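(* Let $K$ be a simplicial complex on the vertex set $[m]$ without ghost vertices, let $k\ge 3$, let $I_1,\dots,I_k\subset[m]$ be pairwise disjoint, and let $\alpha_j\in\widetilde H^{d(j)}(K_{I_j})\subset H^{m(j)}(\mathcal Z_K)$ for $1\le j\le k$, where $m(j)=d(j)+|I_j|+1$. For $1\le s\le s+r\le k$ put $d(s,r+s)=d(s)+d(s+1)+\cdots+d(r+s)+1$. Suppose that (1) $\widetilde H^{\,d(s,r+s)-1}(K_{I_s\sqcup\cdots\sqcup I_{r+s}})=0$ for all $1\le r\le k-2$ and $1\le s\le k-r$; (2) at least one of the following two conditions holds: (a) the $k$-fold Massey product $\langle\alpha_1,\dots,\alpha_k\rangle$ is defined, or (b) $\widetilde H^{\,d(s,r+s)}(K_{I_s\sqcup\cdots\sqcup I_{r+s}})=0$ for all $1\le r\le k-2$ and $1\le s\le k-r$. Then the $k$-fold Massey product $\langle\alpha_1,\dots,\alpha_k\rangle$ is strictly defined.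
   Context: Coefficients are in $\mathbf k$, a field of characteristic zero or $\mathbb Z$. $K$ is an abstract simplicial complex on $[m]=\{1,\dots,m\}$ (no ghost vertices: $\{i\}\in K$ for all $i$); $K_I=K\cap 2^I$ is the induced subcomplex on $I\subset[m]$. The moment-angle-complex is $\mathcal Z_K=\bigcup_{\sigma\in K}\prod_{i=1}^m Y_i^\sigma$ with $Y_i^\sigma=\mathbb D^2$ if $i\in\sigma$ and $Y_i^\sigma=\mathbb S^1$ if $i\notin\sigma$. Cohomology algebra. $\mathbf k[K]=\mathbf k[v_1,\dots,v_m]/(\prod_{i\in I}v_i : I\notin K)$ is the Stanley–Reisner ring, and $R^*(K)=\Lambda[u_1,\dots,u_m]\otimes\mathbf k[K]/(v_i^2=u_iv_i=0,\ 1\le i\le m)$ is a differential graded algebra with $\deg u_i=1$, $\deg v_i=2$, $du_i=v_i$, $dv_i=0$. It is multigraded by subsets of $[m]$ ($u_i$ and $v_i$ have multidegree $\{i\}$). One has $H^*(\mathcal Z_K)\cong H^*[R^*(K),d]$, and the cohomology of the part of $R^*(K)$ of multidegree $I$ in degree $p$ is $\widetilde H^{p-|I|-1}(K_I)$ (reduced simplicial cohomology), so $H^p(\mathcal Z_K)\cong\bigoplus_{I\subset[m]}\widetilde H^{p-|I|-1}(K_I)$. Massey products in $H^*(\mathcal Z_K)$ are computed in $R^*(K)$. Massey products. Let $(A,d)$ be a dga, $\alpha_i=[a_i]\in H^{n_i}(A)$, $1\le i\le k$. A defining system for $(\alpha_1,\dots,\alpha_k)$ is a $(k+1)\times(k+1)$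 matrix $C=(c_{i,j})$ of homogeneous elements of $A$ with $c_{i,j}=0$ for $i\ge j$, $c_{i,i+1}=a_i$, and $dC-\bar C\cdot C=a\cdot E_{1,k+1}$ for some $a=a(C)\in A$, where $\bar c_{i,j}=(-1)^{\deg c_{i,j}}c_{i,j}$ and $E_{1,k+1}$ is the matrix with $1$ at position $(1,k+1)$ and zeros elsewhere. Then $a(C)$ is a cocycle of degree $n_1+\cdots+n_k-k+2$. The Massey product $\langle\alpha_1,\dots,\alpha_k\rangle$ is defined if a defining system exists; it is then the set of all classes $[a(C)]$. A defined Massey product is strictly defined if it consists of exactly one element. Multigraded convention. For $\alpha_j\in\widetilde H^{d(j)}(K_{I_j})$ with pairwise disjoint $I_j$, the Massey product $\langle\alpha_1,\dots,\alpha_k\rangle$ is regarded as a subset of the component $\widetilde H^{d(1)+\cdots+d(k)+1}(K_{I_1\sqcup\cdots\sqcup I_k})$ of $H^*(\mathcal Z_K)$: it is formed using defining systems in $R^*(K)$ whose entries $c_{i,j}$, $i<j$, are homogeneous of multidegree $I_i\sqcup\cdots\sqcup I_{j-1}$. *)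

theory Defs
  imports
    "HOL-Algebra.Algebra"
    "HOL-Library.Poly_Mapping"
    "HOL-Library.Disjoint_Sets"
begin

section \<open>Coefficients and simplicial complexes\<close>

text \<open>The coefficients form a field of characteristic zero or (a copy of) the integers.\<close>

definition coefficient_ring :: "'k::comm_ring_1 itself \<Rightarrow> bool" where
  "coefficient_ring _ \<longleftrightarrow>
     ((\<forall>x::'k. x \<noteq> 0 \<longrightarrow> (\<exists>y. x * y = 1)) \<and> inj (of_nat :: nat \<Rightarrow> 'k)) \<or>
     bij (of_int :: int \<Rightarrow> 'k)"

definition simplicial_complex_on :: "nat \<Rightarrow> nat set set \<Rightarrow> bool" where
  "simplicial_complex_on m K \<longleftrightarrow>
     K \<subseteq> Pow {1..m} \<and> {} \<in> K \<and>
     (\<forall>\<sigma>\<in>K. \<forall>\<tau>. \<tau> \<subseteq> \<sigma> \<longrightarrow> \<tau> \<in> K) \<and>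
     (\<forall>i\<in>{1..m}. {i} \<in> K)"

definition induced_subcomplex :: "nat set set \<Rightarrow> nat set \<Rightarrow> nat set set" where
  "induced_subcomplex K I = K \<inter> Pow I"

text \<open>For \<open>s \<le> t\<close>, the degree of the reduced cohomology containing the Massey products of classes
  of degrees \<open>d s, \<dots>, d t\<close>.\<close>

definition massey_degree :: "(nat \<Rightarrow> int) \<Rightarrow> nat \<Rightarrow> nat \<Rightarrow> int" where
  "massey_degree d s t = (\<Sum>j\<in>{s..t}. d j) + 1"


section \<open>Cohomology of cochain complexes\<close>

text \<open>A cochain complex is a family \<open>C\<close> of abelian groups (written multiplicatively, as always
  for HOL-Algebra monoids) with one map \<open>\<delta>\<close> that raises degrees by one.\<close>

definition cocycles :: "(int \<Rightarrow> 'a monoid) \<Rightarrow> ('a \<Rightarrow> 'a) \<Rightarrow> int \<Rightarrow> 'a set" where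
  "cocycles C \<delta> p = {x \<in> carrier (C p). \<delta> x = \<one>\<^bsub>C (p + 1)\<^esub>}"

definition coboundaries :: "(int \<Rightarrow> 'a monoid) \<Rightarrow> ('a \<Rightarrow> 'a) \<Rightarrow> int \<Rightarrow> 'a set" where
  "coboundaries C \<delta> p = \<delta> ` carrier (C (p - 1))"

definition cohomology :: "(int \<Rightarrow> 'a monoid) \<Rightarrow> ('a \<Rightarrow> 'a) \<Rightarrow> int \<Rightarrow> 'a set monoid" where
  "cohomology C \<delta> p = (C p)\<lparr>carrier := cocycles C \<delta> p\<rparr> Mod coboundaries C \<delta> p"

definition cohomology_class :: "(int \<Rightarrow> 'a monoid) \<Rightarrow> ('a \<Rightarrow> 'a) \<Rightarrow> int \<Rightarrow> 'a \<Rightarrow> 'a set" where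
  "cohomology_class C \<delta> p x = coboundaries C \<delta> p #>\<^bsub>C p\<^esub> x"


section \<open>Reduced simplicial cohomology\<close>

text \<open>Simplices are oriented by the order of the vertices. The empty simplex spans the cochains
  of degree \<open>-1\<close>.\<close>

definition simplicial_cochains :: "nat set set \<Rightarrow> int \<Rightarrow> (nat set \<Rightarrow> 'k::comm_ring_1) monoid" where
  "simplicial_cochains K p =
     \<lparr>carrier = {x. \<forall>\<sigma>. \<not> (\<sigma> \<in> K \<and> int (card \<sigma>) = p + 1) \<longrightarrow> x \<sigma> = 0},
      monoid.mult = (\<lambda>x y \<sigma>. x \<sigma> + y \<sigma>),
      one = (\<lambda>\<sigma>. 0)\<rparr>"

definition simplicial_coboundary ::
  "nat set set \<Rightarrow> (nat set \<Rightarrow> 'k::comm_ring_1) \<Rightarrow> (nat set \<Rightarrow> 'k)" where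
  "simplicial_coboundary K x = (\<lambda>\<tau>. if \<tau> \<in> K
     then \<Sum>j\<in>\<tau>. (-1) ^ card {i \<in> \<tau>. i < j} * x (\<tau> - {j}) else 0)"

definition reduced_cohomology ::
  "nat set set \<Rightarrow> int \<Rightarrow> (nat set \<Rightarrow> 'k::comm_ring_1) set monoid" where
  "reduced_cohomology K = cohomology (simplicial_cochains K) (simplicial_coboundary K)"


section \<open>Differential graded algebras and Massey products\<close>

record 'a dga = "'a ring" +
  differential :: "'a \<Rightarrow> 'a"
  graded_part :: "int \<Rightarrow> 'a set"

definition dga_cochains :: "('a, 'b) dga_scheme \<Rightarrow> int \<Rightarrow> 'a monoid" where
  "dga_cochains A p = \<lparr>carrier = graded_part A p, monoid.mult = ring.add A, one = ring.zero A\<rparr>"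

definition dga_cohomology :: "('a, 'b) dga_scheme \<Rightarrow> int \<Rightarrow> 'a set monoid" where
  "dga_cohomology A = cohomology (dga_cochains A) (differential A)"

definition dga_class :: "('a, 'b) dga_scheme \<Rightarrow> int \<Rightarrow> 'a \<Rightarrow> 'a set" where
  "dga_class A = cohomology_class (dga_cochains A) (differential A)"

text \<open>The degree of the entry \<open>c i j\<close>, \<open>i < j\<close>, of a defining system. It is the one forced by the
  defining equation whenever the entry has nonzero differential; for \<open>j = i + 1\<close> it is \<open>n i\<close>.\<close>

definition entry_degree :: "(nat \<Rightarrow> int) \<Rightarrow> nat \<Rightarrow> nat \<Rightarrow> int" where
  "entry_degree n i j = (\<Sum>l\<in>{i..<j}. n l) - (int j - int i) + 1"

definition signed :: "('a, 'b) dga_scheme \<Rightarrow> int \<Rightarrow> 'a \<Rightarrow> 'a" where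
  "signed A p x = (if even p then x else \<ominus>\<^bsub>A\<^esub> x)"

text \<open>\<open>C\<close> is a \<open>(k + 1) \<times> (k + 1)\<close> matrix with indices in \<open>{1..k + 1}\<close>, and the equation is that of
  the matrices \<open>dC - C' \<cdot> C\<close> and \<open>a \<cdot> E\<close>, entry by entry, with \<open>C'\<close> the sign-twisted matrix.\<close>

definition defining_system ::
  "('a, 'b) dga_scheme \<Rightarrow> nat \<Rightarrow> (nat \<Rightarrow> int) \<Rightarrow> (nat \<Rightarrow> 'a set) \<Rightarrow> (nat \<Rightarrow> nat \<Rightarrow> 'a) \<Rightarrow> 'a \<Rightarrow> bool"
  where
  "defining_system A k n \<alpha> C a \<longleftrightarrow>
     (\<forall>i\<in>{1..k+1}. \<forall>j\<in>{1..k+1}.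
        (if i < j then C i j \<in> graded_part A (entry_degree n i j) else C i j = \<zero>\<^bsub>A\<^esub>)) \<and>
     (\<forall>i\<in>{1..k}. dga_class A (n i) (C i (i + 1)) = \<alpha> i) \<and>
     a \<in> carrier A \<and>
     (\<forall>i\<in>{1..k+1}. \<forall>j\<in>{1..k+1}.
        differential A (C i j) \<ominus>\<^bsub>A\<^esub>
          (\<Oplus>\<^bsub>A\<^esub>r\<in>{1..k+1}. signed A (entry_degree n i r) (C i r) \<otimes>\<^bsub>A\<^esub> C r j) =
        (if i = 1 \<and> j = k + 1 then a else \<zero>\<^bsub>A\<^esub>))"

text \<open>Massey products with multigraded defining systems: \<open>M J\<close> is the part of \<open>A\<close> of multidegree
  \<open>J\<close>, and \<open>\<alpha> j\<close> is a class of degree \<open>n j\<close> and of multidegree \<open>I j\<close>. The products are sets of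
  elements of the cohomology of \<open>A\<close> in degree \<open>n 1 + \<dots> + n k - k + 2\<close>.\<close>

definition multigraded_defining_system ::
  "('a, 'b) dga_scheme \<Rightarrow> (nat set \<Rightarrow> 'a set) \<Rightarrow> (nat \<Rightarrow> nat set) \<Rightarrow> nat \<Rightarrow> (nat \<Rightarrow> int) \<Rightarrow>
     (nat \<Rightarrow> 'a set) \<Rightarrow> (nat \<Rightarrow> nat \<Rightarrow> 'a) \<Rightarrow> 'a \<Rightarrow> bool" where
  "multigraded_defining_system A M I k n \<alpha> C a \<longleftrightarrow>
     defining_system A k n \<alpha> C a \<and>
     (\<forall>i j. 1 \<le> i \<and> i < j \<and> j \<le> k + 1 \<longrightarrow> C i j \<in> M (\<Union>l\<in>{i..<j}. I l))"

definition massey_product ::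
  "('a, 'b) dga_scheme \<Rightarrow> (nat set \<Rightarrow> 'a set) \<Rightarrow> (nat \<Rightarrow> nat set) \<Rightarrow> nat \<Rightarrow> (nat \<Rightarrow> int) \<Rightarrow>
     (nat \<Rightarrow> 'a set) \<Rightarrow> 'a set set" where
  "massey_product A M I k n \<alpha> =
     {dga_class A ((\<Sum>j\<in>{1..k}. n j) - int k + 2) a | C a.
        multigraded_defining_system A M I k n \<alpha> C a}"

definition massey_defined ::
  "('a, 'b) dga_scheme \<Rightarrow> (nat set \<Rightarrow> 'a set) \<Rightarrow> (nat \<Rightarrow> nat set) \<Rightarrow> nat \<Rightarrow> (nat \<Rightarrow> int) \<Rightarrow>
     (nat \<Rightarrow> 'a set) \<Rightarrow> bool" where
  "massey_defined A M I k n \<alpha> \<longleftrightarrow> (\<exists>C a. multigraded_defining_system A M I k n \<alpha> C a)"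

definition massey_strictly_defined ::
  "('a, 'b) dga_scheme \<Rightarrow> (nat set \<Rightarrow> 'a set) \<Rightarrow> (nat \<Rightarrow> nat set) \<Rightarrow> nat \<Rightarrow> (nat \<Rightarrow> int) \<Rightarrow>
     (nat \<Rightarrow> 'a set) \<Rightarrow> bool" where
  "massey_strictly_defined A M I k n \<alpha> \<longleftrightarrow>
     massey_defined A M I k n \<alpha> \<and> is_singleton (massey_product A M I k n \<alpha>)"


section \<open>The algebra \<open>\<Lambda>[u\<^sub>1, \<dots>, u\<^sub>m] \<otimes> k[v\<^sub>1, \<dots>, v\<^sub>m]\<close>\<close>

text \<open>An element is given by its coefficients in \<open>k[v\<^sub>1, \<dots>, v\<^sub>m]\<close> with respect to the basis of the
  monomials \<open>u\<^sub>J\<close>, where \<open>u\<^sub>J\<close> is the product of the \<open>u\<^sub>j\<close> with \<open>j \<in> J\<close> in increasing order.\<close>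

type_synonym 'k vpoly = "(nat \<Rightarrow>\<^sub>0 nat) \<Rightarrow>\<^sub>0 'k"
type_synonym 'k uvpoly = "nat set \<Rightarrow> 'k vpoly"

definition vvar :: "nat \<Rightarrow> 'k::comm_ring_1 vpoly" where
  "vvar i = Poly_Mapping.single (Poly_Mapping.single i 1) 1"

text \<open>For disjoint \<open>J\<close>, \<open>L\<close> this is the sign in \<open>u\<^sub>J u\<^sub>L = \<plusminus> u\<^sub>J\<^sub>\<union>\<^sub>L\<close>.\<close>

definition shuffle_sign :: "nat set \<Rightarrow> nat set \<Rightarrow> 'k::comm_ring_1" where
  "shuffle_sign J L = (-1) ^ card {(a, b) \<in> J \<times> L. b < a}"

definition uv_algebra :: "nat \<Rightarrow> 'k::comm_ring_1 uvpoly ring" where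
  "uv_algebra m =
     \<lparr>carrier = {x. (\<forall>J. \<not> J \<subseteq> {1..m} \<longrightarrow> x J = 0) \<and>
                   (\<forall>J. \<forall>e\<in>Poly_Mapping.keys (x J). Poly_Mapping.keys e \<subseteq> {1..m})},
      monoid.mult = (\<lambda>x y S. \<Sum>J\<in>Pow S. shuffle_sign J (S - J) * x J * y (S - J)),
      one = (\<lambda>S. if S = {} then 1 else 0),
      ring.zero = (\<lambda>S. 0),
      ring.add = (\<lambda>x y S. x S + y S)\<rparr>"

text \<open>\<open>uv_term J p\<close> is the element \<open>u\<^sub>J p\<close>.\<close>

definition uv_term :: "nat set \<Rightarrow> 'k::comm_ring_1 vpoly \<Rightarrow> 'k uvpoly" where
  "uv_term J p = (\<lambda>S. if S = J then p else 0)"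

text \<open>The derivation with \<open>d u\<^sub>i = v\<^sub>i\<close> and \<open>d v\<^sub>i = 0\<close>, that is, with
  \<open>d u\<^sub>J = \<Sum>\<^sub>j\<^sub>\<in>\<^sub>J \<plusminus> v\<^sub>j u\<^sub>J\<^sub>-\<^sub>j\<close>, the sign being given by the number of elements of \<open>J\<close> before \<open>j\<close>.\<close>

definition uv_diff :: "nat \<Rightarrow> 'k::comm_ring_1 uvpoly \<Rightarrow> 'k uvpoly" where
  "uv_diff m x = (\<lambda>S. \<Sum>j\<in>{1..m} - S. (-1) ^ card {i \<in> S. i < j} * vvar j * x (insert j S))"

lemma uv_diff_u: "i \<in> {1..m} \<Longrightarrow> uv_diff m (uv_term {i} 1) = uv_term {} (vvar i)"
proof
  fix S assume i: "i \<in> {1..m}"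
  have *: "insert j S = {i} \<longleftrightarrow> j = i \<and> S = {}" if "j \<in> {1..m} - S" for j
    using that by auto
  have "uv_diff m (uv_term {i} 1) S =
      (\<Sum>j\<in>{1..m} - S. if j = i then (if S = {} then vvar i else 0) else 0 :: 'a vpoly)"
    unfolding uv_diff_def uv_term_def by (rule sum.cong[OF refl], simp only: *, auto)
  then show "uv_diff m (uv_term {i} 1) S = (uv_term {} (vvar i) S :: 'a vpoly)"
    using i by (auto simp: uv_term_def)
qed

lemma uv_diff_v: "uv_diff m (uv_term {} p) = (\<lambda>S. 0)"
  by (auto simp: uv_diff_def uv_term_def intro!: sum.neutral)

definition uv_degree_part :: "nat \<Rightarrow> int \<Rightarrow> 'k::comm_ring_1 uvpoly set" where
  "uv_degree_part m p = {x \<in> carrier (uv_algebra m).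
     \<forall>J. \<forall>e\<in>Poly_Mapping.keys (x J).
       int (card J) + 2 * int (\<Sum>i\<in>Poly_Mapping.keys e. Poly_Mapping.lookup e i) = p}"

definition uv_multidegree_part :: "nat \<Rightarrow> nat set \<Rightarrow> 'k::comm_ring_1 uvpoly set" where
  "uv_multidegree_part m I = {x \<in> carrier (uv_algebra m).
     \<forall>J. \<forall>e\<in>Poly_Mapping.keys (x J).
       \<forall>i. of_bool (i \<in> J) + Poly_Mapping.lookup e i = (of_bool (i \<in> I) :: nat)}"


section \<open>The algebra \<open>R\<^sup>*(K)\<close>\<close>

text \<open>The Stanley--Reisner relations and the relations \<open>v\<^sub>i\<^sup>2 = u\<^sub>i v\<^sub>i = 0\<close> are imposed at once.\<close>

definition R_relations :: "nat \<Rightarrow> nat set set \<Rightarrow> 'k::comm_ring_1 uvpoly set" where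
  "R_relations m K =
     {uv_term {} (\<Prod>i\<in>I. vvar i) | I. I \<subseteq> {1..m} \<and> I \<notin> K} \<union>
     {uv_term {} (vvar i ^ 2) | i. i \<in> {1..m}} \<union>
     {uv_term {i} (vvar i) | i. i \<in> {1..m}}"

definition R_ideal :: "nat \<Rightarrow> nat set set \<Rightarrow> 'k::comm_ring_1 uvpoly set" where
  "R_ideal m K = Idl\<^bsub>uv_algebra m\<^esub> (R_relations m K)"

definition R_proj :: "nat \<Rightarrow> nat set set \<Rightarrow> 'k::comm_ring_1 uvpoly \<Rightarrow> 'k uvpoly set" where
  "R_proj m K x = R_ideal m K +>\<^bsub>uv_algebra m\<^esub> x"

definition R_algebra :: "nat \<Rightarrow> nat set set \<Rightarrow> 'k::comm_ring_1 uvpoly set dga" where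
  "R_algebra m K = ring.extend (uv_algebra m Quot R_ideal m K)
     (dga.fields
        (\<lambda>Y. \<Union>x\<in>Y. R_proj m K (uv_diff m x))
        (\<lambda>p. R_proj m K ` uv_degree_part m p))"

definition R_multidegree_part ::
  "nat \<Rightarrow> nat set set \<Rightarrow> nat set \<Rightarrow> 'k::comm_ring_1 uvpoly set set" where
  "R_multidegree_part m K I = R_proj m K ` uv_multidegree_part m I"


section \<open>Reduced cohomology of induced subcomplexes in the cohomology of \<open>R\<^sup>*(K)\<close>\<close>

text \<open>The cochain map that sends the cochain dual to a simplex \<open>L \<subseteq> I\<close> to
  \<open>\<epsilon>(L, I) u\<^sub>I\<^sub>-\<^sub>L v\<^sub>L\<close>, where \<open>\<epsilon>(L, I)\<close> is the product over \<open>l \<in> L\<close> of \<open>(-1)\<^sup>r\<^sup>-\<^sup>1\<close> for \<open>l\<close> the \<open>r\<close>-th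
  element of \<open>I\<close>. It induces the isomorphism of the reduced cohomology of \<open>K\<^sub>I\<close> with the
  cohomology of the part of \<open>R\<^sup>*(K)\<close> of multidegree \<open>I\<close>; a cochain of degree \<open>d\<close> goes to
  degree \<open>d + card I + 1\<close>.\<close>

definition position_sign :: "nat set \<Rightarrow> nat set \<Rightarrow> 'k::comm_ring_1" where
  "position_sign L I = (\<Prod>l\<in>L. (-1) ^ card {i \<in> I. i < l})"

definition cochain_to_uv :: "nat set \<Rightarrow> (nat set \<Rightarrow> 'k::comm_ring_1) \<Rightarrow> 'k uvpoly" where
  "cochain_to_uv I x = (\<lambda>J. if J \<subseteq> I
     then Poly_Mapping.single 0 (position_sign (I - J) I * x (I - J)) * (\<Prod>i\<in>I - J. vvar i)
     else 0)"

definition class_to_R ::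
  "nat \<Rightarrow> nat set set \<Rightarrow> nat set \<Rightarrow> int \<Rightarrow> (nat set \<Rightarrow> 'k::comm_ring_1) set \<Rightarrow> 'k uvpoly set set"
  where
  "class_to_R m K I d \<alpha> =
     (\<Union>x\<in>\<alpha>. dga_class (R_algebra m K) (d + int (card I) + 1) (R_proj m K (cochain_to_uv I x)))"

end

(*
  The entries of two defining systems C, C' of the same classes form matrices with dC = -T(C) C and
  dC' = -T(C') C' off the corner, where T multiplies an entry of degree n in C by (-1)^(n - 1).
  They are compared through a gauge transformation 1 + B solving dB = C - C' + T(B) C - C' B. Entry
  (i, j) of the right-hand side is a cocycle that involves only the entries of B inside the interval
  from i to j, so condition (1) yields B by induction on j - i; on the corner the differential of the
  right-hand side is the difference of the two values, which are therefore cohomologous. Under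
  condition (b) a defining system itself is built by the same induction. All this is applied to
  representatives supported on the monomials u_J v_L with J and L disjoint and L in K, on which
  the part of multidegree I is the augmented simplicial cochain complex of K_I.
*)

theory Submission
  imports Defs "HOL-Library.Function_Algebras"
begin

section \<open>Gauge transformations between defining systems\<close>

text \<open>Condition (1) sits in the degree of the entries: with
  \<open>n l = d l + |I l| + 1\<close>, the entry \<open>C i j\<close> corresponds to simplicial
  degree \<open>d i + ... + d (j - 1)\<close>, which is \<open>massey_degree - 1\<close>. Condition
  (b) sits one degree higher, where products of entries live. So uniqueness and existence are one
  induction, run in two degrees. Entries cannot be compared one at a time, since changing one alters
  every product that contains it; the matrix B carries all corrections together. Condition (1)
  starts at two consecutive index sets and says nothing about a single \<open>I s\<close>. There B
  comes from the equality of the represented classes. That equality yields a primitive in a degree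
  part of the whole algebra only, and the primitive is cut down to the right multidegree, which the
  differential preserves. The quotient ring consists of cosets, awkward for computing with signs.
  Its relations are monomials, so the ideal is a span of monomials and the remaining monomials give
  canonical representatives; on these, product and differential are total functions on a plain
  type.\<close>

definition parity_sign :: "int \<Rightarrow> 'a::ab_group_add \<Rightarrow> 'a" where
  "parity_sign p x = (if even p then x else - x)"

lemma parity_sign_parity_sign: "parity_sign p (parity_sign q x) = parity_sign (p + q) x"
  by (auto simp: parity_sign_def)

lemma parity_sign_zero [simp]: "parity_sign p 0 = 0"
  by (simp add: parity_sign_def)

lemma parity_sign_add: "parity_sign p (x + y) = parity_sign p x + parity_sign p y"
  by (simp add: parity_sign_def)

lemma parity_sign_sum: "parity_sign p (\<Sum>i\<in>S. f i) = (\<Sum>i\<in>S. parity_sign p (f i))"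
  by (simp add: parity_sign_def sum_negf)

lemma parity_sign_self: "parity_sign p (parity_sign p x) = x"
  by (simp add: parity_sign_def)

text \<open>Both sides run over the triples \<open>i < s < r < j\<close>. This aligns the two
  families of triple products that arise when a sum of products is differentiated.\<close>

lemma sum_greaterThanLessThan_swap:
  fixes i j :: nat
  shows "(\<Sum>r\<in>{i<..<j}. \<Sum>s\<in>{i<..<r}. f s r) = (\<Sum>s\<in>{i<..<j}. \<Sum>r\<in>{s<..<j}. f s r)"
proof -
  have "(\<Sum>r\<in>{i<..<j}. \<Sum>s\<in>{i<..<r}. f s r) =
      (\<Sum>r\<in>{i<..<j}. \<Sum>s | s \<in> {i<..<j} \<and> s < r. f s r)"
    by (intro sum.cong) auto
  also have "\<dots> = (\<Sum>s\<in>{i<..<j}. \<Sum>r | r \<in> {i<..<j} \<and> s < r. f s r)"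
    by (rule sum.swap_restrict) auto
  also have "\<dots> = (\<Sum>s\<in>{i<..<j}. \<Sum>r\<in>{s<..<j}. f s r)"
    by (intro sum.cong) auto
  finally show ?thesis .
qed

text \<open>No interval contains another one of the same length, so the values at all intervals of
  length \<open>l + 1\<close> can be chosen independently. By \<open>cong\<close> the property at an
  interval reads only the entries inside it, which lets the separate choices be merged into one
  matrix.\<close>

lemma interval_choice:
  fixes P :: "(nat \<Rightarrow> nat \<Rightarrow> 'a) \<Rightarrow> nat \<Rightarrow> nat \<Rightarrow> bool"
  assumes cong: "\<And>b b' i j. (\<And>i' j'. i \<le> i' \<Longrightarrow> i' < j' \<Longrightarrow> j' \<le> j \<Longrightarrow> b i' j' = b' i' j') \<Longrightarrow>
      P b i j \<Longrightarrow> P b' i j"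
    and step: "\<And>b i j. i < j \<Longrightarrow>
      (\<And>i' j'. i \<le> i' \<Longrightarrow> i' < j' \<Longrightarrow> j' \<le> j \<Longrightarrow> j' - i' < j - i \<Longrightarrow> P b i' j') \<Longrightarrow>
      \<exists>w. P (b(i := (b i)(j := w))) i j"
  shows "\<exists>b. \<forall>i j. i < j \<and> j - i \<le> l \<longrightarrow> P b i j"
proof (induction l)
  case 0
  then show ?case by auto
next
  case (Suc l)
  then obtain b where b: "\<And>i j. i < j \<Longrightarrow> j - i \<le> l \<Longrightarrow> P b i j" by blast
  have "\<exists>w. P (b(i := (b i)(j := w))) i j" if "i < j" "j - i = Suc l" for i j
    using that by (intro step) (auto intro!: b)
  then obtain w where w: "\<And>i j. i < j \<Longrightarrow> j - i = Suc l \<Longrightarrow> P (b(i := (b i)(j := w i j))) i j"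
    by metis
  define b' where "b' i j = (if j - i = Suc l then w i j else b i j)" for i j
  have "P b' i j" if "i < j" "j - i \<le> Suc l" for i j
  proof (cases "j - i = Suc l")
    case True
    show ?thesis
      by (rule cong[OF _ w[OF that(1) True]]) (use True in \<open>auto simp: b'_def\<close>)
  next
    case False
    then have "P b i j" using that by (intro b) auto
    then show ?thesis
      by (rule cong[rotated]) (use False that in \<open>auto simp: b'_def\<close>)
  qed
  then show ?case by blast
qed

text \<open>\<open>H i j p\<close> stands for the part of degree \<open>p\<close> whose multidegree
  is the union of \<open>I i\<close>, ..., \<open>I (j - 1)\<close>. Products are controlled only
  for adjacent intervals inside \<open>{1..k+1}\<close>, where the index sets are disjoint. The
  operations live on a whole type, so only membership in \<open>H\<close> has to be tracked;
  \<open>e_add\<close> is the one property of entry degrees behind all signs and degree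
  counts.\<close>

locale interval_graded_dga =
  fixes mul :: "'a::ab_group_add \<Rightarrow> 'a \<Rightarrow> 'a" (infixl "\<star>" 70)
    and D :: "'a \<Rightarrow> 'a"
    and H :: "nat \<Rightarrow> nat \<Rightarrow> int \<Rightarrow> 'a set"
    and k :: nat
    and e :: "nat \<Rightarrow> nat \<Rightarrow> int"
  assumes mul_add_left: "(x + y) \<star> z = x \<star> z + y \<star> z"
    and mul_add_right: "x \<star> (y + z) = x \<star> y + x \<star> z"
    and mul_assoc: "x \<star> y \<star> z = x \<star> (y \<star> z)"
    and D_add: "D (x + y) = D x + D y"
    and D_D: "D (D x) = 0"
    and Leibniz: "x \<in> H i j p \<Longrightarrow> D (x \<star> y) = D x \<star> y + parity_sign p (x \<star> D y)"
    and H_zero: "0 \<in> H i j p"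
    and H_add: "x \<in> H i j p \<Longrightarrow> y \<in> H i j p \<Longrightarrow> x + y \<in> H i j p"
    and H_uminus: "x \<in> H i j p \<Longrightarrow> - x \<in> H i j p"
    and H_D: "x \<in> H i j p \<Longrightarrow> D x \<in> H i j (p + 1)"
    and H_mul: "1 \<le> i \<Longrightarrow> i < r \<Longrightarrow> r < j \<Longrightarrow> j \<le> k + 1 \<Longrightarrow>
        x \<in> H i r p \<Longrightarrow> y \<in> H r j q \<Longrightarrow> x \<star> y \<in> H i j (p + q)"
    and e_add: "i < r \<Longrightarrow> r < j \<Longrightarrow> e i r + e r j = e i j + 1"
begin

sublocale D: additive D
  by standard (rule D_add)

sublocale left: additive "\<lambda>x. x \<star> y" for y
  by standard (rule mul_add_left)

sublocale right: additive "\<lambda>y. x \<star> y" for x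
  by standard (rule mul_add_right)

lemma D_parity_sign: "D (parity_sign p x) = parity_sign p (D x)"
  by (simp add: parity_sign_def D.minus)

lemma mul_parity_sign_left: "parity_sign p x \<star> y = parity_sign p (x \<star> y)"
  by (simp add: parity_sign_def left.minus)

lemma mul_parity_sign_right: "x \<star> parity_sign p y = parity_sign p (x \<star> y)"
  by (simp add: parity_sign_def right.minus)

lemma H_parity_sign: "x \<in> H i j p \<Longrightarrow> parity_sign q x \<in> H i j p"
  by (simp add: parity_sign_def H_uminus)

lemma H_diff: "x \<in> H i j p \<Longrightarrow> y \<in> H i j p \<Longrightarrow> x - y \<in> H i j p"
  using H_add[of x i j p "- y"] H_uminus[of y i j p] by simp

lemma H_sum: "(\<And>s. s \<in> S \<Longrightarrow> f s \<in> H i j p) \<Longrightarrow> sum f S \<in> H i j p"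
  by (induction S rule: infinite_finite_induct) (auto intro: H_zero H_add)

text \<open>Entry \<open>(i, j)\<close> of the product of the sign-twisted matrix with
  \<open>C\<close>; strict triangularity leaves only the indices strictly between \<open>i\<close>
  and \<open>j\<close>.\<close>

definition twisted_square :: "(nat \<Rightarrow> nat \<Rightarrow> 'a) \<Rightarrow> nat \<Rightarrow> nat \<Rightarrow> 'a" where
  "twisted_square C i j = (\<Sum>r\<in>{i<..<j}. parity_sign (e i r) (C i r \<star> C r j))"

text \<open>The element \<open>a\<close> enters only at the corner, so the corner entry may be any
  element of its part: changing it changes \<open>a\<close> by a coboundary.\<close>

definition massey_system :: "(nat \<Rightarrow> nat \<Rightarrow> 'a) \<Rightarrow> 'a \<Rightarrow> bool" where
  "massey_system C a \<longleftrightarrow> (\<forall>i j. 1 \<le> i \<and> i < j \<and> j \<le> k + 1 \<longrightarrow>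
     C i j \<in> H i j (e i j) \<and>
     D (C i j) = twisted_square C i j + (if i = 1 \<and> j = k + 1 then a else 0))"

text \<open>The right-hand side of the equation \<open>dB = C - C' + T(B) C - C' B\<close> saying that the
  unipotent matrix \<open>1 + B\<close> is a gauge transformation between \<open>C\<close> and \<open>C'\<close>. Here \<open>T\<close> multiplies
  the \<open>(i, j)\<close> entry by \<open>(-1)\<^sup>n\<close> for \<open>n = e i j - 1\<close>, the degree of the entry \<open>B i j\<close>.\<close>

definition gauge_term ::
  "(nat \<Rightarrow> nat \<Rightarrow> 'a) \<Rightarrow> (nat \<Rightarrow> nat \<Rightarrow> 'a) \<Rightarrow> (nat \<Rightarrow> nat \<Rightarrow> 'a) \<Rightarrow> nat \<Rightarrow> nat \<Rightarrow> 'a" where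
  "gauge_term C C' B i j = C i j - C' i j +
     (\<Sum>r\<in>{i<..<j}. parity_sign (e i r - 1) (B i r \<star> C r j) - C' i r \<star> B r j)"

lemma twisted_square_in_H:
  assumes "1 \<le> i" "j \<le> k + 1"
    and C: "\<And>r s. i \<le> r \<Longrightarrow> r < s \<Longrightarrow> s \<le> j \<Longrightarrow> s - r < j - i \<Longrightarrow> C r s \<in> H r s (e r s)"
  shows "twisted_square C i j \<in> H i j (e i j + 1)"
  unfolding twisted_square_def
proof (intro H_sum H_parity_sign)
  fix r assume r: "r \<in> {i<..<j}"
  have "C i r \<in> H i r (e i r)" "C r j \<in> H r j (e r j)" using r by (auto intro!: C)
  then have "C i r \<star> C r j \<in> H i j (e i r + e r j)"
    using assms(1,2) r by (intro H_mul) auto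
  then show "C i r \<star> C r j \<in> H i j (e i j + 1)"
    using e_add[of i r j] r by simp
qed

text \<open>The Leibniz rule yields each triple product \<open>C i s\<close>, \<open>C s r\<close>,
  \<open>C r j\<close> twice, once from the left factor and once from the right one, and
  \<open>e i s + e s r = e i r + 1\<close> makes the two signs opposite. Hence the obstruction to
  choosing \<open>C i j\<close> is a cocycle.\<close>

lemma D_twisted_square:
  assumes C: "\<And>r s. i \<le> r \<Longrightarrow> r < s \<Longrightarrow> s \<le> j \<Longrightarrow> s - r < j - i \<Longrightarrow>
      C r s \<in> H r s (e r s) \<and> D (C r s) = twisted_square C r s"
  shows "D (twisted_square C i j) = 0"
proof -
  have "D (twisted_square C i j) =
      (\<Sum>r\<in>{i<..<j}. parity_sign (e i r) (twisted_square C i r \<star> C r j) +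
        C i r \<star> twisted_square C r j)"
    unfolding twisted_square_def[of C i j] D.sum
  proof (rule sum.cong[OF refl])
    fix r assume "r \<in> {i<..<j}"
    then have "C i r \<in> H i r (e i r)" "D (C i r) = twisted_square C i r"
      "D (C r j) = twisted_square C r j"
      using C by auto
    then show "D (parity_sign (e i r) (C i r \<star> C r j)) =
        parity_sign (e i r) (twisted_square C i r \<star> C r j) + C i r \<star> twisted_square C r j"
      by (simp add: D_parity_sign Leibniz parity_sign_add parity_sign_self)
  qed
  also have "\<dots> =
      (\<Sum>r\<in>{i<..<j}. \<Sum>s\<in>{i<..<r}. parity_sign (e i r + e i s) (C i s \<star> (C s r \<star> C r j))) +
      (\<Sum>r\<in>{i<..<j}. \<Sum>s\<in>{r<..<j}. parity_sign (e r s) (C i r \<star> (C r s \<star> C s j)))"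
    by (simp add: sum.distrib twisted_square_def left.sum right.sum parity_sign_sum
        mul_parity_sign_left mul_parity_sign_right parity_sign_parity_sign mul_assoc)
  also have "\<dots> = 0"
    unfolding sum_greaterThanLessThan_swap sum.distrib[symmetric]
  proof (intro sum.neutral ballI)
    fix s r assume "s \<in> {i<..<j}" "r \<in> {s<..<j}"
    then have "e i s + e s r = e i r + 1" by (intro e_add) auto
    then have "even (e i r + e i s) \<longleftrightarrow> odd (e s r)" by presburger
    then show "parity_sign (e i r + e i s) (C i s \<star> (C s r \<star> C r j)) +
        parity_sign (e s r) (C i s \<star> (C s r \<star> C r j)) = 0"
      by (simp add: parity_sign_def)
  qed
  finally show ?thesis .
qed

lemma gauge_term_in_H:
  assumes "1 \<le> i" "j \<le> k + 1"
    and "C i j \<in> H i j (e i j)" "C' i j \<in> H i j (e i j)"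
    and C: "\<And>r s. i \<le> r \<Longrightarrow> r < s \<Longrightarrow> s \<le> j \<Longrightarrow> s - r < j - i \<Longrightarrow>
      C r s \<in> H r s (e r s) \<and> C' r s \<in> H r s (e r s) \<and> B r s \<in> H r s (e r s - 1)"
  shows "gauge_term C C' B i j \<in> H i j (e i j)"
  unfolding gauge_term_def
proof (intro H_add H_diff[of "C i j"] H_sum assms(3,4))
  fix r assume r: "r \<in> {i<..<j}"
  have "B i r \<star> C r j \<in> H i j (e i r - 1 + e r j)" "C' i r \<star> B r j \<in> H i j (e i r + (e r j - 1))"
    using assms(1,2) r by (auto intro!: H_mul C[THEN conjunct1] C[THEN conjunct2, THEN conjunct1]
        C[THEN conjunct2, THEN conjunct2])
  moreover have "e i r + e r j = e i j + 1" using r by (intro e_add) auto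
  then have "e i r - 1 + e r j = e i j" "e i r + (e r j - 1) = e i j" by simp_all
  ultimately have "B i r \<star> C r j \<in> H i j (e i j)" "C' i r \<star> B r j \<in> H i j (e i j)"
    by simp_all
  then show "parity_sign (e i r - 1) (B i r \<star> C r j) - C' i r \<star> B r j \<in> H i j (e i j)"
    by (intro H_diff H_parity_sign)
qed

text \<open>Differentiating \<open>B C\<close> and \<open>C' B\<close> brings in the gauge equation
  of the inner entries of \<open>B\<close>. The mixed products \<open>C' C\<close> cancel between
  the two, the products \<open>C C\<close> and \<open>C' C'\<close> cancel against the twisted
  squares coming from \<open>C - C'\<close>, and only triple products remain to be matched.\<close>

lemma D_gauge_term:
  assumes C: "\<And>r s. i \<le> r \<Longrightarrow> r < s \<Longrightarrow> s \<le> j \<Longrightarrow> s - r < j - i \<Longrightarrow>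
      C r s \<in> H r s (e r s) \<and> D (C r s) = twisted_square C r s"
    and C': "\<And>r s. i \<le> r \<Longrightarrow> r < s \<Longrightarrow> s \<le> j \<Longrightarrow> s - r < j - i \<Longrightarrow>
      C' r s \<in> H r s (e r s) \<and> D (C' r s) = twisted_square C' r s"
    and B: "\<And>r s. i \<le> r \<Longrightarrow> r < s \<Longrightarrow> s \<le> j \<Longrightarrow> s - r < j - i \<Longrightarrow>
      B r s \<in> H r s (e r s - 1) \<and> D (B r s) = gauge_term C C' B r s"
    and Cij: "D (C i j) = twisted_square C i j + a"
    and C'ij: "D (C' i j) = twisted_square C' i j + a'"
  shows "D (gauge_term C C' B i j) = a - a'"
proof -
  \<comment> \<open>\<open>F1\<close> and \<open>F4\<close> come from the gauge equation of
    \<open>B i r\<close> and \<open>B r j\<close>, \<open>F2\<close> and \<open>F3\<close> from the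
    defining equations of \<open>C r j\<close> and \<open>C' i r\<close>. The terms
    \<open>B C C\<close> cancel between \<open>F1\<close> and \<open>F2\<close>,
    \<open>C' B C\<close> between \<open>F1\<close> and \<open>F4\<close>, and
    \<open>C' C' B\<close> between \<open>F3\<close> and \<open>F4\<close>.\<close>
  define F1 where "F1 s r = parity_sign (e i r - 1)
    (parity_sign (e i s - 1) (B i s \<star> (C s r \<star> C r j)) - C' i s \<star> (B s r \<star> C r j))" for s r
  define F2 where "F2 s r = parity_sign (e s r) (B i s \<star> (C s r \<star> C r j))" for s r
  define F3 where "F3 s r = parity_sign (e i s) (C' i s \<star> (C' s r \<star> B r j))" for s r
  define F4 where "F4 s r = parity_sign (e i s)
    (parity_sign (e s r - 1) (C' i s \<star> (B s r \<star> C r j)) - C' i s \<star> (C' s r \<star> B r j))" for s r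
  have D_terms: "D (parity_sign (e i r - 1) (B i r \<star> C r j) - C' i r \<star> B r j) =
      parity_sign (e i r) (C' i r \<star> C' r j) - parity_sign (e i r) (C i r \<star> C r j) +
      (\<Sum>s\<in>{i<..<r}. F1 s r) + (\<Sum>s\<in>{r<..<j}. F2 r s) -
      (\<Sum>s\<in>{i<..<r}. F3 s r) - (\<Sum>s\<in>{r<..<j}. F4 r s)"
    if "r \<in> {i<..<j}" for r
  proof -
    have "B i r \<in> H i r (e i r - 1)" "C' i r \<in> H i r (e i r)"
      "D (B i r) = gauge_term C C' B i r" "D (B r j) = gauge_term C C' B r j"
      "D (C' i r) = twisted_square C' i r" "D (C r j) = twisted_square C r j"
      using that B C C' by auto
    then have "D (parity_sign (e i r - 1) (B i r \<star> C r j) - C' i r \<star> B r j) =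
        parity_sign (e i r - 1) (gauge_term C C' B i r \<star> C r j) + B i r \<star> twisted_square C r j -
        (twisted_square C' i r \<star> B r j + parity_sign (e i r) (C' i r \<star> gauge_term C C' B r j))"
      by (simp add: D.diff D_parity_sign Leibniz parity_sign_add parity_sign_self)
    also have "parity_sign (e i r - 1) (gauge_term C C' B i r \<star> C r j) =
        parity_sign (e i r - 1) (C i r \<star> C r j - C' i r \<star> C r j) + (\<Sum>s\<in>{i<..<r}. F1 s r)"
      unfolding gauge_term_def[of C C' B] F1_def
      by (simp add: left.sum left.add left.diff parity_sign_sum parity_sign_add
          mul_parity_sign_left mul_assoc)
    also have "B i r \<star> twisted_square C r j = (\<Sum>s\<in>{r<..<j}. F2 r s)"
      unfolding twisted_square_def F2_def by (simp add: right.sum mul_parity_sign_right)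
    also have "twisted_square C' i r \<star> B r j = (\<Sum>s\<in>{i<..<r}. F3 s r)"
      unfolding twisted_square_def F3_def by (simp add: left.sum mul_parity_sign_left mul_assoc)
    also have "parity_sign (e i r) (C' i r \<star> gauge_term C C' B r j) =
        parity_sign (e i r) (C' i r \<star> C r j - C' i r \<star> C' r j) + (\<Sum>s\<in>{r<..<j}. F4 r s)"
      unfolding gauge_term_def[of C C' B] F4_def
      by (simp add: right.sum right.add right.diff parity_sign_sum parity_sign_add
          mul_parity_sign_right)
    finally show ?thesis
      by (simp add: parity_sign_def)
  qed
  have triples: "(\<Sum>s\<in>{i<..<j}. \<Sum>r\<in>{s<..<j}. F1 s r + F2 s r - F3 s r - F4 s r) = 0"
  proof (intro sum.neutral ballI)
    fix s r assume "s \<in> {i<..<j}" "r \<in> {s<..<j}"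
    then have "e i s + e s r = e i r + 1" by (intro e_add) auto
    then have "e i r = e i s + e s r - 1" by simp
    then show "F1 s r + F2 s r - F3 s r - F4 s r = 0"
      unfolding F1_def F2_def F3_def F4_def
      by (cases "even (e i s)"; cases "even (e s r)") (simp_all add: parity_sign_def)
  qed
  have "D (gauge_term C C' B i j) = twisted_square C i j + a - (twisted_square C' i j + a') +
      (\<Sum>r\<in>{i<..<j}. parity_sign (e i r) (C' i r \<star> C' r j) - parity_sign (e i r) (C i r \<star> C r j) +
      (\<Sum>s\<in>{i<..<r}. F1 s r) + (\<Sum>s\<in>{r<..<j}. F2 r s) -
      (\<Sum>s\<in>{i<..<r}. F3 s r) - (\<Sum>s\<in>{r<..<j}. F4 r s))"
    unfolding gauge_term_def[of C C' B i j] D.add D.diff[of "C i j"] Cij C'ij D.sum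
    by (simp add: D_terms)
  also have "\<dots> = a - a' +
      (\<Sum>s\<in>{i<..<j}. \<Sum>r\<in>{s<..<j}. F1 s r + F2 s r - F3 s r - F4 s r)"
    unfolding sum.distrib sum_subtractf sum_greaterThanLessThan_swap twisted_square_def by simp
  finally show ?thesis by (simp add: triples)
qed

text \<open>Next to the diagonal the sum in \<open>gauge_term\<close> is empty and
  \<open>adj\<close> is the equation for \<open>B\<close>; farther away \<open>exact\<close> solves
  it. At the corner no equation is solved: the gauge term itself is the witness
  \<open>x\<close>.\<close>

lemma massey_system_unique:
  assumes C: "massey_system C a" and C': "massey_system C' a'"
    and adj: "\<And>i. 1 \<le> i \<Longrightarrow> i \<le> k \<Longrightarrow>
      \<exists>b\<in>H i (i + 1) (e i (i + 1) - 1). D b = C i (i + 1) - C' i (i + 1)"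
    and exact: "\<And>i j z. 1 \<le> i \<Longrightarrow> i + 1 < j \<Longrightarrow> j \<le> k + 1 \<Longrightarrow> \<not> (i = 1 \<and> j = k + 1) \<Longrightarrow>
      z \<in> H i j (e i j) \<Longrightarrow> D z = 0 \<Longrightarrow> \<exists>b\<in>H i j (e i j - 1). D b = z"
    and "k \<ge> 1"
  shows "\<exists>x\<in>H 1 (k + 1) (e 1 (k + 1)). D x = a - a'"
proof -
  define P where "P B i j \<longleftrightarrow> (1 \<le> i \<and> i < j \<and> j \<le> k + 1 \<and> \<not> (i = 1 \<and> j = k + 1) \<longrightarrow>
    B i j \<in> H i j (e i j - 1) \<and> D (B i j) = gauge_term C C' B i j)" for B i j
  have CH: "C r s \<in> H r s (e r s)" "C' r s \<in> H r s (e r s)"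
    if "1 \<le> r" "r < s" "s \<le> k + 1" for r s
    using that C C' unfolding massey_system_def by simp_all
  have DC: "D (C r s) = twisted_square C r s" "D (C' r s) = twisted_square C' r s"
    if "1 \<le> r" "r < s" "s \<le> k + 1" "\<not> (r = 1 \<and> s = k + 1)" for r s
    using that C C' unfolding massey_system_def by auto
  have "\<exists>B. \<forall>i j. i < j \<and> j - i \<le> k \<longrightarrow> P B i j"
  proof (rule interval_choice)
    fix B B' :: "nat \<Rightarrow> nat \<Rightarrow> 'a" and i j
    assume eq: "\<And>i' j'. i \<le> i' \<Longrightarrow> i' < j' \<Longrightarrow> j' \<le> j \<Longrightarrow> B i' j' = B' i' j'" and "P B i j"
    show "P B' i j"
    proof (cases "i < j")
      case True
      then have "gauge_term C C' B i j = gauge_term C C' B' i j" "B i j = B' i j"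
        using eq by (auto simp: gauge_term_def intro!: sum.cong)
      then show ?thesis using \<open>P B i j\<close> by (simp add: P_def)
    qed (simp add: P_def)
  next
    fix B :: "nat \<Rightarrow> nat \<Rightarrow> 'a" and i j :: nat
    assume "i < j"
      and IH: "\<And>i' j'. i \<le> i' \<Longrightarrow> i' < j' \<Longrightarrow> j' \<le> j \<Longrightarrow> j' - i' < j - i \<Longrightarrow> P B i' j'"
    have "\<exists>w\<in>H i j (e i j - 1). D w = gauge_term C C' B i j"
      if ij: "1 \<le> i" "j \<le> k + 1" "\<not> (i = 1 \<and> j = k + 1)"
    proof (cases "j = i + 1")
      case True
      then show ?thesis
        using adj[of i] ij by (simp add: gauge_term_def atLeastSucLessThan_greaterThanLessThan[symmetric])
    next
      case False
      have B: "B r s \<in> H r s (e r s - 1) \<and> D (B r s) = gauge_term C C' B r s"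
        if "i \<le> r" "r < s" "s \<le> j" "s - r < j - i" for r s
        using IH[OF that] that ij unfolding P_def by auto
      have "gauge_term C C' B i j \<in> H i j (e i j)"
        using ij \<open>i < j\<close> by (intro gauge_term_in_H CH conjI) (auto simp: B)
      \<comment> \<open>Off the corner neither system has a defect, so \<open>D_gauge_term\<close>
        applies with \<open>a = a' = 0\<close>; hence the shape \<open>0 - 0\<close>.\<close>
      moreover have "D (gauge_term C C' B i j) = 0 - 0"
        using ij \<open>i < j\<close> by (intro D_gauge_term conjI CH DC) (auto simp: B DC)
      ultimately show ?thesis
        using exact[of i j] ij False \<open>i < j\<close> by simp
    qed
    then obtain w where w: "1 \<le> i \<Longrightarrow> j \<le> k + 1 \<Longrightarrow> \<not> (i = 1 \<and> j = k + 1) \<Longrightarrow>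
        w \<in> H i j (e i j - 1) \<and> D w = gauge_term C C' B i j"
      by blast
    \<comment> \<open>The gauge term at \<open>(i, j)\<close> reads only strictly shorter entries of
      \<open>B\<close>, so inserting \<open>w\<close> leaves it unchanged.\<close>
    moreover have "gauge_term C C' (B(i := (B i)(j := w))) i j = gauge_term C C' B i j"
      by (auto simp: gauge_term_def intro!: sum.cong)
    ultimately show "\<exists>w. P (B(i := (B i)(j := w))) i j"
      unfolding P_def by (intro exI[of _ w]) simp
  qed
  then obtain B where "\<And>i j. i < j \<Longrightarrow> j - i \<le> k \<Longrightarrow> P B i j" by blast
  then have B: "B r s \<in> H r s (e r s - 1) \<and> D (B r s) = gauge_term C C' B r s"
    if "1 \<le> r" "r < s" "s \<le> k + 1" "\<not> (r = 1 \<and> s = k + 1)" for r s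
    using that unfolding P_def by auto
  have lower: "C r s \<in> H r s (e r s) \<and> C' r s \<in> H r s (e r s) \<and> B r s \<in> H r s (e r s - 1) \<and>
      D (C r s) = twisted_square C r s \<and> D (C' r s) = twisted_square C' r s \<and>
      D (B r s) = gauge_term C C' B r s"
    if "1 \<le> r" "r < s" "s \<le> k + 1" "s - r < k + 1 - 1" for r s
  proof -
    have "\<not> (r = 1 \<and> s = k + 1)" using that by auto
    then show ?thesis using that CH[of r s] DC[of r s] B[of r s] by blast
  qed
  have "gauge_term C C' B 1 (k + 1) \<in> H 1 (k + 1) (e 1 (k + 1))"
    using \<open>k \<ge> 1\<close> lower by (intro gauge_term_in_H CH) simp_all
  moreover have "D (gauge_term C C' B 1 (k + 1)) = a - a'"
  proof (rule D_gauge_term)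
    show "D (C 1 (k + 1)) = twisted_square C 1 (k + 1) + a"
      "D (C' 1 (k + 1)) = twisted_square C' 1 (k + 1) + a'"
      using \<open>k \<ge> 1\<close> C C' unfolding massey_system_def by auto
  qed (use lower in simp_all)
  ultimately show ?thesis by blast
qed

text \<open>The obstruction \<open>twisted_square C i j\<close> lies one degree above the entry, so
  \<open>exact\<close> is stated in degree \<open>e i j + 1\<close>. By \<open>k >= 2\<close> the
  corner is not next to the diagonal, and choosing 0 there cannot clash with a prescribed
  \<open>c i\<close>.\<close>

lemma massey_system_exists:
  assumes c: "\<And>i. 1 \<le> i \<Longrightarrow> i \<le> k \<Longrightarrow> c i \<in> H i (i + 1) (e i (i + 1)) \<and> D (c i) = 0"
    and exact: "\<And>i j z. 1 \<le> i \<Longrightarrow> i + 1 < j \<Longrightarrow> j \<le> k + 1 \<Longrightarrow> \<not> (i = 1 \<and> j = k + 1) \<Longrightarrow>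
      z \<in> H i j (e i j + 1) \<Longrightarrow> D z = 0 \<Longrightarrow> \<exists>w\<in>H i j (e i j). D w = z"
    and "k \<ge> 2"
  shows "\<exists>C a. massey_system C a \<and> (\<forall>i. 1 \<le> i \<and> i \<le> k \<longrightarrow> C i (i + 1) = c i) \<and>
    a \<in> H 1 (k + 1) (e 1 (k + 1) + 1)"
proof -
  define P where "P C i j \<longleftrightarrow> (1 \<le> i \<and> i < j \<and> j \<le> k + 1 \<longrightarrow>
    C i j \<in> H i j (e i j) \<and>
    (if i = 1 \<and> j = k + 1 then C i j = 0 else D (C i j) = twisted_square C i j) \<and>
    (j = i + 1 \<longrightarrow> C i j = c i))" for C i j
  have "\<exists>C. \<forall>i j. i < j \<and> j - i \<le> k \<longrightarrow> P C i j"
  proof (rule interval_choice)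
    fix C C' :: "nat \<Rightarrow> nat \<Rightarrow> 'a" and i j
    assume eq: "\<And>i' j'. i \<le> i' \<Longrightarrow> i' < j' \<Longrightarrow> j' \<le> j \<Longrightarrow> C i' j' = C' i' j'" and "P C i j"
    show "P C' i j"
    proof (cases "i < j")
      case True
      then have "twisted_square C i j = twisted_square C' i j" "C i j = C' i j"
        using eq by (auto simp: twisted_square_def intro!: sum.cong)
      then show ?thesis using \<open>P C i j\<close> unfolding P_def by metis
    qed (simp add: P_def)
  next
    fix C :: "nat \<Rightarrow> nat \<Rightarrow> 'a" and i j :: nat
    assume "i < j"
      and IH: "\<And>i' j'. i \<le> i' \<Longrightarrow> i' < j' \<Longrightarrow> j' \<le> j \<Longrightarrow> j' - i' < j - i \<Longrightarrow> P C i' j'"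
    have "\<exists>w\<in>H i j (e i j).
        (if i = 1 \<and> j = k + 1 then w = 0 else D w = twisted_square C i j) \<and>
        (j = i + 1 \<longrightarrow> w = c i)"
      if ij: "1 \<le> i" "j \<le> k + 1"
    proof -
      consider "j = i + 1" | "i = 1 \<and> j = k + 1" | "j \<noteq> i + 1" "\<not> (i = 1 \<and> j = k + 1)" by blast
      then show ?thesis
      proof cases
        case 1
        then show ?thesis
          using c[of i] ij \<open>k \<ge> 2\<close> by (auto simp: twisted_square_def atLeastSucLessThan_greaterThanLessThan[symmetric])
      next
        case 2
        then show ?thesis using \<open>k \<ge> 2\<close> by (auto intro: H_zero)
      next
        case 3
        have C: "C r s \<in> H r s (e r s) \<and> D (C r s) = twisted_square C r s"
          if "i \<le> r" "r < s" "s \<le> j" "s - r < j - i" for r s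
          using IH[OF that] that ij 3 unfolding P_def by (auto split: if_splits)
        have "twisted_square C i j \<in> H i j (e i j + 1)"
          using ij by (intro twisted_square_in_H) (auto simp: C)
        moreover have "D (twisted_square C i j) = 0"
          using C by (rule D_twisted_square)
        ultimately show ?thesis
          using exact[of i j] ij 3 \<open>i < j\<close> by auto
      qed
    qed
    then obtain w where w: "1 \<le> i \<Longrightarrow> j \<le> k + 1 \<Longrightarrow> w \<in> H i j (e i j) \<and>
        (if i = 1 \<and> j = k + 1 then w = 0 else D w = twisted_square C i j) \<and> (j = i + 1 \<longrightarrow> w = c i)"
      by blast
    moreover have "twisted_square (C(i := (C i)(j := w))) i j = twisted_square C i j"
      by (auto simp: twisted_square_def intro!: sum.cong)
    ultimately show "\<exists>w. P (C(i := (C i)(j := w))) i j"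
      unfolding P_def by (intro exI[of _ w]) simp
  qed
  then obtain C where "\<And>i j. i < j \<Longrightarrow> j - i \<le> k \<Longrightarrow> P C i j" by blast
  then have C: "C i j \<in> H i j (e i j) \<and>
    (if i = 1 \<and> j = k + 1 then C i j = 0 else D (C i j) = twisted_square C i j) \<and>
    (j = i + 1 \<longrightarrow> C i j = c i)" if "1 \<le> i" "i < j" "j \<le> k + 1" for i j
    using that unfolding P_def by auto
  \<comment> \<open>The corner entry is 0, so the equation at the corner forces this value of
    \<open>a\<close>.\<close>
  have "massey_system C (- twisted_square C 1 (k + 1))"
    unfolding massey_system_def using C D.zero by auto
  moreover have "twisted_square C 1 (k + 1) \<in> H 1 (k + 1) (e 1 (k + 1) + 1)"
    using C by (intro twisted_square_in_H) auto
  ultimately show ?thesis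
    using C by (intro exI[of _ C] exI[of _ "- twisted_square C 1 (k + 1)"]) (auto intro: H_uminus)
qed

end


section \<open>Multiplication and differential of the \<open>uv\<close>-algebra\<close>

lemma shuffle_sign_union_left:
  fixes J L M :: "nat set"
  assumes "finite J" "finite L" "J \<inter> L = {}"
  shows "shuffle_sign (J \<union> L) M = shuffle_sign J M * shuffle_sign L M"
proof -
  \<comment> \<open>An inversion \<open>(a, b)\<close> has \<open>b < a\<close>, so a finite left
    set alone bounds their number; \<open>M\<close> may be infinite.\<close>
  have fin: "finite {(a, b) \<in> N \<times> M. b < a}" if "finite N" for N :: "nat set"
    by (rule finite_subset[of _ "Sigma N (\<lambda>a. {..<a})"]) (use that in auto)
  have "{(a, b) \<in> (J \<union> L) \<times> M. b < a} = {(a, b) \<in> J \<times> M. b < a} \<union> {(a, b) \<in> L \<times> M. b < a}"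
    by auto
  moreover have "{(a, b) \<in> J \<times> M. b < a} \<inter> {(a, b) \<in> L \<times> M. b < a} = {}"
    using assms(3) by auto
  ultimately have "card {(a, b) \<in> (J \<union> L) \<times> M. b < a} =
      card {(a, b) \<in> J \<times> M. b < a} + card {(a, b) \<in> L \<times> M. b < a}"
    using fin assms by (simp add: card_Un_disjoint)
  then show ?thesis by (simp add: shuffle_sign_def power_add)
qed

lemma shuffle_sign_union_right:
  fixes J L M :: "nat set"
  assumes "finite J" "L \<inter> M = {}"
  shows "shuffle_sign J (L \<union> M) = shuffle_sign J L * shuffle_sign J M"
proof -
  have fin: "finite {(a, b) \<in> J \<times> N. b < a}" for N :: "nat set"
    by (rule finite_subset[of _ "Sigma J (\<lambda>a. {..<a})"]) (use assms in auto)
  have "{(a, b) \<in> J \<times> (L \<union> M). b < a} = {(a, b) \<in> J \<times> L. b < a} \<union> {(a, b) \<in> J \<times> M. b < a}"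
    by auto
  moreover have "{(a, b) \<in> J \<times> L. b < a} \<inter> {(a, b) \<in> J \<times> M. b < a} = {}"
    using assms(2) by auto
  ultimately have "card {(a, b) \<in> J \<times> (L \<union> M). b < a} =
      card {(a, b) \<in> J \<times> L. b < a} + card {(a, b) \<in> J \<times> M. b < a}"
    using fin by (simp add: card_Un_disjoint)
  then show ?thesis by (simp add: shuffle_sign_def power_add)
qed

lemma shuffle_sign_insert_left:
  "finite J \<Longrightarrow> j \<notin> J \<Longrightarrow> shuffle_sign (insert j J) M = shuffle_sign {j} M * shuffle_sign J M"
  using shuffle_sign_union_left[of "{j}" J M] by simp

lemma shuffle_sign_insert_right:
  "finite J \<Longrightarrow> j \<notin> L \<Longrightarrow> shuffle_sign J (insert j L) = shuffle_sign J {j} * shuffle_sign J L"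
  using shuffle_sign_union_right[of J "{j}" L] by simp

lemma shuffle_sign_empty [simp]: "shuffle_sign {} J = 1" "shuffle_sign J {} = 1"
  by (simp_all add: shuffle_sign_def)

lemma shuffle_sign_square [simp]: "shuffle_sign J L * shuffle_sign J L = (1 :: 'k::comm_ring_1)"
  by (simp add: shuffle_sign_def flip: power_add)

lemma shuffle_sign_square_left [simp]:
  "shuffle_sign J L * (shuffle_sign J L * x) = (x :: 'k::comm_ring_1)"
  by (simp flip: mult.assoc)

lemma shuffle_sign_singleton_left: "shuffle_sign {j} L = (-1) ^ card {i \<in> L. i < j}"
proof -
  have "{(a, b) \<in> {j} \<times> L. b < a} = Pair j ` {i \<in> L. i < j}" by auto
  then have "card {(a, b) \<in> {j} \<times> L. b < a} = card {i \<in> L. i < j}"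
    by (simp add: card_image inj_on_def)
  then show ?thesis by (simp add: shuffle_sign_def)
qed

lemma shuffle_sign_singletons:
  "shuffle_sign {i} {j} = (if j < i then - 1 else 1)"
proof -
  have "{x \<in> {j}. x < i} = (if j < i then {j} else {})" by auto
  then show ?thesis by (simp add: shuffle_sign_singleton_left)
qed

text \<open>For every \<open>i\<close> in \<open>J\<close> exactly one of the pairs
  \<open>(i, j)\<close> and \<open>(j, i)\<close> is an inversion, so the two signs together count
  all of \<open>J\<close>.\<close>

lemma shuffle_sign_commute_singleton:
  assumes "finite J" "j \<notin> J"
  shows "shuffle_sign {j} J * shuffle_sign J {j} = ((-1) ^ card J :: 'k::comm_ring_1)"
  using assms
proof (induction J rule: finite_induct)
  case (insert i J)
  have "shuffle_sign {j} (insert i J) * shuffle_sign (insert i J) {j} =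
      (shuffle_sign {j} {i} * shuffle_sign {i} {j}) *
        (shuffle_sign {j} J * shuffle_sign J {j} :: 'k)"
    using insert(1,2) by (subst shuffle_sign_insert_left, simp_all,
        subst shuffle_sign_insert_right, simp_all only: finite.intros mult_ac)
  also have "\<dots> = (-1) ^ card (insert i J)"
    using insert by (auto simp: shuffle_sign_singletons)
  finally show ?case .
qed simp

text \<open>The product of \<open>uv_algebra m\<close> is independent of \<open>m\<close>. Naming it
  apart from the record gives laws for all functions, without membership in a carrier.\<close>

definition uv_mult :: "'k::comm_ring_1 uvpoly \<Rightarrow> 'k uvpoly \<Rightarrow> 'k uvpoly" where
  "uv_mult x y = (\<lambda>S. \<Sum>J\<in>Pow S. shuffle_sign J (S - J) * x J * y (S - J))"

lemma uv_algebra_simps: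
  "x \<otimes>\<^bsub>uv_algebra m\<^esub> y = uv_mult x y"
  "x \<oplus>\<^bsub>uv_algebra m\<^esub> y = x + y"
  "\<zero>\<^bsub>uv_algebra m\<^esub> = 0"
  by (simp_all add: uv_algebra_def uv_mult_def plus_fun_def zero_fun_def)

lemma uv_diff_eq:
  "uv_diff m x S = (\<Sum>j\<in>{1..m} - S. shuffle_sign {j} S * vvar j * x (insert j S))"
  by (simp add: uv_diff_def shuffle_sign_singleton_left)

text \<open>A sum over the infinite set \<open>Pow S\<close> is 0 by convention. Thus associativity
  and the Leibniz rule hold for arbitrary functions, and their proofs may take \<open>S\<close>
  finite.\<close>

lemma uv_mult_infinite: "infinite S \<Longrightarrow> uv_mult x y S = 0"
  by (simp add: uv_mult_def)

lemma uv_mult_add_left: "uv_mult (x + y) z = uv_mult x z + uv_mult y z"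
  by (simp add: uv_mult_def fun_eq_iff algebra_simps sum.distrib)

lemma uv_mult_add_right: "uv_mult x (y + z) = uv_mult x y + uv_mult x z"
  by (simp add: uv_mult_def fun_eq_iff algebra_simps sum.distrib)

text \<open>Both sides are sums over the ordered partitions of \<open>S\<close> into three blocks
  \<open>J\<close>, \<open>T - J\<close> and \<open>S - T\<close>; either way the sign is the
  product of the three pairwise shuffle signs.\<close>

lemma uv_mult_assoc: "uv_mult (uv_mult x y) z = uv_mult x (uv_mult y z)"
proof
  fix S
  show "uv_mult (uv_mult x y) z S = uv_mult x (uv_mult y z) S"
  proof (cases "finite S")
    case True
    have fin: "finite J" if "J \<subseteq> S" for J using True that by (rule rev_finite_subset)
    have "uv_mult (uv_mult x y) z S = (\<Sum>T\<in>Pow S. \<Sum>J\<in>Pow T.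
        shuffle_sign T (S - T) * shuffle_sign J (T - J) * x J * y (T - J) * z (S - T))"
      by (simp add: uv_mult_def sum_distrib_left sum_distrib_right mult.assoc)
    also have "\<dots> = (\<Sum>(T, J)\<in>Sigma (Pow S) Pow.
        shuffle_sign T (S - T) * shuffle_sign J (T - J) * x J * y (T - J) * z (S - T))"
      using fin True by (intro sum.Sigma) auto
    also have "\<dots> = (\<Sum>(J, L)\<in>Sigma (Pow S) (\<lambda>J. Pow (S - J)).
        shuffle_sign J (S - J) * shuffle_sign L (S - J - L) * x J * y L * z (S - J - L))"
    proof (rule sum.reindex_bij_witness[where i = "\<lambda>(J, L). (J \<union> L, J)" and j = "\<lambda>(T, J). (J, T - J)"])
      fix a assume "a \<in> Sigma (Pow S) Pow"
      then obtain T J where a: "a = (T, J)" "T \<subseteq> S" "J \<subseteq> T" by auto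
      define L where "L = T - J"
      define M where "M = S - T"
      have "T = J \<union> L" "J \<inter> L = {}" "S - J = L \<union> M" "L \<inter> M = {}" "S - J - L = M"
        using a by (auto simp: L_def M_def)
      moreover have "finite J" "finite L" using a fin by (auto simp: L_def)
      ultimately have "shuffle_sign T M * shuffle_sign J L =
          shuffle_sign J (S - J) * (shuffle_sign L (S - J - L) :: 'a vpoly)"
        by (simp add: shuffle_sign_union_left shuffle_sign_union_right)
      then show "(case (case a of (T, J) \<Rightarrow> (J, T - J)) of (J, L) \<Rightarrow>
          shuffle_sign J (S - J) * shuffle_sign L (S - J - L) * x J * y L * z (S - J - L)) =
        (case a of (T, J) \<Rightarrow>
          shuffle_sign T (S - T) * shuffle_sign J (T - J) * x J * y (T - J) * z (S - T))"
        using \<open>S - J - L = M\<close> unfolding a L_def M_def by simp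
    qed auto
    also have "\<dots> = (\<Sum>J\<in>Pow S. \<Sum>L\<in>Pow (S - J).
        shuffle_sign J (S - J) * shuffle_sign L (S - J - L) * x J * y L * z (S - J - L))"
      using True by (intro sum.Sigma[symmetric]) auto
    also have "\<dots> = uv_mult x (uv_mult y z) S"
      by (simp add: uv_mult_def sum_distrib_left sum_distrib_right mult_ac)
    finally show ?thesis .
  qed (simp add: uv_mult_infinite)
qed

lemma uv_diff_add: "uv_diff m (x + y) = uv_diff m x + uv_diff m y"
  by (simp add: uv_diff_def fun_eq_iff algebra_simps sum.distrib)

text \<open>\<open>F\<close> is symmetric, while \<open>shuffle_sign {l} {j}\<close> changes sign
  when distinct \<open>j\<close> and \<open>l\<close> are exchanged. So every unordered pair of
  replaced variables contributes once with each sign.\<close>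

lemma uv_diff_diff: "uv_diff m (uv_diff m x) = 0"
proof
  fix S
  define F where "F j l = shuffle_sign {j} S * vvar j * (shuffle_sign {l} S * vvar l) *
    x (insert l (insert j S))" for j l
  have F_commute: "F j l = F l j" for j l
    by (simp add: F_def insert_commute mult_ac)
  have split: "(\<Sum>l\<in>{1..m} - S - {j}. shuffle_sign {l} {j} * F j l) =
      (\<Sum>l | l \<in> {1..m} - S \<and> l < j. F j l) - (\<Sum>l | l \<in> {1..m} - S \<and> j < l. F j l)" for j
  proof -
    have *: "{1..m} - S - {j} = {l. l \<in> {1..m} - S \<and> l < j} \<union> {l. l \<in> {1..m} - S \<and> j < l}"
      by auto
    have "(\<Sum>l\<in>{1..m} - S - {j}. shuffle_sign {l} {j} * F j l) =
        (\<Sum>l | l \<in> {1..m} - S \<and> l < j. shuffle_sign {l} {j} * F j l) +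
        (\<Sum>l | l \<in> {1..m} - S \<and> j < l. shuffle_sign {l} {j} * F j l)"
      unfolding * by (subst sum.union_disjoint) auto
    then show ?thesis
      by (simp add: shuffle_sign_singletons sum_negf)
  qed
  have "uv_diff m (uv_diff m x) S =
      (\<Sum>j\<in>{1..m} - S. \<Sum>l\<in>{1..m} - S - {j}. shuffle_sign {l} {j} * F j l)"
    unfolding uv_diff_eq sum_distrib_left
    by (intro sum.cong) (auto simp: shuffle_sign_insert_right[of _ _ S] F_def mult_ac)
  also have "\<dots> = 0"
    unfolding split sum_subtractf
    by (subst sum.swap_restrict) (auto simp: F_commute)
  finally show "uv_diff m (uv_diff m x) S = 0 S" by simp
qed

text \<open>The sign \<open>(-1) ^ card J\<close> counts \<open>u\<close>-variables only, so the
  rule makes sense for inhomogeneous \<open>x\<close>; it is the usual degree sign because the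
  \<open>v\<close>-variables have even degree.\<close>

lemma uv_diff_mult:
  "uv_diff m (uv_mult x y) =
    uv_mult (uv_diff m x) y + uv_mult (\<lambda>J. (-1) ^ card J * x J) (uv_diff m y)"
proof
  fix S
  show "uv_diff m (uv_mult x y) S =
    (uv_mult (uv_diff m x) y + uv_mult (\<lambda>J. (-1) ^ card J * x J) (uv_diff m y)) S"
  proof (cases "finite S")
    case True
    have fin: "finite J" if "J \<subseteq> S" for J using True that by (rule rev_finite_subset)
    \<comment> \<open>In \<open>P\<close> the differential acts on \<open>x\<close>, in
      \<open>Q\<close> on \<open>y\<close>. For \<open>j\<close> outside \<open>S\<close> they make
      up the left-hand side; for \<open>j\<close> in \<open>S\<close> they occur only on the
      right-hand side and have to cancel.\<close>
    define P where "P J j = shuffle_sign {j} J * shuffle_sign J (S - J) * vvar j *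
      x (insert j J) * y (S - J)" for J j
    define Q where "Q J j = (-1) ^ card J * shuffle_sign {j} (S - J) * shuffle_sign J (S - J) *
      vvar j * x J * y (insert j (S - J))" for J j
    have insert_sum: "(\<Sum>J\<in>Pow (insert j S). shuffle_sign J (insert j S - J) * x J * y (insert j S - J)) =
        (\<Sum>J\<in>Pow S. shuffle_sign (insert j J) (S - J) * x (insert j J) * y (S - J) +
          shuffle_sign J (insert j (S - J)) * x J * y (insert j (S - J)))" if "j \<notin> S" for j
    proof -
      have "Pow (insert j S) = Pow S \<union> insert j ` Pow S" by (rule Pow_insert)
      moreover have "Pow S \<inter> insert j ` Pow S = {}" using that by auto
      moreover have "inj_on (insert j) (Pow S)" using that by (auto simp: inj_on_def)
      moreover have "insert j S - J = insert j (S - J)" if "J \<in> Pow S" for J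
        using that \<open>j \<notin> S\<close> by auto
      moreover have "insert j S - insert j J = S - J" for J using that by auto
      ultimately show ?thesis
        using True by (simp add: sum.union_disjoint sum.reindex sum.distrib add.commute)
    qed
    have "uv_diff m (uv_mult x y) S = (\<Sum>j\<in>{1..m} - S. \<Sum>J\<in>Pow S. P J j + Q J j)"
      unfolding uv_diff_eq
    proof (rule sum.cong[OF refl])
      fix j assume j: "j \<in> {1..m} - S"
      have "shuffle_sign {j} S * vvar j * uv_mult x y (insert j S) =
          (\<Sum>J\<in>Pow S. shuffle_sign {j} S * vvar j *
            (shuffle_sign (insert j J) (S - J) * x (insert j J) * y (S - J) +
            shuffle_sign J (insert j (S - J)) * x J * y (insert j (S - J))))"
        unfolding uv_mult_def sum_distrib_left[symmetric] using insert_sum j by simp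
      also have "\<dots> = (\<Sum>J\<in>Pow S. P J j + Q J j)"
      proof (rule sum.cong[OF refl])
        fix J assume "J \<in> Pow S"
        then have J: "J \<subseteq> S" "finite J" "j \<notin> J" "J \<inter> (S - J) = {}" "J \<union> (S - J) = S"
          using fin j by auto
        have "shuffle_sign {j} S = shuffle_sign {j} J * (shuffle_sign {j} (S - J) :: 'a vpoly)"
          using shuffle_sign_union_right[of "{j}" J "S - J"] J(4,5) by simp
        moreover have "shuffle_sign (insert j J) (S - J) =
            shuffle_sign {j} (S - J) * (shuffle_sign J (S - J) :: 'a vpoly)"
          using J(2,3) by (rule shuffle_sign_insert_left)
        moreover have "shuffle_sign J (insert j (S - J)) =
            shuffle_sign J {j} * (shuffle_sign J (S - J) :: 'a vpoly)"
          using J(2) j by (intro shuffle_sign_insert_right) auto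
        moreover have "(-1) ^ card J = shuffle_sign {j} J * (shuffle_sign J {j} :: 'a vpoly)"
          using J(2,3) by (simp add: shuffle_sign_commute_singleton)
        ultimately show "shuffle_sign {j} S * vvar j *
            (shuffle_sign (insert j J) (S - J) * x (insert j J) * y (S - J) +
            shuffle_sign J (insert j (S - J)) * x J * y (insert j (S - J))) = P J j + Q J j"
          by (simp add: P_def Q_def algebra_simps)
      qed
      finally show "shuffle_sign {j} S * vvar j * uv_mult x y (insert j S) =
          (\<Sum>J\<in>Pow S. P J j + Q J j)" .
    qed
    also have "\<dots> = (\<Sum>J\<in>Pow S. \<Sum>j\<in>{1..m} - S. P J j + Q J j)"
      by (rule sum.swap)
    finally have lhs: "uv_diff m (uv_mult x y) S =
        (\<Sum>J\<in>Pow S. \<Sum>j\<in>{1..m} - S. P J j) + (\<Sum>J\<in>Pow S. \<Sum>j\<in>{1..m} - S. Q J j)"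
      by (simp add: sum.distrib)
    have "uv_mult (uv_diff m x) y S = (\<Sum>J\<in>Pow S. \<Sum>j\<in>{1..m} - J. P J j)"
      unfolding uv_mult_def uv_diff_eq sum_distrib_left sum_distrib_right P_def
      by (intro sum.cong refl) (simp add: mult_ac)
    also have "\<dots> = (\<Sum>J\<in>Pow S. (\<Sum>j\<in>{1..m} - S. P J j) + (\<Sum>j\<in>{1..m} \<inter> (S - J). P J j))"
    proof (rule sum.cong[OF refl])
      fix J assume "J \<in> Pow S"
      then have *: "{1..m} - J = ({1..m} - S) \<union> ({1..m} \<inter> (S - J))" by auto
      show "(\<Sum>j\<in>{1..m} - J. P J j) =
          (\<Sum>j\<in>{1..m} - S. P J j) + (\<Sum>j\<in>{1..m} \<inter> (S - J). P J j)"
        unfolding * by (subst sum.union_disjoint) auto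
    qed
    finally have left: "uv_mult (uv_diff m x) y S = (\<Sum>J\<in>Pow S. \<Sum>j\<in>{1..m} - S. P J j) +
        (\<Sum>J\<in>Pow S. \<Sum>j\<in>{1..m} \<inter> (S - J). P J j)"
      by (simp add: sum.distrib)
    have "uv_mult (\<lambda>J. (-1) ^ card J * x J) (uv_diff m y) S =
        (\<Sum>J\<in>Pow S. \<Sum>j\<in>{1..m} - (S - J). Q J j)"
      unfolding uv_mult_def uv_diff_eq sum_distrib_left sum_distrib_right Q_def
      by (intro sum.cong refl) (simp add: mult_ac)
    also have "\<dots> = (\<Sum>J\<in>Pow S. (\<Sum>j\<in>{1..m} - S. Q J j) + (\<Sum>j\<in>{1..m} \<inter> J. Q J j))"
    proof (rule sum.cong[OF refl])
      fix J assume "J \<in> Pow S"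
      then have *: "{1..m} - (S - J) = ({1..m} - S) \<union> ({1..m} \<inter> J)" by auto
      have "({1..m} - S) \<inter> ({1..m} \<inter> J) = {}" using \<open>J \<in> Pow S\<close> by auto
      then show "(\<Sum>j\<in>{1..m} - (S - J). Q J j) =
          (\<Sum>j\<in>{1..m} - S. Q J j) + (\<Sum>j\<in>{1..m} \<inter> J. Q J j)"
        unfolding * by (subst sum.union_disjoint) auto
    qed
    finally have right: "uv_mult (\<lambda>J. (-1) ^ card J * x J) (uv_diff m y) S =
        (\<Sum>J\<in>Pow S. \<Sum>j\<in>{1..m} - S. Q J j) + (\<Sum>J\<in>Pow S. \<Sum>j\<in>{1..m} \<inter> J. Q J j)"
      by (simp add: sum.distrib)
    \<comment> \<open>Here \<open>u_j\<close> occurs in the monomials of both \<open>x\<close> and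
      \<open>y\<close>. Their product is 0, yet each summand on the right-hand side contributes a
      multiple of \<open>u_j v_j\<close>; pairing \<open>J\<close> with \<open>insert j J\<close>
      cancels them.\<close>
    have "(\<Sum>J\<in>Pow S. \<Sum>j\<in>{1..m} \<inter> (S - J). P J j) =
        (\<Sum>(J, j)\<in>Sigma (Pow S) (\<lambda>J. {1..m} \<inter> (S - J)). P J j)"
      using True by (intro sum.Sigma) auto
    also have "\<dots> = (\<Sum>(J, j)\<in>Sigma (Pow S) (\<lambda>J. {1..m} \<inter> J). - Q J j)"
    proof (rule sum.reindex_bij_witness[where i = "\<lambda>(J, j). (J - {j}, j)" and j = "\<lambda>(J, j). (insert j J, j)"])
      fix a assume "a \<in> Sigma (Pow S) (\<lambda>J. {1..m} \<inter> (S - J))"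
      then obtain J j where a: "a = (J, j)" "J \<subseteq> S" "j \<in> S" "j \<notin> J" by auto
      define L where "L = S - insert j J"
      have L: "S - J = insert j L" "j \<notin> L" "finite J" "S - insert j J = L"
        using a fin by (auto simp: L_def)
      have "shuffle_sign {j} J * shuffle_sign J (S - J) = (-1) ^ card J * (shuffle_sign J L :: 'a vpoly)"
        using L a shuffle_sign_commute_singleton[of J j, where 'k = "'a vpoly"]
        by (simp add: shuffle_sign_insert_right[of J j L] flip: mult.assoc)
      moreover have "(-1) ^ card (insert j J) * (shuffle_sign {j} L * shuffle_sign (insert j J) L) =
          - ((-1) ^ card J * (shuffle_sign J L :: 'a vpoly))"
        using L a by (simp add: shuffle_sign_insert_left[of J j])
      moreover have "P J j = (shuffle_sign {j} J * shuffle_sign J (S - J)) *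
          (vvar j * x (insert j J) * y (S - J))"
        by (simp add: P_def mult.assoc)
      moreover have "Q (insert j J) j =
          ((-1) ^ card (insert j J) * (shuffle_sign {j} L * shuffle_sign (insert j J) L)) *
          (vvar j * x (insert j J) * y (S - J))"
        unfolding Q_def L(4) L(1)[symmetric] by (simp only: mult.assoc)
      ultimately have "P J j = - Q (insert j J) j"
        by (simp only: minus_mult_left minus_minus)
      then show "(case (case a of (J, j) \<Rightarrow> (insert j J, j)) of (J, j) \<Rightarrow> - Q J j) =
          (case a of (J, j) \<Rightarrow> P J j)"
        by (simp add: a)
    qed auto
    also have "\<dots> = - (\<Sum>J\<in>Pow S. \<Sum>j\<in>{1..m} \<inter> J. Q J j)"
      using True fin by (subst sum.Sigma) (auto simp: sum_negf split_def)
    finally show ?thesis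
      using lhs left right by simp
  qed (simp add: uv_mult_infinite uv_diff_def)
qed


section \<open>The ideal of relations\<close>

text \<open>\<open>Q\<close> selects monomials \<open>u_J v^e\<close>. The carrier, the parts of
  given degree or multidegree, the ideal of relations and the normal forms are all spans of
  monomials, so one notion with a free predicate serves them all.\<close>

definition supported :: "(nat set \<Rightarrow> (nat \<Rightarrow>\<^sub>0 nat) \<Rightarrow> bool) \<Rightarrow> 'k::comm_ring_1 uvpoly set" where
  "supported Q = {x. \<forall>J. \<forall>e\<in>Poly_Mapping.keys (x J). Q J e}"

text \<open>The projection onto the span of the monomials in \<open>Q\<close> along the span of the
  other monomials.\<close>

definition restrict_support ::
  "(nat set \<Rightarrow> (nat \<Rightarrow>\<^sub>0 nat) \<Rightarrow> bool) \<Rightarrow> 'k::comm_ring_1 uvpoly \<Rightarrow> 'k uvpoly" where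
  "restrict_support Q x = (\<lambda>J. Poly_Mapping.mapp (\<lambda>e c. if Q J e then c else 0) (x J))"

lemma lookup_restrict_support:
  "Poly_Mapping.lookup (restrict_support Q x J) e =
    (if Q J e then Poly_Mapping.lookup (x J) e else 0)"
  by (simp add: restrict_support_def lookup_mapp in_keys_iff when_def)

lemma uvpoly_eqI:
  "(\<And>J e. Poly_Mapping.lookup (x J) e = Poly_Mapping.lookup (y J) e) \<Longrightarrow> x = (y :: 'k::comm_ring_1 uvpoly)"
  by (intro ext poly_mapping_eqI)

lemma supported_iff:
  "x \<in> supported Q \<longleftrightarrow> (\<forall>J e. \<not> Q J e \<longrightarrow> Poly_Mapping.lookup (x J) e = 0)"
  by (simp add: supported_def Ball_def in_keys_iff) blast

lemma restrict_support_add: "restrict_support Q (x + y) = restrict_support Q x + restrict_support Q y"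
  by (intro uvpoly_eqI) (simp add: lookup_restrict_support lookup_add)

lemma restrict_support_uminus: "restrict_support Q (- x) = - restrict_support Q x"
  by (intro uvpoly_eqI) (simp add: lookup_restrict_support)

lemma restrict_support_zero: "restrict_support Q 0 = 0"
  by (intro uvpoly_eqI) (simp add: lookup_restrict_support)

lemma restrict_support_diff: "restrict_support Q (x - y) = restrict_support Q x - restrict_support Q y"
  by (intro uvpoly_eqI) (simp add: lookup_restrict_support lookup_minus)

lemma restrict_support_in_supported: "restrict_support Q x \<in> supported Q"
  by (simp add: supported_iff lookup_restrict_support)

lemma restrict_support_preserves_supported: "x \<in> supported P \<Longrightarrow> restrict_support Q x \<in> supported P"
  by (simp add: supported_iff lookup_restrict_support)

lemma restrict_support_eq_iff: "restrict_support Q x = x \<longleftrightarrow> x \<in> supported Q"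
proof
  assume "x \<in> supported Q"
  then show "restrict_support Q x = x"
    by (intro uvpoly_eqI) (simp add: lookup_restrict_support supported_iff)
qed (metis restrict_support_in_supported)

lemma restrict_support_eq_zero_iff:
  "restrict_support Q x = 0 \<longleftrightarrow> x \<in> supported (\<lambda>J e. \<not> Q J e)"
proof
  assume "restrict_support Q x = 0"
  then have "Poly_Mapping.lookup (restrict_support Q x J) e = 0" for J e by simp
  then show "x \<in> supported (\<lambda>J e. \<not> Q J e)"
    unfolding supported_iff lookup_restrict_support by metis
next
  assume "x \<in> supported (\<lambda>J e. \<not> Q J e)"
  then show "restrict_support Q x = 0"
    by (intro uvpoly_eqI) (simp add: lookup_restrict_support supported_iff)
qed

lemma diff_restrict_support_in_supported: "x - restrict_support Q x \<in> supported (\<lambda>J e. \<not> Q J e)"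
  by (simp add: supported_iff lookup_restrict_support lookup_minus)

lemma restrict_support_commute:
  "restrict_support P (restrict_support Q x) = restrict_support Q (restrict_support P x)"
  by (intro uvpoly_eqI) (simp add: lookup_restrict_support)

lemma supported_zero: "0 \<in> supported Q"
  by (simp add: supported_iff)

lemma supported_add: "x \<in> supported Q \<Longrightarrow> y \<in> supported Q \<Longrightarrow> x + y \<in> supported Q"
  by (simp add: supported_iff lookup_add)

lemma supported_uminus: "x \<in> supported Q \<Longrightarrow> - x \<in> supported Q"
  by (simp add: supported_iff)

lemma supported_diff: "x \<in> supported Q \<Longrightarrow> y \<in> supported Q \<Longrightarrow> x - y \<in> supported Q"
  by (simp add: supported_iff lookup_minus)

lemma supported_Int: "supported P \<inter> supported Q = supported (\<lambda>J e. P J e \<and> Q J e)"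
  by (auto simp: supported_def)

lemma supported_mono: "x \<in> supported P \<Longrightarrow> (\<And>J e. P J e \<Longrightarrow> Q J e) \<Longrightarrow> x \<in> supported Q"
  by (auto simp: supported_def)

lemma keys_shuffle_sign_mult:
  "Poly_Mapping.keys (shuffle_sign J L * p) = Poly_Mapping.keys (p :: 'k::comm_ring_1 vpoly)"
  by (cases "even (card {(a, b) \<in> J \<times> L. b < a})") (simp_all add: shuffle_sign_def)

text \<open>Reduces closure properties of the product to monomials. Only disjoint finite
  \<open>J\<close> and \<open>L\<close> occur, as \<open>u_i\<close> squares to 0 and the product
  vanishes at infinite sets.\<close>

lemma uv_mult_supported:
  assumes "x \<in> supported P" "y \<in> supported Q"
    and "\<And>J L l q. finite J \<Longrightarrow> finite L \<Longrightarrow> J \<inter> L = {} \<Longrightarrow> P J l \<Longrightarrow> Q L q \<Longrightarrow> R (J \<union> L) (l + q)"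
  shows "uv_mult x y \<in> supported R"
  unfolding supported_def
proof (intro CollectI allI ballI)
  fix S e assume e: "e \<in> Poly_Mapping.keys (uv_mult x y S)"
  then have fin: "finite S" using uv_mult_infinite[of S x y] by fastforce
  obtain J where J: "J \<subseteq> S" "e \<in> Poly_Mapping.keys (shuffle_sign J (S - J) * x J * y (S - J))"
    using subsetD[OF keys_sum e[unfolded uv_mult_def]] by blast
  then obtain l q where "l \<in> Poly_Mapping.keys (x J)" "q \<in> Poly_Mapping.keys (y (S - J))" "e = l + q"
    using keys_mult[of "x J" "y (S - J)"] unfolding mult.assoc keys_shuffle_sign_mult by blast
  then have "P J l" "Q (S - J) q" using assms(1,2) by (auto simp: supported_def)
  then have "R (J \<union> (S - J)) (l + q)"
    using J(1) fin by (intro assms(3)) (auto intro: finite_subset)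
  moreover have "J \<union> (S - J) = S" using J(1) by auto
  ultimately show "R S e" using \<open>e = l + q\<close> by simp
qed

lemma uv_diff_supported:
  assumes "x \<in> supported P"
    and "\<And>J j q. j \<in> {1..m} \<Longrightarrow> j \<notin> J \<Longrightarrow> P (insert j J) q \<Longrightarrow> R J (Poly_Mapping.single j 1 + q)"
  shows "uv_diff m x \<in> supported R"
  unfolding supported_def
proof (intro CollectI allI ballI)
  fix S e assume e: "e \<in> Poly_Mapping.keys (uv_diff m x S)"
  then obtain j where j: "j \<in> {1..m} - S"
    "e \<in> Poly_Mapping.keys (shuffle_sign {j} S * vvar j * x (insert j S))"
    using subsetD[OF keys_sum e[unfolded uv_diff_eq]] by blast
  then obtain l q where "l \<in> Poly_Mapping.keys (vvar j :: 'a vpoly)"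
    "q \<in> Poly_Mapping.keys (x (insert j S))" "e = l + q"
    using keys_mult[of "vvar j" "x (insert j S)"] unfolding mult.assoc keys_shuffle_sign_mult by blast
  then have "e = Poly_Mapping.single j 1 + q" "P (insert j S) q"
    using assms(1) by (auto simp: supported_def vvar_def split: if_splits)
  then show "R S e" using j(1) assms(2) by simp
qed

lemma uv_term_supported_iff:
  "uv_term J p \<in> supported Q \<longleftrightarrow> (\<forall>e\<in>Poly_Mapping.keys p. Q J e)"
  by (auto simp: supported_def uv_term_def)

lemma uv_mult_uv_term:
  assumes "finite J" "finite L" "J \<inter> L = {}"
  shows "uv_mult (uv_term J p) (uv_term L q) = uv_term (J \<union> L) (shuffle_sign J L * p * q)"
proof
  fix S
  show "uv_mult (uv_term J p) (uv_term L q) S = uv_term (J \<union> L) (shuffle_sign J L * p * q) S"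
  proof (cases "finite S")
    case True
    have "uv_mult (uv_term J p) (uv_term L q) S =
        (\<Sum>T\<in>Pow S. if T = J then shuffle_sign J (S - J) * p * uv_term L q (S - J) else 0)"
      unfolding uv_mult_def by (intro sum.cong) (auto simp: uv_term_def)
    also have "\<dots> = (if J \<subseteq> S \<and> S - J = L then shuffle_sign J L * p * q else 0)"
      using True by (auto simp: uv_term_def)
    also have "J \<subseteq> S \<and> S - J = L \<longleftrightarrow> S = J \<union> L" using assms(3) by auto
    finally show ?thesis by (simp add: uv_term_def)
  next
    case False
    then show ?thesis using assms by (auto simp: uv_mult_infinite uv_term_def)
  qed
qed

section \<open>Monomials and the ring \<open>uv_algebra m\<close>\<close>

lemma keys_plus_nat:
  "Poly_Mapping.keys (e + f :: nat \<Rightarrow>\<^sub>0 nat) = Poly_Mapping.keys e \<union> Poly_Mapping.keys f"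
  by (auto simp: in_keys_iff lookup_add)

definition monomial_in_range :: "nat \<Rightarrow> nat set \<Rightarrow> (nat \<Rightarrow>\<^sub>0 nat) \<Rightarrow> bool" where
  "monomial_in_range m J e \<longleftrightarrow> J \<subseteq> {1..m} \<and> Poly_Mapping.keys e \<subseteq> {1..m}"

lemma carrier_uv_algebra: "carrier (uv_algebra m) = supported (monomial_in_range m)"
proof (rule Set.set_eqI)
  fix x :: "'a uvpoly"
  have "(\<forall>J. \<not> J \<subseteq> {1..m} \<longrightarrow> x J = 0) \<longleftrightarrow>
      (\<forall>J. \<forall>e\<in>Poly_Mapping.keys (x J). J \<subseteq> {1..m})"
    unfolding keys_eq_empty[symmetric] by blast
  then show "x \<in> carrier (uv_algebra m) \<longleftrightarrow> x \<in> supported (monomial_in_range m)"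
    unfolding uv_algebra_def supported_def monomial_in_range_def by simp blast
qed

lemma uv_mult_in_range:
  "x \<in> supported (monomial_in_range m) \<Longrightarrow> y \<in> supported (monomial_in_range m) \<Longrightarrow>
    uv_mult x y \<in> supported (monomial_in_range m)"
  by (erule (1) uv_mult_supported) (auto simp: monomial_in_range_def keys_plus_nat)

lemma uv_diff_in_range:
  "x \<in> supported (monomial_in_range m) \<Longrightarrow> uv_diff m x \<in> supported (monomial_in_range m)"
  by (erule uv_diff_supported) (auto simp: monomial_in_range_def keys_plus_nat)

lemma uv_mult_one:
  assumes "x \<in> supported (monomial_in_range m)"
  shows "uv_mult (uv_term {} 1) x = x" "uv_mult x (uv_term {} 1) = x"
proof -
  have infinite: "x S = 0" if "infinite S" for S
  proof (rule ccontr)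
    assume "x S \<noteq> 0"
    then obtain e where "e \<in> Poly_Mapping.keys (x S)" by fastforce
    then have "S \<subseteq> {1..m}" using assms by (auto simp: supported_def monomial_in_range_def)
    then show False using that finite_subset by blast
  qed
  show "uv_mult (uv_term {} 1) x = x"
  proof
    fix S
    show "uv_mult (uv_term {} 1) x S = x S"
    proof (cases "finite S")
      case True
      have "uv_mult (uv_term {} 1) x S = (\<Sum>T\<in>Pow S. if T = {} then x S else 0)"
        unfolding uv_mult_def by (intro sum.cong) (auto simp: uv_term_def)
      then show ?thesis using True by simp
    qed (simp add: uv_mult_infinite infinite)
  qed
  show "uv_mult x (uv_term {} 1) = x"
  proof
    fix S
    show "uv_mult x (uv_term {} 1) S = x S"
    proof (cases "finite S")
      case True
      have "uv_mult x (uv_term {} 1) S = (\<Sum>T\<in>Pow S. if T = S then x S else 0)"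
        unfolding uv_mult_def by (intro sum.cong) (auto simp: uv_term_def)
      then show ?thesis using True by simp
    qed (simp add: uv_mult_infinite infinite)
  qed
qed

lemma ring_uv_algebra: "ring (uv_algebra m :: 'k::comm_ring_1 uvpoly ring)"
proof (rule ringI)
  show "abelian_group (uv_algebra m :: 'k uvpoly ring)"
  proof (rule abelian_groupI)
    fix x :: "'k uvpoly" assume "x \<in> carrier (uv_algebra m)"
    then show "\<exists>y\<in>carrier (uv_algebra m). y \<oplus>\<^bsub>uv_algebra m\<^esub> x = \<zero>\<^bsub>uv_algebra m\<^esub>"
      by (intro bexI[of _ "- x"]) (auto simp: uv_algebra_simps carrier_uv_algebra supported_uminus)
  qed (auto simp: uv_algebra_simps carrier_uv_algebra supported_add supported_zero add_ac)
  have one: "\<one>\<^bsub>uv_algebra m\<^esub> = (uv_term {} 1 :: 'k uvpoly)"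
    by (simp add: uv_algebra_def uv_term_def)
  show "monoid (uv_algebra m :: 'k uvpoly ring)"
    by (rule monoidI) (auto simp: uv_algebra_simps carrier_uv_algebra uv_mult_in_range one
        uv_mult_assoc uv_mult_one uv_term_supported_iff monomial_in_range_def)
qed (simp_all add: uv_algebra_simps uv_mult_add_left uv_mult_add_right)

lemma uv_algebra_a_inv:
  assumes "x \<in> carrier (uv_algebra m)"
  shows "\<ominus>\<^bsub>uv_algebra m\<^esub> x = - x"
proof -
  interpret ring "uv_algebra m :: 'a uvpoly ring" by (rule ring_uv_algebra)
  show ?thesis
    using assms by (intro minus_equality) (auto simp: uv_algebra_simps carrier_uv_algebra supported_uminus)
qed

text \<open>The monomials \<open>u\<^sub>J v\<^sup>e\<close> that survive in \<open>R\<^sup>*(K)\<close>.\<close>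

definition normal_monomial :: "nat set set \<Rightarrow> nat set \<Rightarrow> (nat \<Rightarrow>\<^sub>0 nat) \<Rightarrow> bool" where
  "normal_monomial K J e \<longleftrightarrow>
     (\<forall>i. of_bool (i \<in> J) + Poly_Mapping.lookup e i \<le> (1::nat)) \<and> Poly_Mapping.keys e \<in> K"

text \<open>Closure of \<open>K\<close> under subsets passes normality to divisors. Read
  contrapositively, the monomials that are not normal absorb multiplication, so their span is an
  ideal.\<close>

lemma normal_monomial_divisor:
  assumes K: "simplicial_complex_on m K"
    and "normal_monomial K (J \<union> L) (e + f)"
  shows "normal_monomial K J e"
  unfolding normal_monomial_def
proof
  show "\<forall>i. of_bool (i \<in> J) + Poly_Mapping.lookup e i \<le> (1::nat)"
  proof
    fix i
    have "of_bool (i \<in> J \<union> L) + (Poly_Mapping.lookup e i + Poly_Mapping.lookup f i) \<le> (1::nat)"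
      using assms(2) by (simp add: normal_monomial_def lookup_add)
    then show "of_bool (i \<in> J) + Poly_Mapping.lookup e i \<le> (1::nat)"
      by (auto simp: of_bool_def split: if_splits)
  qed
  show "Poly_Mapping.keys e \<in> K"
    using assms unfolding normal_monomial_def simplicial_complex_on_def keys_plus_nat by blast
qed

text \<open>Used contrapositively: the differential of a monomial that is not normal has no normal
  terms, so the differential descends to the quotient. Trading \<open>u_j\<close> for
  \<open>v_j\<close> keeps the total exponent of \<open>j\<close> and only enlarges the set of
  \<open>v\<close>-variables.\<close>

lemma normal_monomial_diff:
  assumes K: "simplicial_complex_on m K"
    and "j \<notin> J" "normal_monomial K J (Poly_Mapping.single j 1 + e)"
  shows "normal_monomial K (insert j J) e"
  unfolding normal_monomial_def
proof
  show "\<forall>i. of_bool (i \<in> insert j J) + Poly_Mapping.lookup e i \<le> (1::nat)"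
  proof
    fix i
    have "of_bool (i \<in> J) + (Poly_Mapping.lookup (Poly_Mapping.single j 1) i + Poly_Mapping.lookup e i) \<le> (1::nat)"
      using assms(3) by (simp add: normal_monomial_def lookup_add)
    then show "of_bool (i \<in> insert j J) + Poly_Mapping.lookup e i \<le> (1::nat)"
      by (cases "i = j") (auto simp: lookup_single when_def)
  qed
  show "Poly_Mapping.keys e \<in> K"
    using assms unfolding normal_monomial_def simplicial_complex_on_def keys_plus_nat by blast
qed

text \<open>The candidate for the ideal of relations: all relations are monomials, so the ideal
  should be spanned by the monomials that some relation divides.\<close>

definition vanishing :: "nat \<Rightarrow> nat set set \<Rightarrow> 'k::comm_ring_1 uvpoly set" where
  "vanishing m K = supported (\<lambda>J e. monomial_in_range m J e \<and> \<not> normal_monomial K J e)"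

definition squarefree_exponent :: "nat set \<Rightarrow> (nat \<Rightarrow>\<^sub>0 nat)" where
  "squarefree_exponent L = (\<Sum>i\<in>L. Poly_Mapping.single i 1)"

lemma lookup_squarefree_exponent:
  "finite L \<Longrightarrow> Poly_Mapping.lookup (squarefree_exponent L) i = of_bool (i \<in> L)"
  by (auto simp: squarefree_exponent_def lookup_sum lookup_single when_def)

lemma keys_squarefree_exponent: "finite L \<Longrightarrow> Poly_Mapping.keys (squarefree_exponent L) = L"
  by (auto simp: in_keys_iff lookup_squarefree_exponent)

lemma prod_vvar: "finite L \<Longrightarrow> (\<Prod>i\<in>L. vvar i) = Poly_Mapping.single (squarefree_exponent L) 1"
proof (induction L rule: finite_induct)
  case (insert j L)
  then show ?case by (simp add: vvar_def mult_single squarefree_exponent_def)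
qed (simp add: squarefree_exponent_def)

lemma ideal_vanishing:
  assumes K: "simplicial_complex_on m K"
  shows "ideal (vanishing m K :: 'k::comm_ring_1 uvpoly set) (uv_algebra m)"
proof (rule idealI)
  interpret ring "uv_algebra m :: 'k uvpoly ring" by (rule ring_uv_algebra)
  have sub: "vanishing m K \<subseteq> (carrier (uv_algebra m) :: 'k uvpoly set)"
    unfolding vanishing_def carrier_uv_algebra by (auto intro: supported_mono)
  show "ring (uv_algebra m :: 'k uvpoly ring)" by (rule ring_uv_algebra)
  show "subgroup (vanishing m K :: 'k uvpoly set) (add_monoid (uv_algebra m))"
  proof (rule group.subgroupI)
    show "group (add_monoid (uv_algebra m :: 'k uvpoly ring))" by (rule add.group_axioms)
    show "(vanishing m K :: 'k uvpoly set) \<noteq> {}"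
      using supported_zero unfolding vanishing_def by blast
  next
    fix x y :: "'k uvpoly" assume "x \<in> vanishing m K"
    then show "inv\<^bsub>add_monoid (uv_algebra m)\<^esub> x \<in> vanishing m K"
      using sub uv_algebra_a_inv[of x m] unfolding a_inv_def
      by (auto simp: vanishing_def supported_uminus)
  next
    fix x y :: "'k uvpoly" assume "x \<in> vanishing m K" "y \<in> vanishing m K"
    then show "x \<otimes>\<^bsub>add_monoid (uv_algebra m)\<^esub> y \<in> vanishing m K"
      by (simp add: vanishing_def uv_algebra_simps supported_add)
  qed (use sub in auto)
  fix x y :: "'k uvpoly" assume "x \<in> vanishing m K" "y \<in> carrier (uv_algebra m)"
  then have xy: "x \<in> supported (\<lambda>J e. monomial_in_range m J e \<and> \<not> normal_monomial K J e)"
    "y \<in> supported (monomial_in_range m)"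
    by (simp_all add: vanishing_def carrier_uv_algebra)
  have "monomial_in_range m (J \<union> L) (l + q) \<and> \<not> normal_monomial K (J \<union> L) (l + q)"
    if "monomial_in_range m J l \<and> \<not> normal_monomial K J l" "monomial_in_range m L q" for J L l q
    using that normal_monomial_divisor[OF K, of J L l q]
    by (auto simp: monomial_in_range_def keys_plus_nat)
  then show "y \<otimes>\<^bsub>uv_algebra m\<^esub> x \<in> vanishing m K" "x \<otimes>\<^bsub>uv_algebra m\<^esub> y \<in> vanishing m K"
    unfolding uv_algebra_simps vanishing_def
    by (auto intro!: uv_mult_supported[OF xy] uv_mult_supported[OF xy(2,1)]
        simp: Un_commute add.commute) (metis Un_commute add.commute)+
qed

lemma sum_fun_apply: "(\<Sum>a\<in>A. f a) J = (\<Sum>a\<in>A. (f a J :: 'b::comm_monoid_add))"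
  by (induction A rule: infinite_finite_induct) auto

lemma uvpoly_eq_sum_monomials:
  assumes "x \<in> supported (monomial_in_range m)"
  shows "x = (\<Sum>(J, e)\<in>Sigma (Pow {1..m}) (\<lambda>J. Poly_Mapping.keys (x J)).
    uv_term J (Poly_Mapping.single e (Poly_Mapping.lookup (x J) e)))"
proof (rule uvpoly_eqI)
  fix S f
  let ?A = "Sigma (Pow {1..m}) (\<lambda>J. Poly_Mapping.keys (x J))"
  have "(S, f) \<in> ?A" if "Poly_Mapping.lookup (x S) f \<noteq> 0"
    using that assms by (auto simp: supported_def monomial_in_range_def in_keys_iff)
  moreover have "finite ?A" by simp
  moreover have "Poly_Mapping.lookup ((\<Sum>(J, e)\<in>?A.
      uv_term J (Poly_Mapping.single e (Poly_Mapping.lookup (x J) e))) S) f =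
      (\<Sum>a\<in>?A. if a = (S, f) then Poly_Mapping.lookup (x S) f else 0)"
    unfolding sum_fun_apply lookup_sum
    by (intro sum.cong) (auto simp: uv_term_def lookup_single when_def split: if_splits)
  ultimately show "Poly_Mapping.lookup (x S) f = Poly_Mapping.lookup ((\<Sum>(J, e)\<in>?A.
      uv_term J (Poly_Mapping.single e (Poly_Mapping.lookup (x J) e))) S) f"
    by auto
qed

text \<open>Each way to fail normality names a relation dividing the monomial:
  \<open>u_i v_i\<close>, \<open>v_i^2\<close>, or the product of the \<open>v_i\<close> over a set
  outside \<open>K\<close>.\<close>

lemma vanishing_monomial_in_ideal:
  fixes c :: "'k::comm_ring_1"
  assumes "ideal N (uv_algebra m)" "R_relations m K \<subseteq> N"
    and range: "monomial_in_range m J e" and e: "\<not> normal_monomial K J e"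
  shows "uv_term J (Poly_Mapping.single e c) \<in> N"
proof -
  interpret ideal N "uv_algebra m" by fact
  have fin: "finite J" using range finite_subset by (auto simp: monomial_in_range_def)
  \<comment> \<open>The sign put into the left factor meets the \<open>shuffle_sign J L\<close> of
    the product and squares to 1, so the coefficient is exactly \<open>c\<close>.\<close>
  have multiple: "uv_term (J \<union> L) (Poly_Mapping.single (f + g) c) \<in> N"
    if "monomial_in_range m J f" "uv_term L (Poly_Mapping.single g 1) \<in> N" "J \<inter> L = {}" "finite L"
      "finite J" for J L f g
  proof -
    have "uv_mult (uv_term J (shuffle_sign J L * Poly_Mapping.single f c))
        (uv_term L (Poly_Mapping.single g 1)) \<in> N"
      using that(1,2) I_l_closed[of "uv_term L (Poly_Mapping.single g 1)"
          "uv_term J (shuffle_sign J L * Poly_Mapping.single f c)"]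
      unfolding uv_algebra_simps
      by (auto simp: carrier_uv_algebra uv_term_supported_iff keys_shuffle_sign_mult)
    also have "uv_mult (uv_term J (shuffle_sign J L * Poly_Mapping.single f c))
        (uv_term L (Poly_Mapping.single g 1)) = uv_term (J \<union> L) (Poly_Mapping.single (f + g) c)"
      using that by (simp add: uv_mult_uv_term mult.assoc mult_single)
    finally show ?thesis .
  qed
  have rel: "uv_term {} (\<Prod>i\<in>L. vvar i) \<in> N" if "L \<subseteq> {1..m}" "L \<notin> K" for L
    using assms(2) that unfolding R_relations_def by blast
  have rel_vv: "uv_term {} (vvar i ^ 2) \<in> N" and rel_uv: "uv_term {i} (vvar i) \<in> N"
    if "i \<in> {1..m}" for i
    using assms(2) that unfolding R_relations_def by blast+
  \<comment> \<open>Subtraction of exponents is truncated, so it can be undone only when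
    \<open>f\<close> divides.\<close>
  have sub: "e - f + f = e" if "\<And>i. Poly_Mapping.lookup f i \<le> Poly_Mapping.lookup e i" for f
    by (rule poly_mapping_eqI) (simp add: lookup_add lookup_minus that)
  have range_sub: "monomial_in_range m J' (e - f)" if "J' \<subseteq> J" for J' f
    using range that by (auto simp: monomial_in_range_def in_keys_iff lookup_minus)
  consider i where "i \<in> J" "Poly_Mapping.lookup e i \<ge> 1"
    | i where "i \<notin> J" "Poly_Mapping.lookup e i \<ge> 2"
    | "Poly_Mapping.keys e \<notin> K"
  proof (cases "Poly_Mapping.keys e \<in> K")
    case True
    then obtain i where "\<not> of_bool (i \<in> J) + Poly_Mapping.lookup e i \<le> (1::nat)"
      using e unfolding normal_monomial_def by blast
    then show ?thesis using that(1,2)[of i] by (cases "i \<in> J") auto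
  qed (rule that(3))
  then show ?thesis
  proof cases
    case 1
    then have "i \<in> {1..m}" using range by (auto simp: monomial_in_range_def)
    then have "uv_term ((J - {i}) \<union> {i})
        (Poly_Mapping.single (e - Poly_Mapping.single i 1 + Poly_Mapping.single i 1) c) \<in> N"
      using fin rel_uv[of i] by (intro multiple range_sub) (auto simp: vvar_def)
    moreover have "(J - {i}) \<union> {i} = J" using 1 by auto
    moreover have "e - Poly_Mapping.single i 1 + Poly_Mapping.single i 1 = e"
      using 1 by (intro sub) (auto simp: lookup_single when_def)
    ultimately show ?thesis by simp
  next
    case 2
    then have "i \<in> Poly_Mapping.keys e" by (simp add: in_keys_iff)
    then have "i \<in> {1..m}" using range by (auto simp: monomial_in_range_def)
    then have "uv_term (J \<union> {})
        (Poly_Mapping.single (e - Poly_Mapping.single i 2 + Poly_Mapping.single i 2) c) \<in> N"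
      using fin rel_vv[of i]
      by (intro multiple range_sub) (auto simp: vvar_def power2_eq_square mult_single numeral_2_eq_2 simp flip: single_add)
    moreover have "e - Poly_Mapping.single i 2 + Poly_Mapping.single i 2 = e"
      using 2 by (intro sub) (auto simp: lookup_single when_def)
    ultimately show ?thesis by simp
  next
    case 3
    let ?f = "squarefree_exponent (Poly_Mapping.keys e)"
    have "uv_term (J \<union> {}) (Poly_Mapping.single (e - ?f + ?f) c) \<in> N"
      using fin rel[of "Poly_Mapping.keys e"] 3 range
      by (intro multiple range_sub) (auto simp: prod_vvar monomial_in_range_def)
    moreover have "e - ?f + ?f = e"
      by (intro sub) (auto simp: lookup_squarefree_exponent in_keys_iff)
    ultimately show ?thesis by simp
  qed
qed

lemma R_relations_vanishing:
  assumes "simplicial_complex_on m K"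
  shows "R_relations m K \<subseteq> (vanishing m K :: 'k::comm_ring_1 uvpoly set)"
proof -
  have 1: "monomial_in_range m {} (squarefree_exponent L) \<and>
      \<not> normal_monomial K {} (squarefree_exponent L)" if "L \<subseteq> {1..m}" "L \<notin> K" for L
    using that finite_subset[of L "{1..m}"]
    by (simp add: monomial_in_range_def normal_monomial_def keys_squarefree_exponent)
  have 2: "monomial_in_range m {} (Poly_Mapping.single i 2) \<and>
      \<not> normal_monomial K {} (Poly_Mapping.single i 2)" if "i \<in> {1..m}" for i
    using that by (auto simp: monomial_in_range_def normal_monomial_def lookup_single intro!: exI[of _ i])
  have 3: "monomial_in_range m {i} (Poly_Mapping.single i 1) \<and>
      \<not> normal_monomial K {i} (Poly_Mapping.single i 1)" if "i \<in> {1..m}" for i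
    using that by (auto simp: monomial_in_range_def normal_monomial_def lookup_single intro!: exI[of _ i])
  have vv: "vvar i ^ 2 = (Poly_Mapping.single (Poly_Mapping.single i 2) 1 :: 'k vpoly)" for i
    by (simp add: vvar_def power2_eq_square mult_single numeral_2_eq_2 flip: single_add)
  have v: "vvar i = (Poly_Mapping.single (Poly_Mapping.single i 1) 1 :: 'k vpoly)" for i
    by (simp add: vvar_def)
  have "uv_term {} (\<Prod>i\<in>L. vvar i) \<in> (vanishing m K :: 'k uvpoly set)"
    if "L \<subseteq> {1..m}" "L \<notin> K" for L
    using 1[OF that] that finite_subset[of L "{1..m}"]
    by (simp add: vanishing_def uv_term_supported_iff prod_vvar)
  moreover have "uv_term {} (vvar i ^ 2) \<in> (vanishing m K :: 'k uvpoly set)"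
    "uv_term {i} (vvar i) \<in> (vanishing m K :: 'k uvpoly set)" if "i \<in> {1..m}" for i
    using 2[OF that] 3[OF that] unfolding vv by (simp_all add: vanishing_def uv_term_supported_iff v)
  ultimately show ?thesis
    unfolding R_relations_def by blast
qed

text \<open>One inclusion holds because \<open>vanishing m K\<close> is an ideal containing the
  relations, the other because each element is a finite sum of its monomials. Congruence modulo the
  relations thereby becomes a condition on supports.\<close>

lemma R_ideal_eq_vanishing:
  assumes K: "simplicial_complex_on m K"
  shows "R_ideal m K = (vanishing m K :: 'k::comm_ring_1 uvpoly set)"
proof
  show "R_ideal m K \<subseteq> (vanishing m K :: 'k uvpoly set)"
    unfolding R_ideal_def genideal_def using ideal_vanishing[OF K] R_relations_vanishing[OF K] by auto
  show "(vanishing m K :: 'k uvpoly set) \<subseteq> R_ideal m K"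
    unfolding R_ideal_def genideal_def
  proof (intro subsetI InterI)
    fix x :: "'k uvpoly" and N :: "'k uvpoly set" assume x: "x \<in> vanishing m K"
      and "N \<in> {I. ideal I (uv_algebra m) \<and> R_relations m K \<subseteq> I}"
    then have N: "ideal N (uv_algebra m)" "R_relations m K \<subseteq> N" by auto
    interpret ideal N "uv_algebra m" by fact
    have closed: "0 \<in> N" "\<And>x y. x \<in> N \<Longrightarrow> y \<in> N \<Longrightarrow> x + y \<in> N"
      using additive_subgroup.zero_closed[OF is_additive_subgroup]
        additive_subgroup.a_closed[OF is_additive_subgroup]
      by (simp_all add: uv_algebra_simps)
    have sum_closed: "sum f A \<in> N" if "\<And>a. a \<in> A \<Longrightarrow> f a \<in> N" for f :: "nat set \<times> (nat \<Rightarrow>\<^sub>0 nat) \<Rightarrow> 'k uvpoly" and A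
      using that
      by (induction A rule: infinite_finite_induct)
        (auto intro: closed)
    have "x \<in> supported (monomial_in_range m)"
      using x unfolding vanishing_def by (auto intro: supported_mono)
    then have "x = (\<Sum>(J, e)\<in>Sigma (Pow {1..m}) (\<lambda>J. Poly_Mapping.keys (x J)).
        uv_term J (Poly_Mapping.single e (Poly_Mapping.lookup (x J) e)))"
      by (rule uvpoly_eq_sum_monomials)
    also have "\<dots> \<in> N"
      using x by (intro sum_closed) (auto simp: vanishing_def supported_def intro!: vanishing_monomial_in_ideal[OF N])
    finally show "x \<in> N" .
  qed
qed


section \<open>Normal representatives\<close>

text \<open>\<open>R_algebra\<close> is the quotient ring with further record fields, and the ring
  laws have to be carried over to the extended record.\<close>

lemma ring_extend:
  assumes "ring R"
  shows "ring (ring.extend R f)"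
proof -
  interpret ring R by fact
  show ?thesis
  proof (rule ringI)
    show "abelian_group (ring.extend R f)"
    proof (rule abelian_groupI)
      fix x assume "x \<in> carrier (ring.extend R f)"
      then show "\<exists>y\<in>carrier (ring.extend R f). y \<oplus>\<^bsub>ring.extend R f\<^esub> x = \<zero>\<^bsub>ring.extend R f\<^esub>"
        by (intro bexI[of _ "\<ominus>\<^bsub>R\<^esub> x"]) (auto simp: ring.defs l_neg)
    qed (auto simp: ring.defs a_ac)
    show "monoid (ring.extend R f)"
      by (rule monoidI) (auto simp: ring.defs m_assoc)
  qed (auto simp: ring.defs l_distr r_distr)
qed

section \<open>Degree and multidegree of monomials\<close>

definition monomial_degree :: "nat set \<Rightarrow> (nat \<Rightarrow>\<^sub>0 nat) \<Rightarrow> int" where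
  "monomial_degree J e =
     int (card J) + 2 * int (\<Sum>i\<in>Poly_Mapping.keys e. Poly_Mapping.lookup e i)"

definition has_multidegree :: "nat set \<Rightarrow> nat set \<Rightarrow> (nat \<Rightarrow>\<^sub>0 nat) \<Rightarrow> bool" where
  "has_multidegree I J e \<longleftrightarrow>
     (\<forall>i. of_bool (i \<in> J) + Poly_Mapping.lookup e i = (of_bool (i \<in> I) :: nat))"

lemma exponent_sum_add:
  fixes e f :: "nat \<Rightarrow>\<^sub>0 nat"
  shows "(\<Sum>i\<in>Poly_Mapping.keys (e + f). Poly_Mapping.lookup (e + f) i) =
    (\<Sum>i\<in>Poly_Mapping.keys e. Poly_Mapping.lookup e i) +
    (\<Sum>i\<in>Poly_Mapping.keys f. Poly_Mapping.lookup f i :: nat)"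
proof -
  have "(\<Sum>i\<in>Poly_Mapping.keys e. Poly_Mapping.lookup e i) =
      (\<Sum>i\<in>Poly_Mapping.keys e \<union> Poly_Mapping.keys f. Poly_Mapping.lookup e i)"
    "(\<Sum>i\<in>Poly_Mapping.keys f. Poly_Mapping.lookup f i) =
      (\<Sum>i\<in>Poly_Mapping.keys e \<union> Poly_Mapping.keys f. Poly_Mapping.lookup f i)"
    by (intro sum.mono_neutral_left; simp add: in_keys_iff)+
  then show ?thesis
    by (simp add: keys_plus_nat lookup_add sum.distrib)
qed

lemma monomial_degree_mult:
  "finite J \<Longrightarrow> finite L \<Longrightarrow> J \<inter> L = {} \<Longrightarrow>
    monomial_degree (J \<union> L) (e + f) = monomial_degree J e + monomial_degree L f"
  by (simp add: monomial_degree_def exponent_sum_add card_Un_disjoint)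

lemma monomial_degree_diff:
  assumes "finite J" "j \<notin> J"
  shows "monomial_degree J (Poly_Mapping.single j 1 + e) = monomial_degree (insert j J) e + 1"
  using assms by (simp add: monomial_degree_def exponent_sum_add)

lemma has_multidegree_mult:
  assumes "has_multidegree I J e" "has_multidegree I' L f" "I \<inter> I' = {}"
  shows "has_multidegree (I \<union> I') (J \<union> L) (e + f)"
  unfolding has_multidegree_def
proof
  fix i
  show "of_bool (i \<in> J \<union> L) + Poly_Mapping.lookup (e + f) i = (of_bool (i \<in> I \<union> I') :: nat)"
    using assms(1,2)[unfolded has_multidegree_def, rule_format, of i] assms(3)
    by (auto simp: lookup_add of_bool_def split: if_splits)
qed

lemma has_multidegree_diff:
  assumes "j \<notin> J"
  shows "has_multidegree I J (Poly_Mapping.single j 1 + e) \<longleftrightarrow> has_multidegree I (insert j J) e"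
proof -
  have "of_bool (i \<in> J) + Poly_Mapping.lookup (Poly_Mapping.single j 1 + e) i =
      of_bool (i \<in> insert j J) + Poly_Mapping.lookup e i" for i
    using assms by (auto simp: lookup_add lookup_single when_def)
  then show ?thesis by (simp add: has_multidegree_def)
qed

lemma uv_degree_part_eq:
  "uv_degree_part m p = supported (\<lambda>J e. monomial_in_range m J e \<and> monomial_degree J e = p)"
  unfolding uv_degree_part_def carrier_uv_algebra monomial_degree_def
  by (auto simp: supported_def)

lemma uv_multidegree_part_eq:
  "uv_multidegree_part m I = supported (\<lambda>J e. monomial_in_range m J e \<and> has_multidegree I J e)"
  unfolding uv_multidegree_part_def carrier_uv_algebra has_multidegree_def
  by (auto simp: supported_def)

lemma uv_degree_part_subset_carrier: "uv_degree_part m p \<subseteq> carrier (uv_algebra m)"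
  by (auto simp: uv_degree_part_def)

lemma uv_multidegree_part_subset_carrier: "uv_multidegree_part m I \<subseteq> carrier (uv_algebra m)"
  by (auto simp: uv_multidegree_part_def)

text \<open>The differential trades \<open>u_j\<close> for \<open>v_j\<close>, which keeps the
  multidegree of every monomial. This is what allows a primitive to be replaced by its component of
  the right multidegree.\<close>

lemma restrict_has_multidegree_diff:
  "restrict_support (has_multidegree I) (uv_diff m x) =
    uv_diff m (restrict_support (has_multidegree I) x)"
proof -
  let ?r = "restrict_support (has_multidegree I)"
  have "uv_diff m (?r x) \<in> supported (has_multidegree I)"
    by (rule uv_diff_supported[OF restrict_support_in_supported])
      (simp add: has_multidegree_diff del: One_nat_def)
  moreover have "uv_diff m (x - ?r x) \<in> supported (\<lambda>J e. \<not> has_multidegree I J e)"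
    by (rule uv_diff_supported[OF diff_restrict_support_in_supported])
      (simp add: has_multidegree_diff del: One_nat_def)
  moreover have "uv_diff m x = uv_diff m (?r x) + uv_diff m (x - ?r x)"
    by (simp flip: uv_diff_add)
  ultimately show ?thesis
    by (simp add: restrict_support_add restrict_support_eq_iff[THEN iffD2]
        restrict_support_eq_zero_iff[THEN iffD2])
qed

lemma uv_diff_zero: "uv_diff m 0 = 0"
  by (simp add: uv_diff_def fun_eq_iff)

lemma uv_diff_minus: "uv_diff m (x - y) = uv_diff m x - uv_diff m y"
  using uv_diff_add[of m "x - y" y] by (simp add: algebra_simps)

text \<open>An element of \<open>R\<^sup>*(K)\<close> has a unique representative supported on the normal monomials; the
  multiplication and the differential of \<open>R\<^sup>*(K)\<close> are transported to these representatives.\<close>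

abbreviation normal_form :: "nat set set \<Rightarrow> 'k::comm_ring_1 uvpoly \<Rightarrow> 'k uvpoly" where
  "normal_form K \<equiv> restrict_support (normal_monomial K)"

definition normal_mult ::
  "nat set set \<Rightarrow> 'k::comm_ring_1 uvpoly \<Rightarrow> 'k uvpoly \<Rightarrow> 'k uvpoly" where
  "normal_mult K x y = normal_form K (uv_mult x y)"

definition normal_diff :: "nat \<Rightarrow> nat set set \<Rightarrow> 'k::comm_ring_1 uvpoly \<Rightarrow> 'k uvpoly" where
  "normal_diff m K x = normal_form K (uv_diff m x)"

definition normal_part ::
  "nat \<Rightarrow> nat set set \<Rightarrow> nat set \<Rightarrow> int \<Rightarrow> 'k::comm_ring_1 uvpoly set" where
  "normal_part m K I p = supported (\<lambda>J e. normal_monomial K J e \<and> monomial_in_range m J e \<and>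
     monomial_degree J e = p \<and> has_multidegree I J e)"

text \<open>The choice is harmless for a coset: its members differ by monomials that are not normal,
  and \<open>normal_form\<close> kills these.\<close>

definition normal_rep :: "nat set set \<Rightarrow> 'k::comm_ring_1 uvpoly set \<Rightarrow> 'k uvpoly" where
  "normal_rep K Y = normal_form K (SOME x. x \<in> Y)"

lemma normal_part_alt:
  "x \<in> normal_part m K I p \<longleftrightarrow>
    normal_form K x = x \<and> x \<in> uv_degree_part m p \<and> x \<in> uv_multidegree_part m I"
  unfolding normal_part_def uv_degree_part_eq uv_multidegree_part_eq restrict_support_eq_iff
  by (auto simp: supported_def)

locale simplicial_complex =
  fixes m :: nat and K :: "nat set set"
  assumes complex: "simplicial_complex_on m K"
begin

text \<open>The part of \<open>x\<close> that reduction discards consists of monomials that are not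
  normal, and these absorb multiplication by any \<open>y\<close>.\<close>

lemma normal_form_mult_left: "normal_form K (uv_mult (normal_form K x) y) = normal_form K (uv_mult x y)"
proof -
  have "uv_mult (x - normal_form K x) y \<in> supported (\<lambda>J e. \<not> normal_monomial K J e)"
    by (rule uv_mult_supported[OF diff_restrict_support_in_supported, where Q = "\<lambda>_ _. True"])
      (auto simp: supported_iff dest: normal_monomial_divisor[OF complex])
  then have "normal_form K (uv_mult (x - normal_form K x) y) = 0"
    by (simp add: restrict_support_eq_zero_iff)
  then show ?thesis
    using uv_mult_add_left[of "normal_form K x" "x - normal_form K x" y]
    by (simp add: restrict_support_add)
qed

lemma normal_form_mult_right: "normal_form K (uv_mult x (normal_form K y)) = normal_form K (uv_mult x y)"
proof -
  have "uv_mult x (y - normal_form K y) \<in> supported (\<lambda>J e. \<not> normal_monomial K J e)"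
    by (rule uv_mult_supported[OF _ diff_restrict_support_in_supported, where P = "\<lambda>_ _. True"])
      (simp add: supported_iff, metis Un_commute add.commute normal_monomial_divisor[OF complex])
  then have "normal_form K (uv_mult x (y - normal_form K y)) = 0"
    by (simp add: restrict_support_eq_zero_iff)
  then show ?thesis
    using uv_mult_add_right[of x "normal_form K y" "y - normal_form K y"]
    by (simp add: restrict_support_add)
qed

lemma normal_form_diff: "normal_form K (uv_diff m (normal_form K x)) = normal_form K (uv_diff m x)"
proof -
  have "uv_diff m (x - normal_form K x) \<in> supported (\<lambda>J e. \<not> normal_monomial K J e)"
    by (rule uv_diff_supported[OF diff_restrict_support_in_supported])
      (use normal_monomial_diff[OF complex] in blast)
  then have "normal_form K (uv_diff m (x - normal_form K x)) = 0"
    by (simp add: restrict_support_eq_zero_iff)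
  then show ?thesis
    using uv_diff_add[of m "normal_form K x" "x - normal_form K x"]
    by (simp add: restrict_support_add)
qed

lemma normal_mult_assoc: "normal_mult K (normal_mult K x y) z = normal_mult K x (normal_mult K y z)"
  by (simp add: normal_mult_def normal_form_mult_left normal_form_mult_right uv_mult_assoc)

lemma normal_diff_diff: "normal_diff m K (normal_diff m K x) = 0"
  by (simp add: normal_diff_def normal_form_diff uv_diff_diff restrict_support_zero)

lemma normal_diff_mult:
  assumes "x \<in> uv_degree_part m p"
  shows "normal_diff m K (normal_mult K x y) =
    normal_mult K (normal_diff m K x) y + parity_sign p (normal_mult K x (normal_diff m K y))"
proof -
  \<comment> \<open>On every monomial of \<open>x\<close> the number \<open>card J\<close> has the
    parity of \<open>p\<close>, as the \<open>v\<close>-variables have degree 2.\<close>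
  have bar: "(\<lambda>J. (-1) ^ card J * x J) = parity_sign p x"
  proof
    fix J
    show "(-1) ^ card J * x J = parity_sign p x J"
    proof (cases "x J = 0")
      case False
      then obtain e where "e \<in> Poly_Mapping.keys (x J)" by fastforce
      then have "monomial_degree J e = p"
        using assms by (auto simp: uv_degree_part_eq supported_def)
      then have "even p \<longleftrightarrow> even (card J)" by (auto simp: monomial_degree_def)
      then show ?thesis by (auto simp: parity_sign_def)
    qed (simp add: parity_sign_def)
  qed
  have "uv_mult (- x) z = - uv_mult x z" for z
    using uv_mult_add_left[of x "- x" z] uv_mult_add_left[of 0 0 z] by (simp add: eq_neg_iff_add_eq_0 add.commute)
  then have "normal_form K (uv_mult (parity_sign p x) (uv_diff m y)) =
      parity_sign p (normal_form K (uv_mult x (uv_diff m y)))"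
    by (simp add: parity_sign_def restrict_support_uminus)
  then show ?thesis
    by (simp add: normal_diff_def normal_mult_def normal_form_mult_left normal_form_mult_right
        normal_form_diff uv_diff_mult bar restrict_support_add)
qed

lemma normal_diff_in_normal_part:
  assumes "x \<in> normal_part m K I p"
  shows "normal_diff m K x \<in> normal_part m K I (p + 1)"
proof -
  have "uv_diff m x \<in> supported (\<lambda>J e. monomial_in_range m J e \<and> monomial_degree J e = p + 1 \<and>
      has_multidegree I J e)"
  proof (rule uv_diff_supported[OF assms[unfolded normal_part_def]], elim conjE, intro conjI)
    fix J j q assume *: "j \<in> {1..m}" "j \<notin> J" "monomial_in_range m (insert j J) q"
      "monomial_degree (insert j J) q = p" "has_multidegree I (insert j J) q"
    then have "finite J" using finite_subset by (auto simp: monomial_in_range_def)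
    then show "monomial_degree J (Poly_Mapping.single j 1 + q) = p + 1"
      using * by (simp add: monomial_degree_diff del: One_nat_def)
    show "has_multidegree I J (Poly_Mapping.single j 1 + q)"
      using * by (simp add: has_multidegree_diff del: One_nat_def)
    show "monomial_in_range m J (Poly_Mapping.single j 1 + q)"
      using * by (simp add: monomial_in_range_def keys_plus_nat)
  qed
  then have "normal_form K (uv_diff m x) \<in> supported (normal_monomial K) \<inter>
      supported (\<lambda>J e. monomial_in_range m J e \<and> monomial_degree J e = p + 1 \<and> has_multidegree I J e)"
    by (auto intro: restrict_support_preserves_supported restrict_support_in_supported)
  then show ?thesis
    by (simp only: supported_Int normal_diff_def normal_part_def)
qed

lemma normal_mult_in_normal_part:
  assumes "x \<in> normal_part m K I p" "y \<in> normal_part m K I' q" "I \<inter> I' = {}"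
  shows "normal_mult K x y \<in> normal_part m K (I \<union> I') (p + q)"
proof -
  have "uv_mult x y \<in> supported (\<lambda>J e. monomial_in_range m J e \<and> monomial_degree J e = p + q \<and>
      has_multidegree (I \<union> I') J e)"
    by (rule uv_mult_supported[OF assms(1,2)[unfolded normal_part_def]])
      (use assms(3) in \<open>auto simp: monomial_in_range_def keys_plus_nat monomial_degree_mult
        intro: has_multidegree_mult\<close>)
  then have "normal_form K (uv_mult x y) \<in> supported (normal_monomial K) \<inter>
      supported (\<lambda>J e. monomial_in_range m J e \<and> monomial_degree J e = p + q \<and>
        has_multidegree (I \<union> I') J e)"
    by (auto intro: restrict_support_preserves_supported restrict_support_in_supported)
  then show ?thesis
    by (simp only: supported_Int normal_mult_def normal_part_def)
qed

text \<open>On the carrier the ideal of relations is the kernel of \<open>normal_form\<close>, so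
  its cosets are the fibres.\<close>

lemma R_proj_eq:
  assumes "x \<in> carrier (uv_algebra m)"
  shows "R_proj m K x = {y \<in> carrier (uv_algebra m). normal_form K y = normal_form K x}"
proof -
  have vanishing: "h \<in> vanishing m K \<longleftrightarrow> h \<in> carrier (uv_algebra m) \<and> normal_form K h = 0"
    for h :: "'a uvpoly"
    unfolding vanishing_def carrier_uv_algebra restrict_support_eq_zero_iff supported_Int[symmetric]
    by simp
  have "y \<in> R_proj m K x \<longleftrightarrow> y - x \<in> vanishing m K" for y
    unfolding R_proj_def R_ideal_eq_vanishing[OF complex] a_r_coset_def' uv_algebra_simps
    by (auto intro!: bexI[of _ "y - x"])
  moreover have "y - x \<in> carrier (uv_algebra m) \<longleftrightarrow> y \<in> carrier (uv_algebra m)" for y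
    using assms supported_add[of "y - x" _ x] supported_diff[of y _ x]
    by (auto simp: carrier_uv_algebra)
  ultimately show ?thesis
    by (auto simp: vanishing restrict_support_diff)
qed

section \<open>Operations of the quotient ring, read on normal representatives\<close>

lemma ideal_R_ideal: "ideal (R_ideal m K :: 'k::comm_ring_1 uvpoly set) (uv_algebra m)"
  by (simp add: R_ideal_eq_vanishing[OF complex] ideal_vanishing[OF complex])

lemma ring_R_algebra: "ring (R_algebra m K :: 'k::comm_ring_1 uvpoly set dga)"
  unfolding R_algebra_def by (intro ring_extend ideal.quotient_is_ring ideal_R_ideal)

lemma carrier_R_algebra: "carrier (R_algebra m K) = R_proj m K ` carrier (uv_algebra m)"
  by (auto simp: R_algebra_def ring.defs FactRing_def A_RCOSETS_def' R_proj_def)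

lemma R_proj_in_carrier: "x \<in> carrier (uv_algebra m) \<Longrightarrow> R_proj m K x \<in> carrier (R_algebra m K)"
  by (simp add: carrier_R_algebra)

lemma R_algebra_add:
  "x \<in> carrier (uv_algebra m) \<Longrightarrow> y \<in> carrier (uv_algebra m) \<Longrightarrow>
    R_proj m K x \<oplus>\<^bsub>R_algebra m K\<^esub> R_proj m K y = R_proj m K (x + y)"
  using ring_hom_add[OF ideal.rcos_ring_hom[OF ideal_R_ideal], of x y]
  by (simp add: R_algebra_def ring.defs R_proj_def uv_algebra_simps)

lemma R_algebra_mult:
  "x \<in> carrier (uv_algebra m) \<Longrightarrow> y \<in> carrier (uv_algebra m) \<Longrightarrow>
    R_proj m K x \<otimes>\<^bsub>R_algebra m K\<^esub> R_proj m K y = R_proj m K (uv_mult x y)"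
  using ring_hom_mult[OF ideal.rcos_ring_hom[OF ideal_R_ideal], of x y]
  by (simp add: R_algebra_def ring.defs R_proj_def uv_algebra_simps)

lemma R_algebra_zero: "\<zero>\<^bsub>R_algebra m K\<^esub> = R_proj m K 0"
proof -
  have "\<zero>\<^bsub>R_algebra m K\<^esub> = (R_ideal m K :: 'a uvpoly set)"
    by (simp add: R_algebra_def ring.defs FactRing_def)
  also have "\<dots> = R_proj m K 0"
    unfolding R_proj_def a_r_coset_def' uv_algebra_simps by simp
  finally show ?thesis .
qed

text \<open>The union in the definition ranges over a whole coset, whose members have differentials
  with equal normal forms; so all sets in the union coincide.\<close>

lemma R_algebra_differential:
  assumes "x \<in> carrier (uv_algebra m)"
  shows "differential (R_algebra m K) (R_proj m K x) = R_proj m K (uv_diff m x)"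
proof -
  have "R_proj m K (uv_diff m y) = R_proj m K (uv_diff m x)" if "y \<in> R_proj m K x" for y
  proof -
    have y: "y \<in> carrier (uv_algebra m)" "normal_form K y = normal_form K x"
      using that R_proj_eq[OF assms] by auto
    then have "normal_form K (uv_diff m y) = normal_form K (uv_diff m x)"
      by (metis normal_form_diff)
    moreover have "uv_diff m x \<in> carrier (uv_algebra m)" "uv_diff m y \<in> carrier (uv_algebra m)"
      using assms y by (simp_all add: carrier_uv_algebra uv_diff_in_range)
    ultimately show ?thesis by (simp add: R_proj_eq)
  qed
  moreover have "R_proj m K x \<noteq> {}" using assms R_proj_eq by blast
  ultimately have "(\<Union>y\<in>R_proj m K x. R_proj m K (uv_diff m y)) = R_proj m K (uv_diff m x)"
    by (intro SUP_eq_const)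
  then show ?thesis
    by (simp add: R_algebra_def ring.defs dga.defs)
qed

lemma graded_part_R_algebra: "graded_part (R_algebra m K) p = R_proj m K ` uv_degree_part m p"
  by (simp add: R_algebra_def ring.defs dga.defs)

lemma normal_rep_R_proj:
  assumes "x \<in> carrier (uv_algebra m)"
  shows "normal_rep K (R_proj m K x) = normal_form K x"
proof -
  have "x \<in> R_proj m K x" using assms by (simp add: R_proj_eq)
  then have "(SOME y. y \<in> R_proj m K x) \<in> R_proj m K x" by (rule someI[where P = "\<lambda>y. y \<in> R_proj m K x"])
  then show ?thesis using assms by (simp add: normal_rep_def R_proj_eq)
qed

lemma normal_form_in_carrier:
  "x \<in> carrier (uv_algebra m) \<Longrightarrow> normal_form K x \<in> carrier (uv_algebra m)"
  by (simp add: carrier_uv_algebra restrict_support_preserves_supported)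

lemma normal_rep:
  assumes "Y \<in> carrier (R_algebra m K)"
  shows "normal_rep K Y \<in> carrier (uv_algebra m)" "normal_form K (normal_rep K Y) = normal_rep K Y"
    "R_proj m K (normal_rep K Y) = Y"
proof -
  obtain x where x: "x \<in> carrier (uv_algebra m)" "Y = R_proj m K x"
    using assms by (auto simp: carrier_R_algebra)
  then show "normal_rep K Y \<in> carrier (uv_algebra m)"
    by (simp add: normal_rep_R_proj normal_form_in_carrier)
  show nf: "normal_form K (normal_rep K Y) = normal_rep K Y"
    using x by (simp add: normal_rep_R_proj restrict_support_eq_iff restrict_support_in_supported)
  have rep: "normal_rep K Y = normal_form K x" using x by (simp add: normal_rep_R_proj)
  show "R_proj m K (normal_rep K Y) = Y"
    unfolding rep R_proj_eq[OF normal_form_in_carrier[OF x(1)]] nf[unfolded rep]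
    by (rule R_proj_eq[OF x(1), folded x(2), symmetric])
qed

text \<open>Turns an equation between cosets into one between normal representatives, where sums and
  signs can be computed.\<close>

lemma normal_rep_inject:
  "Y \<in> carrier (R_algebra m K) \<Longrightarrow> Z \<in> carrier (R_algebra m K) \<Longrightarrow>
    normal_rep K Y = normal_rep K Z \<Longrightarrow> Y = Z"
  by (metis normal_rep(3))

lemma normal_rep_zero: "normal_rep K \<zero>\<^bsub>R_algebra m K\<^esub> = 0"
  by (simp add: R_algebra_zero normal_rep_R_proj carrier_uv_algebra supported_zero restrict_support_zero)

lemma normal_rep_add:
  assumes "Y \<in> carrier (R_algebra m K)" "Z \<in> carrier (R_algebra m K)"
  shows "normal_rep K (Y \<oplus>\<^bsub>R_algebra m K\<^esub> Z) = normal_rep K Y + normal_rep K Z"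
  using assms normal_rep(1,2)[OF assms(1)] normal_rep(1,2)[OF assms(2)]
    R_algebra_add[of "normal_rep K Y" "normal_rep K Z"]
    normal_rep_R_proj[of "normal_rep K Y + normal_rep K Z"]
  by (simp add: normal_rep(3) carrier_uv_algebra supported_add restrict_support_add)

lemma normal_rep_uminus:
  assumes "Y \<in> carrier (R_algebra m K)"
  shows "normal_rep K (\<ominus>\<^bsub>R_algebra m K\<^esub> Y) = - normal_rep K Y"
proof -
  interpret ring "R_algebra m K :: 'a uvpoly set dga" by (rule ring_R_algebra)
  have "normal_rep K (\<ominus>\<^bsub>R_algebra m K\<^esub> Y) + normal_rep K Y = 0"
    using normal_rep_add[of "\<ominus>\<^bsub>R_algebra m K\<^esub> Y" Y] assms
    by (simp add: l_neg normal_rep_zero)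
  then show ?thesis by (simp add: eq_neg_iff_add_eq_0)
qed

lemma normal_rep_minus:
  assumes "Y \<in> carrier (R_algebra m K)" "Z \<in> carrier (R_algebra m K)"
  shows "normal_rep K (Y \<ominus>\<^bsub>R_algebra m K\<^esub> Z) = normal_rep K Y - normal_rep K Z"
proof -
  interpret ring "R_algebra m K :: 'a uvpoly set dga" by (rule ring_R_algebra)
  show ?thesis using assms by (simp add: a_minus_def normal_rep_add normal_rep_uminus)
qed

lemma normal_rep_mult:
  assumes "Y \<in> carrier (R_algebra m K)" "Z \<in> carrier (R_algebra m K)"
  shows "normal_rep K (Y \<otimes>\<^bsub>R_algebra m K\<^esub> Z) = normal_mult K (normal_rep K Y) (normal_rep K Z)"
  using assms normal_rep(1)[OF assms(1)] normal_rep(1)[OF assms(2)]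
    R_algebra_mult[of "normal_rep K Y" "normal_rep K Z"]
    normal_rep_R_proj[of "uv_mult (normal_rep K Y) (normal_rep K Z)"]
  by (simp add: normal_rep(3) carrier_uv_algebra uv_mult_in_range normal_mult_def)

lemma differential_in_carrier:
  "Y \<in> carrier (R_algebra m K) \<Longrightarrow> differential (R_algebra m K) Y \<in> carrier (R_algebra m K)"
  by (auto simp: carrier_R_algebra R_algebra_differential carrier_uv_algebra uv_diff_in_range)

lemma normal_rep_differential:
  assumes "Y \<in> carrier (R_algebra m K)"
  shows "normal_rep K (differential (R_algebra m K) Y) = normal_diff m K (normal_rep K Y)"
  using assms normal_rep(1)[OF assms]
    R_algebra_differential[of "normal_rep K Y"] normal_rep_R_proj[of "uv_diff m (normal_rep K Y)"]
  by (simp add: normal_rep(3) carrier_uv_algebra uv_diff_in_range normal_diff_def)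

lemma normal_rep_finsum:
  fixes f :: "'b \<Rightarrow> 'k::comm_ring_1 uvpoly set"
  assumes "\<And>a. a \<in> S \<Longrightarrow> f a \<in> carrier (R_algebra m K)"
  shows "normal_rep K (\<Oplus>\<^bsub>R_algebra m K\<^esub>a\<in>S. f a) = (\<Sum>a\<in>S. normal_rep K (f a))"
proof -
  interpret ring "R_algebra m K :: 'k uvpoly set dga" by (rule ring_R_algebra)
  show ?thesis
    using assms
  proof (induction S rule: infinite_finite_induct)
    case (insert a S)
    then have "normal_rep K (finsum (R_algebra m K) f (insert a S)) =
        normal_rep K (f a \<oplus>\<^bsub>R_algebra m K\<^esub> finsum (R_algebra m K) f S)"
      by (subst finsum_insert) auto
    also have "\<dots> = normal_rep K (f a) + normal_rep K (finsum (R_algebra m K) f S)"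
      using insert by (intro normal_rep_add finsum_closed) auto
    finally show ?case using insert by simp
  qed (simp_all add: finsum_infinite normal_rep_zero)
qed

lemma graded_part_subset_carrier: "graded_part (R_algebra m K) p \<subseteq> carrier (R_algebra m K)"
  by (auto simp: graded_part_R_algebra carrier_R_algebra uv_degree_part_def)

lemma in_graded_part_iff:
  assumes "Y \<in> carrier (R_algebra m K)"
  shows "Y \<in> graded_part (R_algebra m K) p \<longleftrightarrow> normal_rep K Y \<in> uv_degree_part m p"
proof
  assume "Y \<in> graded_part (R_algebra m K) p"
  then obtain x where "x \<in> uv_degree_part m p" "Y = R_proj m K x"
    by (auto simp: graded_part_R_algebra)
  then show "normal_rep K Y \<in> uv_degree_part m p"
    using normal_rep_R_proj[OF subsetD[OF uv_degree_part_subset_carrier], of x]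
    by (simp add: uv_degree_part_eq restrict_support_preserves_supported)
next
  assume "normal_rep K Y \<in> uv_degree_part m p"
  then show "Y \<in> graded_part (R_algebra m K) p"
    using normal_rep(3)[OF assms] by (auto simp: graded_part_R_algebra intro: rev_image_eqI)
qed

lemma in_multidegree_part_iff:
  assumes "Y \<in> carrier (R_algebra m K)"
  shows "Y \<in> R_multidegree_part m K I \<longleftrightarrow> normal_rep K Y \<in> uv_multidegree_part m I"
proof
  assume "Y \<in> R_multidegree_part m K I"
  then obtain x where "x \<in> uv_multidegree_part m I" "Y = R_proj m K x"
    by (auto simp: R_multidegree_part_def)
  then show "normal_rep K Y \<in> uv_multidegree_part m I"
    using normal_rep_R_proj[OF subsetD[OF uv_multidegree_part_subset_carrier], of x]
    by (simp add: uv_multidegree_part_eq restrict_support_preserves_supported)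
next
  assume "normal_rep K Y \<in> uv_multidegree_part m I"
  then show "Y \<in> R_multidegree_part m K I"
    using normal_rep(3)[OF assms] by (auto simp: R_multidegree_part_def intro: rev_image_eqI)
qed

end


section \<open>Simplicial cochains\<close>

lemma position_sign_square: "position_sign L I * position_sign L I = (1 :: 'k::comm_ring_1)"
  unfolding position_sign_def prod.distrib[symmetric] power_add[symmetric]
  by (intro prod.neutral ballI) simp

text \<open>The elements of \<open>I\<close> before \<open>j\<close> split into those in
  \<open>I - L\<close>, counted by the differential of the algebra, and those in \<open>L\<close>,
  counted by the simplicial coboundary; the factor of \<open>j\<close> in
  \<open>position_sign L I\<close> counts both.\<close>

lemma position_sign_remove:
  assumes "finite I" "L \<subseteq> I" "j \<in> L"
  shows "shuffle_sign {j} (I - L) * position_sign (L - {j}) I =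
    (position_sign L I * shuffle_sign {j} L :: 'k::comm_ring_1)"
proof -
  have "finite L" using assms finite_subset by auto
  then have "position_sign L I = shuffle_sign {j} I * (position_sign (L - {j}) I :: 'k)"
    using assms by (simp add: position_sign_def prod.remove shuffle_sign_singleton_left)
  moreover have "shuffle_sign {j} I = shuffle_sign {j} (I - L) * (shuffle_sign {j} L :: 'k)"
    using shuffle_sign_union_right[of "{j}" "I - L" L, where 'a = 'k] assms(2)
    by (simp add: Un_absorb2 Diff_Int_distrib2)
  ultimately show ?thesis by (simp add: mult_ac)
qed

lemma cochain_to_uv_eq:
  "finite I \<Longrightarrow> J \<subseteq> I \<Longrightarrow> cochain_to_uv I x J =
    Poly_Mapping.single (squarefree_exponent (I - J)) (position_sign (I - J) I * x (I - J))"
  by (simp add: cochain_to_uv_def prod_vvar mult_single)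

lemma lookup_cochain_to_uv:
  "finite I \<Longrightarrow> Poly_Mapping.lookup (cochain_to_uv I x J) e =
    (if J \<subseteq> I \<and> e = squarefree_exponent (I - J) then position_sign (I - J) I * x (I - J) else 0)"
  by (cases "J \<subseteq> I") (simp_all add: cochain_to_uv_eq lookup_single when_def, simp add: cochain_to_uv_def)

lemma cochain_to_uv_add:
  "finite I \<Longrightarrow> cochain_to_uv I (\<lambda>\<sigma>. x \<sigma> + y \<sigma>) = cochain_to_uv I x + cochain_to_uv I y"
  by (intro uvpoly_eqI) (simp add: lookup_cochain_to_uv lookup_add algebra_simps)

text \<open>\<open>position_sign\<close> is its own inverse, so the values of the cochain can be
  recovered over any coefficients.\<close>

lemma cochain_to_uv_eq_zeroD:
  assumes "finite I" "cochain_to_uv I x = 0" "\<tau> \<subseteq> I"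
  shows "x \<tau> = (0 :: 'k::comm_ring_1)"
proof -
  have "Poly_Mapping.lookup (cochain_to_uv I x (I - \<tau>)) (squarefree_exponent \<tau>) = 0"
    using assms(2) by simp
  then have "position_sign \<tau> I * x \<tau> = 0"
    using assms(1,3) by (simp add: lookup_cochain_to_uv double_diff)
  then have "position_sign \<tau> I * position_sign \<tau> I * x \<tau> = 0"
    by (simp add: mult.assoc)
  then show ?thesis by (simp add: position_sign_square)
qed

lemma shuffle_sign_mult_single:
  "shuffle_sign J L * Poly_Mapping.single e c = Poly_Mapping.single e (shuffle_sign J L * c)"
  by (cases "even (card {(a, b) \<in> J \<times> L. b < a})") (simp_all add: shuffle_sign_def single_uminus)

lemma sum_single:
  "(\<Sum>a\<in>A. Poly_Mapping.single e (f a)) = Poly_Mapping.single e (\<Sum>a\<in>A. f a)"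
  by (induction A rule: infinite_finite_induct) (auto simp: single_add)

text \<open>Before reduction modulo the relations the complex is that of the full simplex on
  \<open>I\<close>; \<open>K\<close> enters only through the normal form.\<close>

lemma cochain_to_uv_coboundary:
  fixes x :: "nat set \<Rightarrow> 'k::comm_ring_1"
  assumes I: "I \<subseteq> {1..m}"
  shows "uv_diff m (cochain_to_uv I x) = cochain_to_uv I (simplicial_coboundary (Pow I) x)"
proof
  have fin: "finite I" using I finite_subset by auto
  fix S
  show "uv_diff m (cochain_to_uv I x) S = cochain_to_uv I (simplicial_coboundary (Pow I) x) S"
  proof (cases "S \<subseteq> I")
    case True
    define L where "L = I - S"
    have L: "finite L" "L \<subseteq> I" "I - L = S" using fin True by (auto simp: L_def)
    have "uv_diff m (cochain_to_uv I x) S =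
        (\<Sum>j\<in>L. shuffle_sign {j} S * vvar j * cochain_to_uv I x (insert j S))"
      unfolding uv_diff_eq
      by (rule sum.mono_neutral_right) (use I True in \<open>auto simp: cochain_to_uv_def L_def\<close>)
    also have "\<dots> = (\<Sum>j\<in>L. Poly_Mapping.single (squarefree_exponent L)
        (position_sign L I * (shuffle_sign {j} L * x (L - {j}))))"
    proof (rule sum.cong[OF refl])
      fix j assume j: "j \<in> L"
      then have "insert j S \<subseteq> I" "I - insert j S = L - {j}" using True by (auto simp: L_def)
      then have "shuffle_sign {j} S * vvar j * cochain_to_uv I x (insert j S) =
          Poly_Mapping.single (Poly_Mapping.single j 1 + squarefree_exponent (L - {j}))
            (shuffle_sign {j} S * (position_sign (L - {j}) I * x (L - {j})))"
        using fin by (simp add: cochain_to_uv_eq vvar_def mult_single mult.assoc shuffle_sign_mult_single)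
      also have "Poly_Mapping.single j 1 + squarefree_exponent (L - {j}) = squarefree_exponent L"
        using L j by (simp add: squarefree_exponent_def sum.remove)
      also have "shuffle_sign {j} S * (position_sign (L - {j}) I * x (L - {j})) =
          position_sign L I * (shuffle_sign {j} L * x (L - {j}))"
        using position_sign_remove[OF fin L(2) j, where 'k = 'k] L(3) by (simp flip: mult.assoc)
      finally show "shuffle_sign {j} S * vvar j * cochain_to_uv I x (insert j S) =
          Poly_Mapping.single (squarefree_exponent L)
            (position_sign L I * (shuffle_sign {j} L * x (L - {j})))" .
    qed
    also have "\<dots> = cochain_to_uv I (simplicial_coboundary (Pow I) x) S"
      using fin True L
      by (simp add: sum_single cochain_to_uv_eq simplicial_coboundary_def sum_distrib_left
          shuffle_sign_singleton_left flip: L_def)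
    finally show ?thesis .
  next
    case False
    then show ?thesis by (auto simp: uv_diff_def cochain_to_uv_def intro!: sum.neutral)
  qed
qed

lemma sum_lookup_squarefree_exponent:
  "finite L \<Longrightarrow>
    (\<Sum>i\<in>Poly_Mapping.keys (squarefree_exponent L). Poly_Mapping.lookup (squarefree_exponent L) i) = card L"
  by (simp add: keys_squarefree_exponent lookup_squarefree_exponent)

text \<open>Every \<open>i\<close> in \<open>I\<close> occurs exactly once, as a \<open>u\<close> or
  as a \<open>v\<close>, so the monomials of multidegree \<open>I\<close> correspond to the subsets
  of \<open>I\<close>.\<close>

lemma has_multidegree_iff:
  assumes "finite I"
  shows "has_multidegree I J e \<longleftrightarrow> J \<subseteq> I \<and> e = squarefree_exponent (I - J)"
proof
  assume *: "has_multidegree I J e"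
  then have J: "J \<subseteq> I" by (force simp: has_multidegree_def of_bool_def split: if_splits)
  moreover have "e = squarefree_exponent (I - J)"
  proof (rule poly_mapping_eqI)
    fix i
    show "Poly_Mapping.lookup e i = Poly_Mapping.lookup (squarefree_exponent (I - J)) i"
      using *[unfolded has_multidegree_def, rule_format, of i] assms J
      by (auto simp: lookup_squarefree_exponent of_bool_def split: if_splits)
  qed
  ultimately show "J \<subseteq> I \<and> e = squarefree_exponent (I - J)" by simp
next
  assume "J \<subseteq> I \<and> e = squarefree_exponent (I - J)"
  then show "has_multidegree I J e"
    using assms by (auto simp: has_multidegree_def lookup_squarefree_exponent)
qed

lemma monomial_degree_squarefree:
  assumes "finite I" "\<tau> \<subseteq> I"
  shows "monomial_degree (I - \<tau>) (squarefree_exponent \<tau>) = int (card I) + int (card \<tau>)"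
proof -
  have "finite \<tau>" using assms finite_subset by auto
  moreover have "card I = card (I - \<tau>) + card \<tau>"
    using assms \<open>finite \<tau>\<close> by (simp add: card_Diff_subset card_mono)
  ultimately show ?thesis
    by (simp only: monomial_degree_def sum_lookup_squarefree_exponent)
qed

lemma normal_monomial_squarefree:
  "finite \<tau> \<Longrightarrow> normal_monomial K (I - \<tau>) (squarefree_exponent \<tau>) \<longleftrightarrow> \<tau> \<in> K"
  by (auto simp: normal_monomial_def keys_squarefree_exponent lookup_squarefree_exponent)

section \<open>Cocycles and exactness in cochain complexes\<close>

lemma cocycle_of_cohomology:
  assumes "\<alpha> \<in> carrier (cohomology C \<delta> p)"
  obtains x where "x \<in> cocycles C \<delta> p"
    "\<alpha> = (\<lambda>y. \<delta> y \<otimes>\<^bsub>C p\<^esub> x) ` carrier (C (p - 1))"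
  using assms
  by (auto simp: cohomology_def FactGroup_def RCOSETS_def r_coset_def coboundaries_def)

text \<open>\<open>C\<close> is an arbitrary family of monoid records, so \<open>y\<^sub>0\<close>
  stands in for a zero: it puts \<open>x\<close> into its own coset, which triviality identifies
  with the set of coboundaries.\<close>

lemma exact_of_trivial_cohomology:
  assumes "trivial_group (cohomology C \<delta> p)" "x \<in> cocycles C \<delta> p"
    and "y\<^sub>0 \<in> carrier (C (p - 1))" "\<delta> y\<^sub>0 \<otimes>\<^bsub>C p\<^esub> x = x"
  shows "\<exists>y\<in>carrier (C (p - 1)). \<delta> y = x"
proof -
  have "coboundaries C \<delta> p #>\<^bsub>C p\<^esub> x \<in> carrier (cohomology C \<delta> p)"
    using assms(2) by (auto simp: cohomology_def FactGroup_def RCOSETS_def r_coset_def)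
  also have "\<dots> = {coboundaries C \<delta> p}"
    using assms(1) by (simp add: trivial_group_def cohomology_def FactGroup_def)
  finally have "(\<lambda>y. \<delta> y \<otimes>\<^bsub>C p\<^esub> x) ` carrier (C (p - 1)) = coboundaries C \<delta> p"
    by (auto simp: coboundaries_def r_coset_def)
  then show ?thesis
    using assms(3,4) unfolding coboundaries_def by (metis imageE imageI)
qed

lemma simplicial_coboundary_in_cochains:
  assumes "x \<in> carrier (simplicial_cochains L p)" "\<And>\<sigma>. \<sigma> \<in> L \<Longrightarrow> finite \<sigma>"
  shows "simplicial_coboundary L x \<in> carrier (simplicial_cochains L (p + 1))"
proof -
  have "simplicial_coboundary L x \<tau> = 0" if "\<not> (\<tau> \<in> L \<and> int (card \<tau>) = p + 1 + 1)" for \<tau>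
  proof (cases "\<tau> \<in> L")
    case True
    have "x (\<tau> - {j}) = 0" if "j \<in> \<tau>" for j
    proof -
      have "card \<tau> = Suc (card (\<tau> - {j}))"
        using card.remove[OF assms(2)[OF True] that] .
      then have "int (card (\<tau> - {j})) \<noteq> p + 1"
        using \<open>\<not> (\<tau> \<in> L \<and> _)\<close> True by auto
      then show ?thesis using assms(1) by (simp add: simplicial_cochains_def)
    qed
    then show ?thesis by (simp add: simplicial_coboundary_def)
  qed (simp add: simplicial_coboundary_def)
  then show ?thesis by (simp add: simplicial_cochains_def)
qed

context simplicial_complex
begin

text \<open>Taking the normal form deletes the monomials \<open>u_J v_L\<close> with
  \<open>L\<close> outside \<open>K\<close>, and this restricts the coboundary from the full simplex
  to the induced subcomplex.\<close>

lemma normal_diff_cochain_to_uv: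
  assumes I: "I \<subseteq> {1..m}"
  shows "normal_diff m K (cochain_to_uv I x) =
    cochain_to_uv I (simplicial_coboundary (induced_subcomplex K I) x)"
proof -
  have fin: "finite I" using I finite_subset by auto
  show ?thesis
    unfolding normal_diff_def cochain_to_uv_coboundary[OF I]
  proof (rule uvpoly_eqI)
    fix J e
    show "Poly_Mapping.lookup (normal_form K (cochain_to_uv I (simplicial_coboundary (Pow I) x)) J) e =
        Poly_Mapping.lookup (cochain_to_uv I (simplicial_coboundary (induced_subcomplex K I) x) J) e"
    proof (cases "J \<subseteq> I \<and> e = squarefree_exponent (I - J)")
      case True
      then have "normal_monomial K J e \<longleftrightarrow> I - J \<in> K"
        using normal_monomial_squarefree[of "I - J" K I] fin by (simp add: double_diff)
      then show ?thesis
        using fin True by (simp add: lookup_restrict_support lookup_cochain_to_uv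
            simplicial_coboundary_def induced_subcomplex_def)
    qed (use fin in \<open>auto simp: lookup_restrict_support lookup_cochain_to_uv\<close>)
  qed
qed

lemma cochain_to_uv_in_normal_part:
  assumes I: "I \<subseteq> {1..m}"
    and x: "x \<in> carrier (simplicial_cochains (induced_subcomplex K I) q)"
  shows "cochain_to_uv I x \<in> normal_part m K I (q + int (card I) + 1)"
  unfolding normal_part_def supported_iff
proof (intro allI impI, rule ccontr)
  have fin: "finite I" using I finite_subset by auto
  fix J e
  assume "\<not> (normal_monomial K J e \<and> monomial_in_range m J e \<and>
      monomial_degree J e = q + int (card I) + 1 \<and> has_multidegree I J e)"
    and "Poly_Mapping.lookup (cochain_to_uv I x J) e \<noteq> 0"
  moreover from this have J: "J \<subseteq> I" "e = squarefree_exponent (I - J)" "x (I - J) \<noteq> 0"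
    using fin by (auto simp: lookup_cochain_to_uv split: if_splits)
  moreover have "I - J \<in> K" "int (card (I - J)) = q + 1"
    using x J(3) by (auto simp: simplicial_cochains_def induced_subcomplex_def)
  moreover have "I - (I - J) = J" using J(1) by auto
  moreover have "monomial_in_range m J e"
    using I J fin by (auto simp: monomial_in_range_def keys_squarefree_exponent)
  ultimately show False
    using fin monomial_degree_squarefree[OF fin, of "I - J"] normal_monomial_squarefree[of "I - J" K I]
    by (simp add: has_multidegree_iff)
qed

lemma normal_part_cochain:
  fixes h :: "'k::comm_ring_1 uvpoly"
  assumes I: "I \<subseteq> {1..m}" and h: "h \<in> normal_part m K I p"
  obtains x where "x \<in> carrier (simplicial_cochains (induced_subcomplex K I) (p - int (card I) - 1))"
    "h = cochain_to_uv I x"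
proof
  have fin: "finite I" using I finite_subset by auto
  \<comment> \<open>\<open>x\<close> reads off the coefficients of \<open>h\<close>; the factor
    \<open>position_sign\<close> undoes the equal factor in \<open>cochain_to_uv\<close>.\<close>
  define x where "x \<tau> = (if \<tau> \<subseteq> I then position_sign \<tau> I *
    Poly_Mapping.lookup (h (I - \<tau>)) (squarefree_exponent \<tau>) else 0)" for \<tau>
  have "\<tau> \<in> induced_subcomplex K I \<and> int (card \<tau>) = p - int (card I) - 1 + 1" if "x \<tau> \<noteq> 0" for \<tau>
  proof -
    have \<tau>: "\<tau> \<subseteq> I" "Poly_Mapping.lookup (h (I - \<tau>)) (squarefree_exponent \<tau>) \<noteq> 0"
      using that by (auto simp: x_def split: if_splits)
    then have "normal_monomial K (I - \<tau>) (squarefree_exponent \<tau>)"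
      "monomial_degree (I - \<tau>) (squarefree_exponent \<tau>) = p"
      using h unfolding normal_part_def supported_iff by blast+
    moreover have "finite \<tau>" using \<tau>(1) fin finite_subset by auto
    ultimately show ?thesis
      using \<tau>(1) fin by (simp add: normal_monomial_squarefree monomial_degree_squarefree
          induced_subcomplex_def)
  qed
  then show "x \<in> carrier (simplicial_cochains (induced_subcomplex K I) (p - int (card I) - 1))"
    unfolding simplicial_cochains_def by fastforce
  show "h = cochain_to_uv I x"
  proof (rule uvpoly_eqI)
    fix J e
    show "Poly_Mapping.lookup (h J) e = Poly_Mapping.lookup (cochain_to_uv I x J) e"
    proof (cases "J \<subseteq> I \<and> e = squarefree_exponent (I - J)")
      case True
      then show ?thesis
        using fin by (simp add: lookup_cochain_to_uv x_def double_diff position_sign_square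
            flip: mult.assoc)
    next
      case False
      then have "\<not> has_multidegree I J e" using fin by (simp add: has_multidegree_iff)
      then have "Poly_Mapping.lookup (h J) e = 0"
        using h by (simp add: normal_part_def supported_iff)
      then show ?thesis using False fin by (auto simp: lookup_cochain_to_uv)
    qed
  qed
qed

lemma induced_subcomplex_finite: "\<sigma> \<in> induced_subcomplex K I \<Longrightarrow> finite \<sigma>"
  using complex finite_subset[of \<sigma> "{1..m}"]
  unfolding induced_subcomplex_def simplicial_complex_on_def by blast

text \<open>Degree \<open>p\<close> and multidegree \<open>I\<close> correspond to simplicial degree
  \<open>p - |I| - 1\<close>. In this form the vanishing conditions enter the induction.\<close>

lemma normal_part_exact:
  fixes h :: "'k::comm_ring_1 uvpoly"
  assumes I: "I \<subseteq> {1..m}"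
    and trivial: "trivial_group (reduced_cohomology (induced_subcomplex K I) (p - int (card I) - 1) ::
      (nat set \<Rightarrow> 'k) set monoid)"
    and h: "h \<in> normal_part m K I p" "normal_diff m K h = 0"
  shows "\<exists>w\<in>normal_part m K I (p - 1). normal_diff m K w = h"
proof -
  let ?L = "induced_subcomplex K I" and ?q = "p - int (card I) - 1"
  have fin: "finite I" using I finite_subset by auto
  obtain x where x: "x \<in> carrier (simplicial_cochains ?L ?q)" "h = cochain_to_uv I x"
    using normal_part_cochain[OF I h(1)] .
  have "simplicial_coboundary ?L x \<tau> = 0" for \<tau>
  proof (cases "\<tau> \<subseteq> I")
    case True
    then show ?thesis
      using cochain_to_uv_eq_zeroD[OF fin] h(2) x(2) by (simp add: normal_diff_cochain_to_uv[OF I])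
  qed (simp add: simplicial_coboundary_def induced_subcomplex_def)
  then have "x \<in> cocycles (simplicial_cochains ?L) (simplicial_coboundary ?L) ?q"
    using x(1) by (simp add: cocycles_def simplicial_cochains_def fun_eq_iff)
  then have "\<exists>y\<in>carrier (simplicial_cochains ?L (?q - 1)). simplicial_coboundary ?L y = x"
    by (rule exact_of_trivial_cohomology[OF trivial[unfolded reduced_cohomology_def],
        where y\<^sub>0 = "\<lambda>_. 0"]) (simp_all add: simplicial_cochains_def simplicial_coboundary_def cong: if_cong)
  then obtain y where y: "y \<in> carrier (simplicial_cochains ?L (?q - 1))"
    "simplicial_coboundary ?L y = x"
    by blast
  have "cochain_to_uv I y \<in> normal_part m K I (p - 1)"
    using cochain_to_uv_in_normal_part[OF I y(1)] by simp
  moreover have "normal_diff m K (cochain_to_uv I y) = h"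
    using y(2) x(2) by (simp add: normal_diff_cochain_to_uv[OF I])
  ultimately show ?thesis by blast
qed

text \<open>A primitive obtained from equal cohomology classes is known only to have the right
  degree. Its component of multidegree \<open>I\<close> is still a primitive, because
  \<open>h\<close> has multidegree \<open>I\<close> and the differential respects
  multidegrees.\<close>

lemma normal_diff_primitive_in_normal_part:
  assumes h: "h \<in> normal_part m K I (p + 1)"
    and y: "y \<in> uv_degree_part m p" "normal_form K y = y" "normal_diff m K y = h"
  shows "\<exists>w\<in>normal_part m K I p. normal_diff m K w = h"
proof
  let ?w = "restrict_support (has_multidegree I) y"
  have "y \<in> supported (normal_monomial K)" using y(2) by (simp add: restrict_support_eq_iff)
  then have "?w \<in> supported (normal_monomial K) \<inter> (uv_degree_part m p \<inter> supported (has_multidegree I))"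
    using y(1) by (simp add: uv_degree_part_eq restrict_support_preserves_supported
        restrict_support_in_supported)
  then show "?w \<in> normal_part m K I p"
    by (simp add: normal_part_def uv_degree_part_eq supported_Int)
  have "h \<in> supported (has_multidegree I)"
    using h unfolding normal_part_def by (rule supported_mono) simp
  then have "restrict_support (has_multidegree I) h = h"
    by (simp add: restrict_support_eq_iff)
  then show "normal_diff m K ?w = h"
    using y(3) unfolding normal_diff_def restrict_has_multidegree_diff[symmetric]
    by (metis restrict_support_commute)
qed

end


section \<open>Massey products in \<open>R\<^sup>*(K)\<close>\<close>

lemma dga_class_eq:
  "dga_class A p x = (\<lambda>y. differential A y \<oplus>\<^bsub>A\<^esub> x) ` graded_part A (p - 1)"
  by (auto simp: dga_class_def cohomology_class_def coboundaries_def dga_cochains_def r_coset_def)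

lemma multigraded_defining_system_entry:
  assumes "multigraded_defining_system A M I k n \<alpha> C a" "1 \<le> i" "i < j" "j \<le> k + 1"
  shows "C i j \<in> graded_part A (entry_degree n i j)" "C i j \<in> M (\<Union>l\<in>{i..<j}. I l)"
proof -
  have "i \<in> {1..k+1}" "j \<in> {1..k+1}" using assms(2-4) by auto
  then show "C i j \<in> graded_part A (entry_degree n i j)"
    using assms(1,3) unfolding multigraded_defining_system_def defining_system_def by meson
  show "C i j \<in> M (\<Union>l\<in>{i..<j}. I l)"
    using assms unfolding multigraded_defining_system_def by blast
qed

context simplicial_complex
begin

section \<open>Cohomology classes in \<open>R_algebra m K\<close>\<close>

lemma normal_part_in_carrier: "x \<in> normal_part m K I p \<Longrightarrow> x \<in> carrier (uv_algebra m)"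
  using uv_degree_part_subset_carrier by (auto simp: normal_part_alt)

lemma normal_rep_R_proj_normal_part:
  "x \<in> normal_part m K I p \<Longrightarrow> normal_rep K (R_proj m K x) = x"
  by (simp add: normal_rep_R_proj normal_part_in_carrier) (simp add: normal_part_alt)

lemma R_proj_normal_part:
  assumes "x \<in> normal_part m K I p"
  shows "R_proj m K x \<in> graded_part (R_algebra m K) p \<inter> R_multidegree_part m K I"
  using assms by (auto simp: normal_part_alt graded_part_R_algebra R_multidegree_part_def)

lemma normal_rep_in_normal_part:
  assumes "Y \<in> graded_part (R_algebra m K) p" "Y \<in> R_multidegree_part m K I"
  shows "normal_rep K Y \<in> normal_part m K I p"
proof -
  have "Y \<in> carrier (R_algebra m K)" using assms(1) graded_part_subset_carrier by auto
  then show ?thesis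
    using assms by (simp add: normal_part_alt normal_rep(2) in_graded_part_iff in_multidegree_part_iff)
qed

lemma dga_class_subset:
  fixes a b y :: "'k::comm_ring_1 uvpoly set"
  assumes y: "y \<in> graded_part (R_algebra m K) (p - 1)" and b: "b \<in> carrier (R_algebra m K)"
    and a: "a = differential (R_algebra m K) y \<oplus>\<^bsub>R_algebra m K\<^esub> b"
  shows "dga_class (R_algebra m K) p a \<subseteq> dga_class (R_algebra m K) p b"
proof
  interpret ring "R_algebra m K :: 'k uvpoly set dga" by (rule ring_R_algebra)
  fix w assume "w \<in> dga_class (R_algebra m K) p a"
  then obtain z where z: "z \<in> graded_part (R_algebra m K) (p - 1)"
    "w = differential (R_algebra m K) z \<oplus>\<^bsub>R_algebra m K\<^esub> a"
    by (auto simp: dga_class_eq)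
  have car: "z \<in> carrier (R_algebra m K)" "y \<in> carrier (R_algebra m K)"
    using z(1) y graded_part_subset_carrier by auto
  then have "normal_rep K z \<in> uv_degree_part m (p - 1)" "normal_rep K y \<in> uv_degree_part m (p - 1)"
    using z(1) y by (simp_all add: in_graded_part_iff)
  then have "normal_rep K (z \<oplus>\<^bsub>R_algebra m K\<^esub> y) \<in> uv_degree_part m (p - 1)"
    using car by (simp add: normal_rep_add uv_degree_part_eq supported_add)
  then have "z \<oplus>\<^bsub>R_algebra m K\<^esub> y \<in> graded_part (R_algebra m K) (p - 1)"
    using car by (simp add: in_graded_part_iff)
  moreover have "w = differential (R_algebra m K) (z \<oplus>\<^bsub>R_algebra m K\<^esub> y) \<oplus>\<^bsub>R_algebra m K\<^esub> b"
  proof (rule normal_rep_inject)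
    show "w \<in> carrier (R_algebra m K)"
      using z(2) b a car by (simp add: differential_in_carrier)
    show "differential (R_algebra m K) (z \<oplus>\<^bsub>R_algebra m K\<^esub> y) \<oplus>\<^bsub>R_algebra m K\<^esub> b \<in>
        carrier (R_algebra m K)"
      using b car by (simp add: differential_in_carrier)
    show "normal_rep K w =
        normal_rep K (differential (R_algebra m K) (z \<oplus>\<^bsub>R_algebra m K\<^esub> y) \<oplus>\<^bsub>R_algebra m K\<^esub> b)"
      using z(2) b a car
      by (simp add: differential_in_carrier normal_rep_add normal_rep_differential normal_diff_def
          uv_diff_add restrict_support_add add.assoc)
  qed
  ultimately show "w \<in> dga_class (R_algebra m K) p b"
    by (auto simp: dga_class_eq)
qed

lemma dga_class_eqI:
  fixes a b :: "'k::comm_ring_1 uvpoly set"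
  assumes y: "y \<in> normal_part m K I (p - 1)"
    and ab: "a \<in> carrier (R_algebra m K)" "b \<in> carrier (R_algebra m K)"
    and diff: "normal_rep K a - normal_rep K b = normal_diff m K y"
  shows "dga_class (R_algebra m K) p a = dga_class (R_algebra m K) p b"
proof
  interpret ring "R_algebra m K :: 'k uvpoly set dga" by (rule ring_R_algebra)
  have y': "- y \<in> normal_part m K I (p - 1)"
    using y by (simp add: normal_part_def supported_uminus)
  have "normal_diff m K (- y) = - normal_diff m K y"
    using uv_diff_minus[of m 0 y]
    by (simp add: normal_diff_def uv_diff_zero restrict_support_uminus)
  then have *: "normal_rep K a = normal_diff m K y + normal_rep K b"
    "normal_rep K b = normal_diff m K (- y) + normal_rep K a"
    using diff by (simp_all add: algebra_simps)
  have graded: "R_proj m K y \<in> graded_part (R_algebra m K) (p - 1)"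
    "R_proj m K (- y) \<in> graded_part (R_algebra m K) (p - 1)"
    using R_proj_normal_part[OF y] R_proj_normal_part[OF y'] by auto
  then have car: "R_proj m K y \<in> carrier (R_algebra m K)" "R_proj m K (- y) \<in> carrier (R_algebra m K)"
    using graded_part_subset_carrier by auto
  have "a = differential (R_algebra m K) (R_proj m K y) \<oplus>\<^bsub>R_algebra m K\<^esub> b"
    by (rule normal_rep_inject) (simp_all add: ab car differential_in_carrier normal_rep_add
        normal_rep_differential normal_rep_R_proj_normal_part[OF y] *(1))
  then show "dga_class (R_algebra m K) p a \<subseteq> dga_class (R_algebra m K) p b"
    using graded ab by (intro dga_class_subset)
  have "b = differential (R_algebra m K) (R_proj m K (- y)) \<oplus>\<^bsub>R_algebra m K\<^esub> a"
    by (rule normal_rep_inject) (simp_all add: ab car differential_in_carrier normal_rep_add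
        normal_rep_differential normal_rep_R_proj_normal_part[OF y'] *(2)[symmetric])
  then show "dga_class (R_algebra m K) p b \<subseteq> dga_class (R_algebra m K) p a"
    using graded ab by (intro dga_class_subset)
qed

text \<open>Since 0 is homogeneous of every degree, a class contains its representative. So
  \<open>a\<close> lies in the class of \<open>b\<close> and differs from \<open>b\<close> by a
  coboundary, whose primitive is cut down to multidegree \<open>I\<close>.\<close>

lemma dga_class_primitive:
  fixes a b :: "'k::comm_ring_1 uvpoly set"
  assumes "a \<in> graded_part (R_algebra m K) p" "a \<in> R_multidegree_part m K I"
    and "b \<in> graded_part (R_algebra m K) p" "b \<in> R_multidegree_part m K I"
    and eq: "dga_class (R_algebra m K) p a = dga_class (R_algebra m K) p b"
  shows "\<exists>w\<in>normal_part m K I (p - 1). normal_diff m K w = normal_rep K a - normal_rep K b"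
proof -
  interpret ring "R_algebra m K :: 'k uvpoly set dga" by (rule ring_R_algebra)
  have car: "a \<in> carrier (R_algebra m K)" "b \<in> carrier (R_algebra m K)"
    using assms graded_part_subset_carrier by auto
  have zero: "(\<zero>\<^bsub>R_algebra m K\<^esub> :: 'k uvpoly set) \<in> graded_part (R_algebra m K) (p - 1)"
    by (simp add: in_graded_part_iff normal_rep_zero uv_degree_part_eq supported_zero)
  have "differential (R_algebra m K) \<zero>\<^bsub>R_algebra m K\<^esub> = (\<zero>\<^bsub>R_algebra m K\<^esub> :: 'k uvpoly set)"
    by (simp add: R_algebra_zero R_algebra_differential carrier_uv_algebra supported_zero uv_diff_zero)
  then have "a = differential (R_algebra m K) \<zero>\<^bsub>R_algebra m K\<^esub> \<oplus>\<^bsub>R_algebra m K\<^esub> a"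
    using car by simp
  then have "a \<in> dga_class (R_algebra m K) p a"
    using zero unfolding dga_class_eq by (rule image_eqI)
  then obtain y where y: "y \<in> graded_part (R_algebra m K) (p - 1)"
    "a = differential (R_algebra m K) y \<oplus>\<^bsub>R_algebra m K\<^esub> b"
    unfolding eq by (auto simp: dga_class_eq)
  have y_car: "y \<in> carrier (R_algebra m K)" using y(1) graded_part_subset_carrier by auto
  have "normal_rep K a - normal_rep K b = normal_diff m K (normal_rep K y)"
    unfolding y(2) using y_car car
    by (simp add: normal_rep_add normal_rep_differential differential_in_carrier)
  moreover have "normal_rep K a - normal_rep K b \<in> normal_part m K I (p - 1 + 1)"
    using normal_rep_in_normal_part[OF assms(1,2)] normal_rep_in_normal_part[OF assms(3,4)]
    by (simp add: normal_part_def supported_diff)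
  moreover have "normal_rep K y \<in> uv_degree_part m (p - 1)"
    using y(1) y_car by (simp add: in_graded_part_iff)
  ultimately show ?thesis
    using normal_rep(2)[OF y_car]
    by (intro normal_diff_primitive_in_normal_part) auto
qed

text \<open>\<open>class_to_R\<close> is a union over all cocycles in \<alpha>. These differ by
  coboundaries, so all of them give the same class and any one serves as \<open>c\<close>.\<close>

lemma class_to_R_representative:
  fixes \<alpha> :: "(nat set \<Rightarrow> 'k::comm_ring_1) set"
  assumes I: "I \<subseteq> {1..m}"
    and \<alpha>: "\<alpha> \<in> carrier (reduced_cohomology (induced_subcomplex K I) d)"
  shows "\<exists>c\<in>normal_part m K I (d + int (card I) + 1). normal_diff m K c = 0 \<and>
    dga_class (R_algebra m K) (d + int (card I) + 1) (R_proj m K c) = class_to_R m K I d \<alpha>"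
proof -
  let ?L = "induced_subcomplex K I" and ?p = "d + int (card I) + 1"
  interpret ring "R_algebra m K :: 'k uvpoly set dga" by (rule ring_R_algebra)
  have fin: "finite I" using I finite_subset by auto
  obtain x where x: "x \<in> cocycles (simplicial_cochains ?L) (simplicial_coboundary ?L) d"
    "\<alpha> = (\<lambda>y. simplicial_coboundary ?L y \<otimes>\<^bsub>simplicial_cochains ?L d\<^esub> x) `
      carrier (simplicial_cochains ?L (d - 1))"
    using cocycle_of_cohomology[OF \<alpha>[unfolded reduced_cohomology_def]] .
  have x_cochain: "x \<in> carrier (simplicial_cochains ?L d)" "simplicial_coboundary ?L x = (\<lambda>_. 0)"
    using x(1) by (auto simp: cocycles_def simplicial_cochains_def)
  have c: "cochain_to_uv I x \<in> normal_part m K I ?p"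
    using cochain_to_uv_in_normal_part[OF I x_cochain(1)] .
  have "normal_diff m K (cochain_to_uv I x) = 0"
    unfolding normal_diff_cochain_to_uv[OF I] x_cochain(2)
    using fin by (intro uvpoly_eqI) (simp add: lookup_cochain_to_uv)
  moreover have "dga_class (R_algebra m K) ?p (R_proj m K (cochain_to_uv I x')) =
      dga_class (R_algebra m K) ?p (R_proj m K (cochain_to_uv I x))" if "x' \<in> \<alpha>" for x'
  proof -
    obtain y where y: "y \<in> carrier (simplicial_cochains ?L (d - 1))"
      "x' = (\<lambda>\<sigma>. simplicial_coboundary ?L y \<sigma> + x \<sigma>)"
      using \<open>x' \<in> \<alpha>\<close> x(2) by (auto simp: simplicial_cochains_def)
    have "simplicial_coboundary ?L y \<in> carrier (simplicial_cochains ?L d)"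
      using simplicial_coboundary_in_cochains[OF y(1)] induced_subcomplex_finite by simp
    then have "x' \<in> carrier (simplicial_cochains ?L d)"
      using x_cochain(1) y(2) by (simp add: simplicial_cochains_def)
    then have c': "cochain_to_uv I x' \<in> normal_part m K I ?p"
      using cochain_to_uv_in_normal_part[OF I] by blast
    have "cochain_to_uv I y \<in> normal_part m K I (?p - 1)"
      using cochain_to_uv_in_normal_part[OF I y(1)] by simp
    moreover have "R_proj m K (cochain_to_uv I x') \<in> carrier (R_algebra m K)"
      "R_proj m K (cochain_to_uv I x) \<in> carrier (R_algebra m K)"
      using c c' by (auto intro: R_proj_in_carrier normal_part_in_carrier)
    moreover have "normal_rep K (R_proj m K (cochain_to_uv I x')) -
        normal_rep K (R_proj m K (cochain_to_uv I x)) = normal_diff m K (cochain_to_uv I y)"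
      unfolding normal_rep_R_proj_normal_part[OF c] normal_rep_R_proj_normal_part[OF c']
      unfolding normal_diff_cochain_to_uv[OF I] y(2) cochain_to_uv_add[OF fin] by simp
    ultimately show ?thesis by (rule dga_class_eqI)
  qed
  then have "class_to_R m K I d \<alpha> = dga_class (R_algebra m K) ?p (R_proj m K (cochain_to_uv I x))"
    unfolding class_to_R_def using x(2)
    by (intro SUP_eq_const) (auto simp: simplicial_cochains_def)
  ultimately show ?thesis using c by blast
qed

end

locale massey_multidegrees = simplicial_complex m K for m K +
  fixes I :: "nat \<Rightarrow> nat set" and k :: nat
  assumes I_subset: "j \<in> {1..k} \<Longrightarrow> I j \<subseteq> {1..m}"
    and I_disjoint: "disjoint_family_on I {1..k}"
begin

text \<open>Half-open, so that \<open>interval i j\<close> is the multidegree of the entry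
  \<open>(i, j)\<close> and splits disjointly at every intermediate index.\<close>

abbreviation interval :: "nat \<Rightarrow> nat \<Rightarrow> nat set" where
  "interval i j \<equiv> (\<Union>l\<in>{i..<j}. I l)"

lemma interval_subset: "1 \<le> i \<Longrightarrow> j \<le> k + 1 \<Longrightarrow> interval i j \<subseteq> {1..m}"
  by (intro UN_least I_subset) auto

lemma interval_graded_dga_normal:
  "interval_graded_dga (normal_mult K :: 'k::comm_ring_1 uvpoly \<Rightarrow> _) (normal_diff m K)
    (\<lambda>i j. normal_part m K (interval i j)) k (entry_degree n)"
proof
  fix x y z :: "'k uvpoly" and i j r :: nat and p q :: int
  show "normal_mult K (x + y) z = normal_mult K x z + normal_mult K y z"
    by (simp add: normal_mult_def uv_mult_add_left restrict_support_add)
  show "normal_mult K x (y + z) = normal_mult K x y + normal_mult K x z"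
    by (simp add: normal_mult_def uv_mult_add_right restrict_support_add)
  show "normal_mult K (normal_mult K x y) z = normal_mult K x (normal_mult K y z)"
    by (rule normal_mult_assoc)
  show "normal_diff m K (x + y) = normal_diff m K x + normal_diff m K y"
    by (simp add: normal_diff_def uv_diff_add restrict_support_add)
  show "normal_diff m K (normal_diff m K x) = 0"
    by (rule normal_diff_diff)
  show "(0 :: 'k uvpoly) \<in> normal_part m K (interval i j) p"
    by (simp add: normal_part_def supported_zero)
  {
    assume x: "x \<in> normal_part m K (interval i j) p"
    then show "normal_diff m K (normal_mult K x y) =
        normal_mult K (normal_diff m K x) y + parity_sign p (normal_mult K x (normal_diff m K y))"
      by (intro normal_diff_mult) (simp add: normal_part_alt)
    show "- x \<in> normal_part m K (interval i j) p"
      using x by (simp add: normal_part_def supported_uminus)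
    show "normal_diff m K x \<in> normal_part m K (interval i j) (p + 1)"
      using x by (rule normal_diff_in_normal_part)
    assume "y \<in> normal_part m K (interval i j) p"
    with x show "x + y \<in> normal_part m K (interval i j) p"
      by (simp add: normal_part_def supported_add)
  }
  {
    assume ir: "1 \<le> i" "i < r" "r < j" "j \<le> k + 1"
      and xy: "x \<in> normal_part m K (interval i r) p" "y \<in> normal_part m K (interval r j) q"
    have "I l \<inter> I l' = {}" if "l \<in> {i..<r}" "l' \<in> {r..<j}" for l l'
      using ir that by (intro disjoint_family_onD[OF I_disjoint]) auto
    then have "interval i r \<inter> interval r j = {}" by blast
    moreover have "interval i j = interval i r \<union> interval r j"
    proof -
      have "{i..<j} = {i..<r} \<union> {r..<j}" using ir by auto
      then show ?thesis by (simp only: UN_Un)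
    qed
    ultimately show "normal_mult K x y \<in> normal_part m K (interval i j) (p + q)"
      using normal_mult_in_normal_part[OF xy] by simp
  }
  {
    assume "i < r" "r < j"
    then have "(\<Sum>l\<in>{i..<j}. n l) = (\<Sum>l\<in>{i..<r}. n l) + (\<Sum>l\<in>{r..<j}. n l)"
      by (simp add: sum.atLeastLessThan_concat)
    then show "entry_degree n i r + entry_degree n r j = entry_degree n i j + 1"
      by (simp add: entry_degree_def)
  }
qed

text \<open>Entries on and below the diagonal vanish, which shrinks the sum over all
  \<open>r\<close> to the indices strictly between \<open>i\<close> and \<open>j\<close>, as in
  \<open>twisted_square\<close>.\<close>

lemma normal_rep_defect:
  fixes C :: "nat \<Rightarrow> nat \<Rightarrow> 'k::comm_ring_1 uvpoly set"
  assumes C: "\<And>i j. i \<in> {1..k+1} \<Longrightarrow> j \<in> {1..k+1} \<Longrightarrow> C i j \<in> carrier (R_algebra m K)"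
    and C0: "\<And>i j. i \<in> {1..k+1} \<Longrightarrow> j \<in> {1..k+1} \<Longrightarrow> \<not> i < j \<Longrightarrow> C i j = \<zero>\<^bsub>R_algebra m K\<^esub>"
    and ij: "i \<in> {1..k+1}" "j \<in> {1..k+1}"
  shows "differential (R_algebra m K) (C i j) \<ominus>\<^bsub>R_algebra m K\<^esub>
      (\<Oplus>\<^bsub>R_algebra m K\<^esub>r\<in>{1..k+1}. signed (R_algebra m K) (q r) (C i r) \<otimes>\<^bsub>R_algebra m K\<^esub> C r j)
      \<in> carrier (R_algebra m K)" (is "?Y \<in> _")
    and "normal_rep K (differential (R_algebra m K) (C i j) \<ominus>\<^bsub>R_algebra m K\<^esub>
      (\<Oplus>\<^bsub>R_algebra m K\<^esub>r\<in>{1..k+1}. signed (R_algebra m K) (q r) (C i r) \<otimes>\<^bsub>R_algebra m K\<^esub> C r j)) =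
      normal_diff m K (normal_rep K (C i j)) -
      (\<Sum>r\<in>{i<..<j}. parity_sign (q r) (normal_mult K (normal_rep K (C i r)) (normal_rep K (C r j))))"
proof -
  interpret ring "R_algebra m K :: 'k uvpoly set dga" by (rule ring_R_algebra)
  \<comment> \<open>Only linearity of the product and its behaviour under signs are taken from this
    interpretation, and they do not depend on the degree function; \<open>\<lambda>_. 0\<close> is a
    placeholder.\<close>
  interpret N: interval_graded_dga "normal_mult K :: 'k uvpoly \<Rightarrow> _" "normal_diff m K"
    "\<lambda>i j. normal_part m K (interval i j)" k "entry_degree (\<lambda>_. 0)"
    by (rule interval_graded_dga_normal)
  have signed_car: "signed (R_algebra m K) (q r) (C i r) \<in> carrier (R_algebra m K)"
    if "r \<in> {1..k+1}" for r
    using C[OF ij(1) that] by (simp add: signed_def)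
  have term_car: "signed (R_algebra m K) (q r) (C i r) \<otimes>\<^bsub>R_algebra m K\<^esub> C r j \<in> carrier (R_algebra m K)"
    if "r \<in> {1..k+1}" for r
    using signed_car[OF that] C[OF that ij(2)] by (rule m_closed)
  have rep_term: "normal_rep K (signed (R_algebra m K) (q r) (C i r) \<otimes>\<^bsub>R_algebra m K\<^esub> C r j) =
      parity_sign (q r) (normal_mult K (normal_rep K (C i r)) (normal_rep K (C r j)))"
    if "r \<in> {1..k+1}" for r
    unfolding normal_rep_mult[OF signed_car[OF that] C[OF that ij(2)]] N.mul_parity_sign_left[symmetric]
    using C[OF ij(1) that] by (simp add: signed_def parity_sign_def normal_rep_uminus)
  have sum_car: "(\<Oplus>\<^bsub>R_algebra m K\<^esub>r\<in>{1..k+1}.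
      signed (R_algebra m K) (q r) (C i r) \<otimes>\<^bsub>R_algebra m K\<^esub> C r j) \<in> carrier (R_algebra m K)"
    using term_car by (intro finsum_closed) auto
  show "?Y \<in> carrier (R_algebra m K)"
    using sum_car C[OF ij] by (intro minus_closed differential_in_carrier)
  have "normal_rep K (\<Oplus>\<^bsub>R_algebra m K\<^esub>r\<in>{1..k+1}.
        signed (R_algebra m K) (q r) (C i r) \<otimes>\<^bsub>R_algebra m K\<^esub> C r j) =
      (\<Sum>r\<in>{1..k+1}. parity_sign (q r) (normal_mult K (normal_rep K (C i r)) (normal_rep K (C r j))))"
    using term_car rep_term by (subst normal_rep_finsum) (auto intro!: sum.cong)
  also have "\<dots> =
      (\<Sum>r\<in>{i<..<j}. parity_sign (q r) (normal_mult K (normal_rep K (C i r)) (normal_rep K (C r j))))"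
  proof (rule sum.mono_neutral_right)
    show "{i<..<j} \<subseteq> {1..k+1}" using ij by auto
    show "\<forall>r\<in>{1..k+1} - {i<..<j}.
        parity_sign (q r) (normal_mult K (normal_rep K (C i r)) (normal_rep K (C r j))) = 0"
    proof
      fix r assume r: "r \<in> {1..k+1} - {i<..<j}"
      then have "C i r = \<zero>\<^bsub>R_algebra m K\<^esub> \<or> C r j = \<zero>\<^bsub>R_algebra m K\<^esub>"
        using C0 ij by (cases "i < r") auto
      then show "parity_sign (q r) (normal_mult K (normal_rep K (C i r)) (normal_rep K (C r j))) = 0"
        by (auto simp: normal_rep_zero N.left.zero N.right.zero)
    qed
  qed simp
  finally show "normal_rep K ?Y = normal_diff m K (normal_rep K (C i j)) -
      (\<Sum>r\<in>{i<..<j}. parity_sign (q r) (normal_mult K (normal_rep K (C i r)) (normal_rep K (C r j))))"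
    using sum_car C[OF ij]
    by (simp add: normal_rep_minus differential_in_carrier normal_rep_differential)
qed

lemma massey_system_of_defining_system:
  fixes C :: "nat \<Rightarrow> nat \<Rightarrow> 'k::comm_ring_1 uvpoly set"
  assumes "multigraded_defining_system (R_algebra m K) (R_multidegree_part m K) I k n \<alpha> C a"
  shows "interval_graded_dga.massey_system (normal_mult K) (normal_diff m K)
    (\<lambda>i j. normal_part m K (interval i j)) k (entry_degree n) (\<lambda>i j. normal_rep K (C i j))
    (normal_rep K a)"
proof -
  interpret ring "R_algebra m K :: 'k uvpoly set dga" by (rule ring_R_algebra)
  interpret N: interval_graded_dga "normal_mult K :: 'k uvpoly \<Rightarrow> _" "normal_diff m K"
    "\<lambda>i j. normal_part m K (interval i j)" k "entry_degree n"
    by (rule interval_graded_dga_normal)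
  have graded: "C i j \<in> graded_part (R_algebra m K) (entry_degree n i j)"
    and multi: "C i j \<in> R_multidegree_part m K (interval i j)"
    if "1 \<le> i" "i < j" "j \<le> k + 1" for i j
    using multigraded_defining_system_entry[OF assms that] by blast+
  have zero: "C i j = \<zero>\<^bsub>R_algebra m K\<^esub>" if "i \<in> {1..k+1}" "j \<in> {1..k+1}" "\<not> i < j" for i j
    using assms that unfolding multigraded_defining_system_def defining_system_def by meson
  have car: "C i j \<in> carrier (R_algebra m K)" if "i \<in> {1..k+1}" "j \<in> {1..k+1}" for i j
  proof (cases "i < j")
    case True
    then show ?thesis using graded[of i j] graded_part_subset_carrier that by auto
  qed (use zero that in simp)
  have eq: "differential (R_algebra m K) (C i j) \<ominus>\<^bsub>R_algebra m K\<^esub>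
      (\<Oplus>\<^bsub>R_algebra m K\<^esub>r\<in>{1..k+1}.
        signed (R_algebra m K) (entry_degree n i r) (C i r) \<otimes>\<^bsub>R_algebra m K\<^esub> C r j) =
      (if i = 1 \<and> j = k + 1 then a else \<zero>\<^bsub>R_algebra m K\<^esub>)"
    if "i \<in> {1..k+1}" "j \<in> {1..k+1}" for i j
    using assms that unfolding multigraded_defining_system_def defining_system_def by blast
  show ?thesis
    unfolding N.massey_system_def N.twisted_square_def
  proof (intro allI impI conjI; elim conjE)
    fix i j assume ij: "1 \<le> i" "i < j" "j \<le> k + 1"
    show "normal_rep K (C i j) \<in> normal_part m K (interval i j) (entry_degree n i j)"
      using graded[OF ij] multi[OF ij] by (rule normal_rep_in_normal_part)
    have "normal_diff m K (normal_rep K (C i j)) -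
        (\<Sum>r\<in>{i<..<j}. parity_sign (entry_degree n i r)
          (normal_mult K (normal_rep K (C i r)) (normal_rep K (C r j)))) =
        normal_rep K (if i = 1 \<and> j = k + 1 then a else \<zero>\<^bsub>R_algebra m K\<^esub>)"
      using normal_rep_defect(2)[of C i j "entry_degree n i"] car zero eq[of i j] ij by simp
    then show "normal_diff m K (normal_rep K (C i j)) =
        (\<Sum>r\<in>{i<..<j}. parity_sign (entry_degree n i r)
          (normal_mult K (normal_rep K (C i r)) (normal_rep K (C r j)))) +
        (if i = 1 \<and> j = k + 1 then normal_rep K a else 0)"
      by (auto simp: normal_rep_zero diff_eq_eq add.commute split: if_splits)
  qed
qed

text \<open>The entries are wrapped into cosets, zeros fill the other positions, and the matrix
  equation is checked on normal representatives. Membership in a normal part makes \<open>a\<close>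
  its own normal representative.\<close>

lemma defining_system_of_massey_system:
  fixes c :: "nat \<Rightarrow> nat \<Rightarrow> 'k::comm_ring_1 uvpoly"
  assumes c: "interval_graded_dga.massey_system (normal_mult K) (normal_diff m K)
      (\<lambda>i j. normal_part m K (interval i j)) k (entry_degree n) c a"
    and "k \<ge> 1"
    and a: "a \<in> normal_part m K (interval 1 (k + 1)) p"
    and \<alpha>: "\<And>i. i \<in> {1..k} \<Longrightarrow> dga_class (R_algebra m K) (n i) (R_proj m K (c i (i + 1))) = \<alpha> i"
  shows "massey_defined (R_algebra m K) (R_multidegree_part m K) I k n \<alpha>"
proof -
  interpret ring "R_algebra m K :: 'k uvpoly set dga" by (rule ring_R_algebra)
  interpret N: interval_graded_dga "normal_mult K :: 'k uvpoly \<Rightarrow> _" "normal_diff m K"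
    "\<lambda>i j. normal_part m K (interval i j)" k "entry_degree n"
    by (rule interval_graded_dga_normal)
  define C where "C i j = (if i < j then R_proj m K (c i j) else \<zero>\<^bsub>R_algebra m K\<^esub>)" for i j
  have cH: "c i j \<in> normal_part m K (interval i j) (entry_degree n i j)"
    and Dc: "normal_diff m K (c i j) = (\<Sum>r\<in>{i<..<j}. parity_sign (entry_degree n i r)
        (normal_mult K (c i r) (c r j))) + (if i = 1 \<and> j = k + 1 then a else 0)"
    if "1 \<le> i" "i < j" "j \<le> k + 1" for i j
    using c that unfolding N.massey_system_def N.twisted_square_def by blast+
  have rep: "normal_rep K (C i j) = c i j" if "1 \<le> i" "i < j" "j \<le> k + 1" for i j
    using that cH[OF that] by (simp add: C_def normal_rep_R_proj_normal_part)
  have zero: "C i j = \<zero>\<^bsub>R_algebra m K\<^esub>" if "\<not> i < j" for i j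
    using that by (simp add: C_def)
  have part: "C i j \<in> graded_part (R_algebra m K) (entry_degree n i j)"
    "C i j \<in> R_multidegree_part m K (interval i j)" if "1 \<le> i" "i < j" "j \<le> k + 1" for i j
    using R_proj_normal_part[OF cH[OF that]] that by (simp_all add: C_def)
  have car: "C i j \<in> carrier (R_algebra m K)" if "i \<in> {1..k+1}" "j \<in> {1..k+1}" for i j
  proof (cases "i < j")
    case True
    then show ?thesis using part(1)[of i j] graded_part_subset_carrier that by auto
  qed (simp add: zero)
  have a_car: "R_proj m K a \<in> carrier (R_algebra m K)"
    using a by (intro R_proj_in_carrier normal_part_in_carrier)
  have eq: "differential (R_algebra m K) (C i j) \<ominus>\<^bsub>R_algebra m K\<^esub>
      (\<Oplus>\<^bsub>R_algebra m K\<^esub>r\<in>{1..k+1}.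
        signed (R_algebra m K) (entry_degree n i r) (C i r) \<otimes>\<^bsub>R_algebra m K\<^esub> C r j) =
      (if i = 1 \<and> j = k + 1 then R_proj m K a else \<zero>\<^bsub>R_algebra m K\<^esub>)"
    if ij: "i \<in> {1..k+1}" "j \<in> {1..k+1}" for i j
  proof (rule normal_rep_inject)
    show "differential (R_algebra m K) (C i j) \<ominus>\<^bsub>R_algebra m K\<^esub>
      (\<Oplus>\<^bsub>R_algebra m K\<^esub>r\<in>{1..k+1}.
        signed (R_algebra m K) (entry_degree n i r) (C i r) \<otimes>\<^bsub>R_algebra m K\<^esub> C r j)
      \<in> carrier (R_algebra m K)"
      using normal_rep_defect(1)[of C i j] car zero ij by blast
    show "(if i = 1 \<and> j = k + 1 then R_proj m K a else \<zero>\<^bsub>R_algebra m K\<^esub>) \<in> carrier (R_algebra m K)"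
      using a_car by simp
    have "normal_diff m K (normal_rep K (C i j)) - (\<Sum>r\<in>{i<..<j}. parity_sign (entry_degree n i r)
        (normal_mult K (normal_rep K (C i r)) (normal_rep K (C r j)))) =
        (if i = 1 \<and> j = k + 1 then a else 0)"
    proof (cases "i < j")
      case True
      then have "(\<Sum>r\<in>{i<..<j}. parity_sign (entry_degree n i r)
          (normal_mult K (normal_rep K (C i r)) (normal_rep K (C r j)))) =
          (\<Sum>r\<in>{i<..<j}. parity_sign (entry_degree n i r) (normal_mult K (c i r) (c r j)))"
        using ij by (intro sum.cong) (auto simp: rep)
      then show ?thesis using Dc[of i j] rep[of i j] True ij by simp
    next
      case False
      \<comment> \<open>On and below the diagonal both sides are zero; \<open>k >= 1\<close> keeps
        the corner above the diagonal.\<close>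
      then have *: "\<not> (i = 1 \<and> j = k + 1)" "{i<..<j} = {}" using ij \<open>k \<ge> 1\<close> by auto
      show ?thesis
        unfolding if_not_P[OF *(1)] *(2) zero[OF False] normal_rep_zero N.D.zero by simp
    qed
    also have "\<dots> = normal_rep K (if i = 1 \<and> j = k + 1 then R_proj m K a else \<zero>\<^bsub>R_algebra m K\<^esub>)"
      using a by (simp add: normal_rep_R_proj_normal_part normal_rep_zero)
    finally show "normal_rep K (differential (R_algebra m K) (C i j) \<ominus>\<^bsub>R_algebra m K\<^esub>
      (\<Oplus>\<^bsub>R_algebra m K\<^esub>r\<in>{1..k+1}.
        signed (R_algebra m K) (entry_degree n i r) (C i r) \<otimes>\<^bsub>R_algebra m K\<^esub> C r j)) =
      normal_rep K (if i = 1 \<and> j = k + 1 then R_proj m K a else \<zero>\<^bsub>R_algebra m K\<^esub>)"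
      using normal_rep_defect(2)[of C i j "entry_degree n i"] car zero ij by simp
  qed
  have "multigraded_defining_system (R_algebra m K) (R_multidegree_part m K) I k n \<alpha> C (R_proj m K a)"
    unfolding multigraded_defining_system_def defining_system_def
  proof (intro conjI ballI allI impI)
    fix i j assume "i \<in> {1..k+1}" "j \<in> {1..k+1}"
    then show "if i < j then C i j \<in> graded_part (R_algebra m K) (entry_degree n i j)
        else C i j = \<zero>\<^bsub>R_algebra m K\<^esub>"
      using part(1) zero by simp
  next
    fix i assume "i \<in> {1..k}"
    then show "dga_class (R_algebra m K) (n i) (C i (i + 1)) = \<alpha> i"
      using \<alpha> by (simp add: C_def)
  next
    fix i j assume "1 \<le> i \<and> i < j \<and> j \<le> k + 1"
    then show "C i j \<in> R_multidegree_part m K (interval i j)" using part(2) by blast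
  qed (use a_car eq in blast)+
  then show ?thesis unfolding massey_defined_def by blast
qed

text \<open>The summands 1 in the degrees cancel against \<open>j - i\<close>, and disjointness adds
  up the cardinalities. Subtracting \<open>card (interval i j) + 1\<close> leaves the sum of the
  \<open>d l\<close>, the simplicial degree of the entry.\<close>

lemma entry_degree_eq:
  assumes "1 \<le> i" "i < j" "j \<le> k + 1"
  shows "entry_degree (\<lambda>l. d l + int (card (I l)) + 1) i j =
    (\<Sum>l\<in>{i..<j}. d l) + int (card (interval i j)) + 1"
proof -
  have "card (interval i j) = (\<Sum>l\<in>{i..<j}. card (I l))"
  proof (rule card_UN_disjoint)
    show "\<forall>l\<in>{i..<j}. finite (I l)"
      using I_subset assms finite_subset[of _ "{1..m}"] by fastforce
    show "\<forall>l\<in>{i..<j}. \<forall>l'\<in>{i..<j}. l \<noteq> l' \<longrightarrow> I l \<inter> I l' = {}"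
      using I_disjoint assms by (auto simp: disjoint_family_on_def)
  qed simp
  then show ?thesis
    using assms by (simp add: entry_degree_def sum.distrib of_nat_diff)
qed

end

section \<open>Strictness from the vanishing conditions\<close>

theorem lemma3p3:
  fixes K :: "nat set set" and m k :: nat and I :: "nat \<Rightarrow> nat set" and d :: "nat \<Rightarrow> int"
    and \<alpha> :: "nat \<Rightarrow> (nat set \<Rightarrow> 'k::comm_ring_1) set"
  assumes "coefficient_ring TYPE('k)"
    and "simplicial_complex_on m K"
    and "k \<ge> 3"
    and "\<And>j. j \<in> {1..k} \<Longrightarrow> I j \<subseteq> {1..m}"
    and "disjoint_family_on I {1..k}"
    and "\<And>j. j \<in> {1..k} \<Longrightarrow>
      \<alpha> j \<in> carrier (reduced_cohomology (induced_subcomplex K (I j)) (d j))"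
    and "\<And>r s. 1 \<le> r \<Longrightarrow> r \<le> k - 2 \<Longrightarrow> 1 \<le> s \<Longrightarrow> s \<le> k - r \<Longrightarrow>
      trivial_group (reduced_cohomology (induced_subcomplex K (\<Union>j\<in>{s..r+s}. I j))
        (massey_degree d s (r + s) - 1) :: (nat set \<Rightarrow> 'k) set monoid)"
    and "massey_defined (R_algebra m K) (R_multidegree_part m K) I k
        (\<lambda>j. d j + int (card (I j)) + 1)
        (\<lambda>j. class_to_R m K (I j) (d j) (\<alpha> j)) \<or>
      (\<forall>r s. 1 \<le> r \<and> r \<le> k - 2 \<and> 1 \<le> s \<and> s \<le> k - r \<longrightarrow>
        trivial_group (reduced_cohomology (induced_subcomplex K (\<Union>j\<in>{s..r+s}. I j))
          (massey_degree d s (r + s)) :: (nat set \<Rightarrow> 'k) set monoid))"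
  shows "massey_strictly_defined (R_algebra m K) (R_multidegree_part m K) I k
        (\<lambda>j. d j + int (card (I j)) + 1)
        (\<lambda>j. class_to_R m K (I j) (d j) (\<alpha> j))"
proof -
  let ?n = "\<lambda>j. d j + int (card (I j)) + 1" and ?\<alpha> = "\<lambda>j. class_to_R m K (I j) (d j) (\<alpha> j)"
  let ?A = "R_algebra m K :: 'k uvpoly set dga"
  interpret massey_multidegrees m K I k
    by standard (use assms(2,4,5) in auto)
  interpret N: interval_graded_dga "normal_mult K :: 'k uvpoly \<Rightarrow> _" "normal_diff m K"
    "\<lambda>i j. normal_part m K (interval i j)" k "entry_degree ?n"
    by (rule interval_graded_dga_normal)
  \<comment> \<open>The entry \<open>(i, j)\<close> matches \<open>s = i\<close> and
    \<open>r = j - 1 - i\<close>; being neither next to the diagonal nor the corner means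
    \<open>1 <= r\<close> and \<open>r <= k - 2\<close>. Here \<open>massey_degree\<close> is the
    simplicial degree for algebra degree \<open>entry_degree + 1\<close>, that of the products of
    entries.\<close>
  have degrees: "{i..j - 1 - i + i} = {i..<j}" "1 \<le> j - 1 - i" "j - 1 - i \<le> k - 2"
    "i \<le> k - (j - 1 - i)"
    "massey_degree d i (j - 1 - i + i) = entry_degree ?n i j + 1 - int (card (interval i j)) - 1"
    if "1 \<le> i" "i + 1 < j" "j \<le> k + 1" "\<not> (i = 1 \<and> j = k + 1)" for i j
  proof -
    show *: "{i..j - 1 - i + i} = {i..<j}" using that by auto
    show "1 \<le> j - 1 - i" "j - 1 - i \<le> k - 2" "i \<le> k - (j - 1 - i)" using that by auto
    show "massey_degree d i (j - 1 - i + i) = entry_degree ?n i j + 1 - int (card (interval i j)) - 1"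
      using that by (simp only: massey_degree_def * entry_degree_eq)
  qed
  \<comment> \<open>Condition (1) lies one below \<open>massey_degree\<close>, hence in the degree
    of the entries.\<close>
  have exact: "\<exists>w\<in>normal_part m K (interval i j) (entry_degree ?n i j - 1). normal_diff m K w = z"
    if "1 \<le> i" "i + 1 < j" "j \<le> k + 1" "\<not> (i = 1 \<and> j = k + 1)"
      "z \<in> normal_part m K (interval i j) (entry_degree ?n i j)" "normal_diff m K z = 0"
    for i j and z :: "'k uvpoly"
    using assms(7)[OF degrees(2,3)[OF that(1-4)] that(1) degrees(4)[OF that(1-4)]]
      interval_subset[of i j] that(1,3,5,6)
    unfolding degrees(1,5)[OF that(1-4)]
    by (intro normal_part_exact) simp_all
  have defined: "massey_defined ?A (R_multidegree_part m K) I k ?n ?\<alpha>"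
    using assms(8)
  proof
    assume trivial: "\<forall>r s. 1 \<le> r \<and> r \<le> k - 2 \<and> 1 \<le> s \<and> s \<le> k - r \<longrightarrow>
        trivial_group (reduced_cohomology (induced_subcomplex K (\<Union>j\<in>{s..r+s}. I j))
          (massey_degree d s (r + s)) :: (nat set \<Rightarrow> 'k) set monoid)"
    \<comment> \<open>Condition (b) gives exactness one degree higher, where
      \<open>twisted_square\<close> lies.\<close>
    have exact': "\<exists>w\<in>normal_part m K (interval i j) (entry_degree ?n i j). normal_diff m K w = z"
      if "1 \<le> i" "i + 1 < j" "j \<le> k + 1" "\<not> (i = 1 \<and> j = k + 1)"
        "z \<in> normal_part m K (interval i j) (entry_degree ?n i j + 1)" "normal_diff m K z = 0"
      for i j and z :: "'k uvpoly"
      using trivial[rule_format, of "j - 1 - i" i] degrees(2-4)[OF that(1-4)]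
        normal_part_exact[of "interval i j" "entry_degree ?n i j + 1" z]
        interval_subset[of i j] that
      unfolding degrees(1,5)[OF that(1-4)] by simp
    have "\<forall>i\<in>{1..k}. \<exists>c\<in>normal_part m K (I i) (?n i). normal_diff m K c = 0 \<and>
        dga_class ?A (?n i) (R_proj m K c) = ?\<alpha> i"
      using class_to_R_representative assms(4,6) by blast
    then obtain c where c: "\<And>i. i \<in> {1..k} \<Longrightarrow> c i \<in> normal_part m K (I i) (?n i) \<and>
        normal_diff m K (c i) = 0 \<and> dga_class ?A (?n i) (R_proj m K (c i)) = ?\<alpha> i"
      by metis
    have "\<exists>C a. N.massey_system C a \<and> (\<forall>i. 1 \<le> i \<and> i \<le> k \<longrightarrow> C i (i + 1) = c i) \<and>
        a \<in> normal_part m K (interval 1 (k + 1)) (entry_degree ?n 1 (k + 1) + 1)"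
    proof (rule N.massey_system_exists)
      show "c i \<in> normal_part m K (interval i (i + 1)) (entry_degree ?n i (i + 1)) \<and>
          normal_diff m K (c i) = 0" if "1 \<le> i" "i \<le> k" for i
        using c[of i] that by (simp add: entry_degree_def)
    qed (use exact' assms(3) in auto)
    then obtain C a where C: "N.massey_system C a" "\<forall>i. 1 \<le> i \<and> i \<le> k \<longrightarrow> C i (i + 1) = c i"
      "a \<in> normal_part m K (interval 1 (k + 1)) (entry_degree ?n 1 (k + 1) + 1)"
      by blast
    show ?thesis
      by (rule defining_system_of_massey_system[OF C(1) _ C(3)]) (use C(2) c assms(3) in auto)
  qed
  let ?P = "(\<Sum>j\<in>{1..k}. ?n j) - int k + 2"
  \<comment> \<open>Classes of values are taken in degree \<open>?P\<close>; the corner gauge term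
    has the degree of the corner entry, which is that of a primitive.\<close>
  have degree: "?P - 1 = entry_degree ?n 1 (k + 1)"
    by (simp add: entry_degree_def atLeastLessThanSuc_atLeastAtMost)
  have unique: "dga_class ?A ?P a = dga_class ?A ?P b"
    if a: "multigraded_defining_system ?A (R_multidegree_part m K) I k ?n ?\<alpha> C a"
      and b: "multigraded_defining_system ?A (R_multidegree_part m K) I k ?n ?\<alpha> C' b" for C C' a b
  proof -
    \<comment> \<open>Both matrices represent the same classes next to the diagonal, which provides
      the assumption \<open>adj\<close> of \<open>massey_system_unique\<close>.\<close>
    have "\<exists>w\<in>normal_part m K (interval i (i + 1)) (entry_degree ?n i (i + 1) - 1).
        normal_diff m K w = normal_rep K (C i (i + 1)) - normal_rep K (C' i (i + 1))"
      if i: "1 \<le> i" "i \<le> k" for i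
    proof (rule dga_class_primitive)
      have "entry_degree ?n i (i + 1) = ?n i" by (simp add: entry_degree_def)
      then show "dga_class ?A (entry_degree ?n i (i + 1)) (C i (i + 1)) =
          dga_class ?A (entry_degree ?n i (i + 1)) (C' i (i + 1))"
        using a b i unfolding multigraded_defining_system_def defining_system_def by simp
    qed (use i in \<open>auto intro!: multigraded_defining_system_entry[OF a]
        multigraded_defining_system_entry[OF b] simp del: One_nat_def\<close>)
    then have "\<exists>x\<in>normal_part m K (interval 1 (k + 1)) (entry_degree ?n 1 (k + 1)).
        normal_diff m K x = normal_rep K a - normal_rep K b"
      using assms(3) exact
      by (intro N.massey_system_unique[OF massey_system_of_defining_system[OF a]
            massey_system_of_defining_system[OF b]]) auto
    then obtain x where "x \<in> normal_part m K (interval 1 (k + 1)) (?P - 1)"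
      "normal_diff m K x = normal_rep K a - normal_rep K b"
      unfolding degree by blast
    moreover have "a \<in> carrier ?A" "b \<in> carrier ?A"
      using a b unfolding multigraded_defining_system_def defining_system_def by auto
    ultimately show ?thesis by (intro dga_class_eqI) auto
  qed
  define prods where "prods = massey_product ?A (R_multidegree_part m K) I k ?n ?\<alpha>"
  have prods_iff: "x \<in> prods \<longleftrightarrow> (\<exists>C a. x = dga_class ?A ?P a \<and>
      multigraded_defining_system ?A (R_multidegree_part m K) I k ?n ?\<alpha> C a)" for x
    unfolding prods_def massey_product_def mem_Collect_eq by (rule refl)
  obtain C a where "multigraded_defining_system ?A (R_multidegree_part m K) I k ?n ?\<alpha> C a"
    using defined unfolding massey_defined_def by (elim exE)
  then have "dga_class ?A ?P a \<in> prods"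
    by (rule prods_iff[THEN iffD2, OF exI[of _ C], OF exI[of _ a], OF conjI[OF refl]])
  then have "prods \<noteq> {}"
    by (simp only: ex_in_conv[symmetric]) (rule exI)
  then have "is_singleton prods"
  proof (rule is_singletonI')
    fix x y assume "x \<in> prods" "y \<in> prods"
    obtain C a where a: "x = dga_class ?A ?P a"
      "multigraded_defining_system ?A (R_multidegree_part m K) I k ?n ?\<alpha> C a"
      using prods_iff[THEN iffD1, OF \<open>x \<in> prods\<close>] by (elim exE conjE)
    obtain C' b where b: "y = dga_class ?A ?P b"
      "multigraded_defining_system ?A (R_multidegree_part m K) I k ?n ?\<alpha> C' b"
      using prods_iff[THEN iffD1, OF \<open>y \<in> prods\<close>] by (elim exE conjE)
    show "x = y" unfolding a(1) b(1) using a(2) b(2) by (rule unique)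
  qed
  then show ?thesis
    unfolding massey_strictly_defined_def prods_def using defined by (intro conjI)
qed

end
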